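(* For every $n\geq 4.5\times 10^6$, the graph $K_2\nabla P_{n-2}$ is the unique graph (up to isomorphism) attaining the maximum spectral radius among all planar graphs of order $n$.
   Context: All graphs are finite and simple. The spectral radius of a graph is the largest eigenvalue of its adjacency matrix. $P_m$ is the path on $m$ vertices, $K_2$ is the complete graph on two vertices, and $A\nabla B$ is the join of $A$ and $B$ (disjoint union plus all edges between $V(A)$ and $V(B)$). *)

theory Defs
  imports
    "HOL-Analysis.Path_Connected"
    "Graph_Theory.Graph_Theory"
    "Jordan_Normal_Form.Char_Poly"
begin

text \<open>
  A finite simple graph is a digraph \<open>G\<close> with \<open>pair_graph G\<close>: finite, loopless, and with a
  symmetric arc relation, so that the edge \<open>uv\<close> is the pair of arcs \<open>(u, v)\<close>, \<open>(v, u)\<close>.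
\<close>

definition complete_graph :: "nat \<Rightarrow> nat pair_pre_digraph" where
  "complete_graph m = \<lparr>pverts = {..<m}, parcs = {(i, j). i < m \<and> j < m \<and> i \<noteq> j}\<rparr>"

definition path_graph :: "nat \<Rightarrow> nat pair_pre_digraph" where
  "path_graph m = \<lparr>pverts = {..<m}, parcs = {(i, j). i < m \<and> j < m \<and> (j = Suc i \<or> i = Suc j)}\<rparr>"

definition graph_join ::
  "'a pair_pre_digraph \<Rightarrow> 'b pair_pre_digraph \<Rightarrow> ('a + 'b) pair_pre_digraph" (infixl \<open>\<nabla>\<close> 65) where
  "G \<nabla> H = \<lparr>
     pverts = Inl ` pverts G \<union> Inr ` pverts H,
     parcs = map_prod Inl Inl ` parcs G \<union> map_prod Inr Inr ` parcs H
       \<union> Inl ` pverts G \<times> Inr ` pverts H \<union> Inr ` pverts H \<times> Inl ` pverts G\<rparr>"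

text \<open>The list \<open>vs\<close> enumerates the vertices and thereby indexes the rows and columns.\<close>

definition adjacency_mat :: "'a list \<Rightarrow> 'a pair_pre_digraph \<Rightarrow> real mat" where
  "adjacency_mat vs G = Matrix.mat (length vs) (length vs)
     (\<lambda>(i, j). if (vs ! i, vs ! j) \<in> parcs G then 1 else 0)"

text \<open>
  Adjacency matrices for different vertex enumerations are permutation similar and have the same
  eigenvalues, so quantifying over all enumerations adds nothing to the spectrum.
\<close>

definition graph_eigenvalues :: "'a pair_pre_digraph \<Rightarrow> real set" where
  "graph_eigenvalues G =
     {k. \<exists>vs. distinct vs \<and> set vs = pverts G \<and> eigenvalue (adjacency_mat vs G) k}"

definition graph_spectral_radius :: "'a pair_pre_digraph \<Rightarrow> real" where
  "graph_spectral_radius G = Max (graph_eigenvalues G)"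

text \<open>
  A drawing in the plane (the type \<^typ>\<open>complex\<close>) puts the vertex \<open>v\<close> at the point \<open>p v\<close> and draws
  the undirected edge \<open>{u, v}\<close> as the simple arc \<open>\<gamma> {u, v}\<close>, traversed in either direction.
  Arcs contain no vertex other than their end points, and different arcs meet only in the points of
  common end vertices.
\<close>

definition plane_drawing ::
  "'a pair_pre_digraph \<Rightarrow> ('a \<Rightarrow> complex) \<Rightarrow> ('a set \<Rightarrow> real \<Rightarrow> complex) \<Rightarrow> bool" where
  "plane_drawing G p \<gamma> \<longleftrightarrow>
     inj_on p (pverts G) \<and>
     (\<forall>(u, v) \<in> parcs G.
        arc (\<gamma> {u, v}) \<and>
        {pathstart (\<gamma> {u, v}), pathfinish (\<gamma> {u, v})} = {p u, p v} \<and>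
        path_image (\<gamma> {u, v}) \<inter> p ` pverts G = {p u, p v}) \<and>
     (\<forall>(u, v) \<in> parcs G. \<forall>(x, y) \<in> parcs G. {u, v} \<noteq> {x, y} \<longrightarrow>
        path_image (\<gamma> {u, v}) \<inter> path_image (\<gamma> {x, y}) \<subseteq> p ` ({u, v} \<inter> {x, y}))"

definition planar :: "'a pair_pre_digraph \<Rightarrow> bool" where
  "planar G \<longleftrightarrow> (\<exists>p \<gamma>. plane_drawing G p \<gamma>)"

definition planar_graph_of_order :: "nat \<Rightarrow> 'a pair_pre_digraph \<Rightarrow> bool" where
  "planar_graph_of_order n G \<longleftrightarrow> pair_graph G \<and> planar G \<and> card (pverts G) = n"

end

theory Submission
  imports "HOL-Analysis.Analysis" Defs
begin

text \<open>For a planar graph whose radius is at least that of the fan \<open>K\<^sub>2 \<nabla> P\<^sub>n\<^sub>-\<^sub>2\<close>, scale an eigenvector of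
  the largest eigenvalue to maximum \<open>1\<close>. As \<open>K\<^sub>3\<^sub>,\<^sub>3\<close> is excluded, all but \<open>O(|L|)\<close> of the edges between
  vertex sets \<open>S\<close> and \<open>L\<close> are accounted for by two edges at each vertex of \<open>S\<close>; applied to the
  eigenvalue equation, this leaves exactly two vertices \<open>u\<close>, \<open>w\<close> with large entries. The common
  neighbours of \<open>u\<close> and \<open>w\<close> induce paths, or a single cycle if these two are not adjacent. Replacing
  the graph by the fan with hubs \<open>u\<close>, \<open>w\<close> can then only increase the quadratic form: edges among the
  small entries weigh less than the missing edges at \<open>u\<close> and \<open>w\<close>.

  The only topology needed is that two chords of a Jordan curve with interlaced ends, both inside or
  both outside, intersect: it excludes \<open>K\<^sub>5\<close> and \<open>K\<^sub>3\<^sub>,\<^sub>3\<close>, and linear edge bounds follow from the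
  exclusion of \<open>K\<^sub>3\<^sub>,\<^sub>3\<close> minors.\<close>

section \<open>Crossing chords of a Jordan curve\<close>

text \<open>The coefficient 2 per vertex of \<open>S\<close> has to be exact, since the squared
  radius is about \<open>2n\<close>. The multiple of \<open>|L|\<close> may be crude: in the
  weighted form it multiplies only the sum of the entries, which is at most about
  \<open>2n / l\<close> for the radius \<open>l\<close>. Edge bounds far from \<open>3n - 6\<close>
  therefore suffice, and their price is the size of \<open>n\<close>.
  \<open>K\<^sub>3\<^sub>,\<^sub>3\<close> and \<open>K\<^sub>5\<close> play different roles.
  Contraction turns vertices into regions, and a region with at most three contact points can be
  replaced by a point with three legs. As \<open>K\<^sub>3\<^sub>,\<^sub>3\<close> is cubic, it
  stays excluded after any number of contractions. \<open>K\<^sub>5\<close> has degree four and is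
  excluded only for drawings with points as vertices; it serves to show that hubs joined by an edge,
  or by a path of length two off the cycle, have no cycle of common neighbours.\<close>

definition arc_between :: "complex \<Rightarrow> complex \<Rightarrow> complex set \<Rightarrow> bool" where
  "arc_between x y A \<longleftrightarrow> (\<exists>g. arc g \<and> pathstart g = x \<and> pathfinish g = y \<and> path_image g = A)"

lemma arc_between_ends: "arc_between x y A \<Longrightarrow> x \<in> A \<and> y \<in> A \<and> x \<noteq> y"
  unfolding arc_between_def using arc_distinct_ends by fastforce

lemma arc_between_sym: "arc_between x y A \<Longrightarrow> arc_between y x A"
  unfolding arc_between_def
  by (metis arc_reversepath path_image_reversepath pathfinish_reversepath pathstart_reversepath)

lemma arc_between_join:
  assumes "arc_between x y A" "arc_between y z B" "A \<inter> B \<subseteq> {y}"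
  shows "arc_between x z (A \<union> B)"
proof -
  obtain g h where "arc g" "pathstart g = x" "pathfinish g = y" "path_image g = A"
    "arc h" "pathstart h = y" "pathfinish h = z" "path_image h = B"
    using assms unfolding arc_between_def by auto
  then have "arc (g +++ h)" "pathstart (g +++ h) = x" "pathfinish (g +++ h) = z"
    "path_image (g +++ h) = A \<union> B"
    using assms(3) by (auto simp: path_image_join intro!: arc_join)
  then show ?thesis unfolding arc_between_def by blast
qed

lemma arc_between_compact: "arc_between x y A \<Longrightarrow> compact A"
  unfolding arc_between_def using compact_arc_image by blast

lemma arc_between_path_connected: "arc_between x y A \<Longrightarrow> path_connected A"
  unfolding arc_between_def by (metis arc_imp_path path_connected_path_image)

text \<open>Connectedness puts an open arc on one side of a closed curve that it avoids; the closure
  then carries the end points along.\<close>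

lemma arc_between_interior:
  assumes "arc_between x y A"
  shows "Topological_Spaces.connected (A - {x, y})" "A - {x, y} \<noteq> {}" "A \<subseteq> closure (A - {x, y})"
proof -
  obtain g where g: "arc g" "pathstart g = x" "pathfinish g = y" "path_image g = A"
    using assms unfolding arc_between_def by auto
  then have s: "simple_path g" by (simp add: arc_imp_simple_path)
  show "Topological_Spaces.connected (A - {x, y})"
    using connected_simple_path_endless[OF s] g by simp
  show "A - {x, y} \<noteq> {}"
    using nonempty_simple_path_endless[OF s] g by simp
  have eq: "A - {x, y} = g ` {0<..<1}"
    using simple_path_endless[OF s] g by simp
  have "g ` closure {0<..<1} \<subseteq> closure (g ` {0<..<1})"
  proof (rule image_closure_subset)
    show "continuous_on (closure {0<..<1}) g"
      using arc_imp_path[OF g(1)] by (simp add: path_def)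
  qed (auto intro: closure_subset[THEN subsetD])
  then show "A \<subseteq> closure (A - {x, y})"
    using g(4) by (simp add: eq path_image_def)
qed

lemma arc_between_image:
  assumes "arc_between x y A" "continuous_on A f" "inj_on f A"
  shows "arc_between (f x) (f y) (f ` A)"
proof -
  obtain g where g: "arc g" "pathstart g = x" "pathfinish g = y" "path_image g = A"
    using assms unfolding arc_between_def by auto
  have "path (f \<circ> g)"
    using g assms(2) by (intro path_continuous_image) (auto simp: arc_imp_path)
  moreover have "inj_on (f \<circ> g) {0..1}"
    using g assms(3) by (intro comp_inj_on) (auto simp: arc_def path_image_def)
  ultimately have "arc (f \<circ> g)" by (simp add: arc_def)
  then show ?thesis
    unfolding arc_between_def using g
    by (intro exI[of _ "f \<circ> g"]) (auto simp: path_image_compose pathstart_compose pathfinish_compose)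
qed

lemma two_arcs_simple_closed_curve:
  assumes "arc_between a c C1" "arc_between a c C2" "C1 \<inter> C2 = {a, c}"
  obtains h where "simple_path h" "pathfinish h = pathstart h" "path_image h = C1 \<union> C2"
proof -
  obtain g1 g2 where g1: "arc g1" "pathstart g1 = a" "pathfinish g1 = c" "path_image g1 = C1"
    and g2: "arc g2" "pathstart g2 = a" "pathfinish g2 = c" "path_image g2 = C2"
    using assms unfolding arc_between_def by auto
  show thesis
  proof (rule that[of "g1 +++ reversepath g2"])
    show "simple_path (g1 +++ reversepath g2)"
      using g1 g2 assms(3) by (intro simple_path_join_loop) (auto simp: arc_reversepath)
  qed (use g1 g2 in \<open>auto simp: path_image_join\<close>)
qed

lemma open_arc_in_side:
  assumes "arc_between x y A" "A \<inter> J \<subseteq> {x, y}" "closed J"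
  shows "A - {x, y} \<subseteq> inside J \<or> A - {x, y} \<subseteq> outside J"
proof -
  have "A - {x, y} \<subseteq> inside J \<union> outside J"
    using assms(2) by (auto simp: inside_Un_outside)
  then show ?thesis
    using connectedD[OF arc_between_interior(1)[OF assms(1)], of "inside J" "outside J"] assms(3)
    by (smt (verit, best) Int_assoc Int_empty_right disjoint_iff inside_Int_outside inf.orderE
      le_iff_inf open_inside open_outside subset_iff Un_iff)
qed

text \<open>The chord \<open>C\<close> cuts the inside of the curve into the insides of
  \<open>C1 \<union> C\<close> and \<open>C2 \<union> C\<close>. The open chord \<open>D\<close> is
  connected and avoids \<open>C\<close>, so it stays in one of them, and its end on the other arc
  cannot lie in the closure of that region.\<close>

lemma crossing_chords_inside:
  assumes C1: "arc_between a c C1" and C2: "arc_between a c C2" and C: "arc_between a c C"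
    and i12: "C1 \<inter> C2 = {a, c}" and i1: "C1 \<inter> C = {a, c}" and i2: "C2 \<inter> C = {a, c}"
    and D: "arc_between b d D" and b: "b \<in> C1" and d: "d \<in> C2" and DC: "D \<inter> C = {}"
    and Ci: "C - {a, c} \<subseteq> inside (C1 \<union> C2)" and Di: "D - {b, d} \<subseteq> inside (C1 \<union> C2)"
  shows False
proof -
  obtain g1 g2 g where g1: "arc g1" "pathstart g1 = a" "pathfinish g1 = c" "path_image g1 = C1"
    and g2: "arc g2" "pathstart g2 = a" "pathfinish g2 = c" "path_image g2 = C2"
    and g: "arc g" "pathstart g = a" "pathfinish g = c" "path_image g = C"
    using C1 C2 C unfolding arc_between_def by auto
  have ac: "a \<noteq> c" using arc_between_ends[OF C] by simp
  have ne: "C \<inter> inside (C1 \<union> C2) \<noteq> {}"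
    using arc_between_interior(2)[OF C] Ci by auto
  obtain disj: "inside (C1 \<union> C) \<inter> inside (C2 \<union> C) = {}"
    and un: "inside (C1 \<union> C) \<union> inside (C2 \<union> C) \<union> (C - {a, c}) = inside (C1 \<union> C2)"
    using split_inside_simple_closed_curve[of g1 a c g2 g]
    by (metis arc_imp_simple_path g g1 g2 ac i12 i1 i2 ne)
  have cl: "closed (C1 \<union> C)" "closed (C2 \<union> C)"
    using arc_between_compact[OF C1] arc_between_compact[OF C2] arc_between_compact[OF C]
    by (auto intro: compact_imp_closed)
  have sub: "D - {b, d} \<subseteq> inside (C1 \<union> C) \<union> inside (C2 \<union> C)"
    using un Di DC by blast
  have "D - {b, d} \<subseteq> inside (C1 \<union> C) \<or> D - {b, d} \<subseteq> inside (C2 \<union> C)"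
  proof (rule ccontr)
    assume "\<not> ?thesis"
    then have "inside (C1 \<union> C) \<inter> (D - {b, d}) \<noteq> {}" "inside (C2 \<union> C) \<inter> (D - {b, d}) \<noteq> {}"
      using sub by blast+
    with connectedD[OF arc_between_interior(1)[OF D] open_inside[OF cl(1)] open_inside[OF cl(2)]]
    show False using sub disj by blast
  qed
  then show False
  proof
    assume "D - {b, d} \<subseteq> inside (C1 \<union> C)"
    then have "D \<subseteq> closure (inside (C1 \<union> C))"
      using arc_between_interior(3)[OF D] closure_mono by blast
    then have "d \<in> C1 \<union> C \<union> inside (C1 \<union> C)"
      using arc_between_ends[OF D] closure_inside_subset[OF cl(1)] by blast
    moreover have "d \<notin> inside (C1 \<union> C)" using un d inside_no_overlap[of "C1 \<union> C2"] by blast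
    moreover have "d \<notin> C" using DC arc_between_ends[OF D] by blast
    ultimately have "d \<in> C1 \<inter> C2" using d by blast
    then show False using i12 i1 \<open>d \<notin> C\<close> by blast
  next
    assume "D - {b, d} \<subseteq> inside (C2 \<union> C)"
    then have "D \<subseteq> closure (inside (C2 \<union> C))"
      using arc_between_interior(3)[OF D] closure_mono by blast
    then have "b \<in> C2 \<union> C \<union> inside (C2 \<union> C)"
      using arc_between_ends[OF D] closure_inside_subset[OF cl(2)] by blast
    moreover have "b \<notin> inside (C2 \<union> C)" using un b inside_no_overlap[of "C1 \<union> C2"] by blast
    moreover have "b \<notin> C" using DC arc_between_ends[OF D] by blast
    ultimately have "b \<in> C1 \<inter> C2" using b by blast
    then show False using i12 i1 \<open>b \<notin> C\<close> by blast
  qed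
qed

text \<open>Inversion at \<open>q\<close> sends \<open>q\<close> to infinity. If the image of
  \<open>z\<close> were outside the image of \<open>J\<close>, it could be joined there to points
  far away, whose preimages are close to \<open>q\<close>. Then \<open>z\<close> and a point inside
  \<open>J\<close> would lie in one component of the complement of \<open>J\<close>.\<close>

lemma inversion_outside_to_inside:
  fixes J :: "complex set"
  assumes J: "compact J" and q: "q \<in> inside J" and z: "z \<in> outside J"
  shows "inverse (z - q) \<in> inside ((\<lambda>w. inverse (w - q)) ` J)"
proof (rule ccontr)
  let ?f = "\<lambda>w. inverse (w - q)"
  let ?h = "\<lambda>w. q + inverse w"
  have qJ: "q \<notin> J" using q inside_no_overlap by blast
  have zJ: "z \<notin> J" using z outside_no_overlap by blast
  have zq: "z \<noteq> q" using q z inside_Int_outside by blast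
  have "compact (?f ` J)"
    by (intro compact_continuous_image continuous_intros J) (use qJ in auto)
  then have cf: "compact (?f ` J)" .
  assume "\<not> ?thesis"
  moreover have "?f z \<notin> ?f ` J" using zJ by (auto simp: inverse_eq_iff_eq)
  ultimately have zo: "?f z \<in> outside (?f ` J)"
    using inside_Un_outside[of "?f ` J"] by blast
  \<comment> \<open>The point 0 is the image of infinity and has to be removed before mapping back;
    deleting a point keeps a connected open set in the plane connected.\<close>
  have conn: "Topological_Spaces.connected (outside (?f ` J) - {0})"
    using cf by (intro connected_open_delete) (auto simp: compact_imp_closed open_outside compact_imp_bounded connected_outside)
  have "Topological_Spaces.connected (?h ` (outside (?f ` J) - {0}))"
    by (intro connected_continuous_image conn continuous_intros) auto
  moreover have "?h ` (outside (?f ` J) - {0}) \<subseteq> - J"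
  proof clarsimp
    fix w assume "w \<in> outside (?f ` J)" "w \<noteq> 0" "q + inverse w \<in> J"
    then have "?f (q + inverse w) \<in> ?f ` J" by blast
    then have "w \<in> ?f ` J" by (simp only: add_diff_cancel_left' inverse_inverse_eq)
    then show False using \<open>w \<in> outside (?f ` J)\<close> outside_no_overlap[of "?f ` J"] by blast
  qed
  moreover have "z \<in> ?h ` (outside (?f ` J) - {0})"
    by (rule image_eqI[of _ _ "?f z"]) (use zo zq in auto)
  moreover obtain q' where "q' \<in> inside J" "q' \<in> ?h ` (outside (?f ` J) - {0})"
  proof -
    obtain R where R: "R > 0" "- outside (?f ` J) \<subseteq> ball 0 R"
      using cobounded_outside[OF compact_imp_bounded[OF cf]] by (metis bounded_subset_ballD)
    obtain e where e: "e > 0" "ball q e \<subseteq> inside J"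
      using open_inside[OF compact_imp_closed[OF J]] q open_contains_ball by blast
    \<comment> \<open>Norm above \<open>R\<close> puts \<open>w\<close> outside the image of
      \<open>J\<close>; norm at least \<open>2 / e\<close> puts \<open>q + inverse w\<close> within
      \<open>e / 2\<close> of \<open>q\<close>.\<close>
    define w :: complex where "w = of_real (max (R + 1) (2 / e))"
    have nw: "norm w = max (R + 1) (2 / e)" using R e unfolding w_def by (simp only: norm_of_real)
    have wo: "w \<in> outside (?f ` J)" using R nw by (auto simp: subset_iff)
    have w0: "w \<noteq> 0" using nw R by auto
    have "norm w \<ge> 2 / e" using nw by simp
    moreover have "0 < 2 / e" using e by simp
    ultimately have "norm (inverse w) \<le> e / 2"
      by (metis inverse_divide le_imp_inverse_le norm_inverse)
    then have "q + inverse w \<in> ball q e" using e by (simp add: dist_norm)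
    then have "q + inverse w \<in> inside J" using e by blast
    then show thesis using wo w0 that[of "q + inverse w"] by blast
  qed
  ultimately have "connected_component (- J) z q'"
    unfolding connected_component_def by blast
  then show False
    using \<open>q' \<in> inside J\<close> z by (metis disjoint_iff inside_Int_outside inside_same_component connected_component_sym)
qed

text \<open>Two chords inside are excluded directly; two chords outside become two chords inside
  after inversion at a point inside the curve. The conclusion is an exclusive or, so that it can be
  chained around a cycle.\<close>

lemma crossing_chords:
  assumes C1: "arc_between a c C1" and C2: "arc_between a c C2" and C: "arc_between a c C"
    and i12: "C1 \<inter> C2 = {a, c}" and i1: "C1 \<inter> C = {a, c}" and i2: "C2 \<inter> C = {a, c}"
    and D: "arc_between b d D" and b: "b \<in> C1" and d: "d \<in> C2" and DC: "D \<inter> C = {}"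
    and DJ: "D \<inter> (C1 \<union> C2) \<subseteq> {b, d}"
  shows "(C - {a, c} \<subseteq> inside (C1 \<union> C2)) \<longleftrightarrow> \<not> (D - {b, d} \<subseteq> inside (C1 \<union> C2))"
proof -
  let ?J = "C1 \<union> C2"
  have cJ: "compact ?J" using arc_between_compact C1 C2 by blast
  have "\<not> (C - {a, c} \<subseteq> outside ?J \<and> D - {b, d} \<subseteq> outside ?J)"
  proof
    assume o: "C - {a, c} \<subseteq> outside ?J \<and> D - {b, d} \<subseteq> outside ?J"
    obtain h where h: "simple_path h" "pathfinish h = pathstart h" "path_image h = ?J"
      using two_arcs_simple_closed_curve[OF C1 C2 i12] .
    obtain q where q: "q \<in> inside ?J"
      using Jordan_inside_outside[OF h(1,2)] h(3) by auto
    let ?f = "\<lambda>w. inverse (w - q)"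
    have qJ: "q \<notin> ?J" using q inside_no_overlap by blast
    have qC: "q \<notin> C" using o q qJ i1 inside_Int_outside[of ?J] by blast
    have qD: "q \<notin> D" using o q qJ b d inside_Int_outside[of ?J] by blast
    have cont: "continuous_on A ?f" if "q \<notin> A" for A
      by (intro continuous_intros) (use that in auto)
    have inj: "inj_on ?f A" for A by (auto simp: inj_on_def)
    have Int: "?f ` A \<inter> ?f ` B = ?f ` (A \<inter> B)" for A B by auto
    have ins: "?f ` (A - {x, y}) \<subseteq> inside (?f ` ?J)" if "A - {x, y} \<subseteq> outside ?J" for A x y
      using inversion_outside_to_inside[OF cJ q] that by blast
    have diff: "?f ` (A - {x, y}) = ?f ` A - {?f x, ?f y}" for A x y by auto
    show False
    proof (rule crossing_chords_inside[of "?f a" "?f c" "?f ` C1" "?f ` C2" "?f ` C" "?f b" "?f d" "?f ` D"])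
      show "?f ` C - {?f a, ?f c} \<subseteq> inside (?f ` C1 \<union> ?f ` C2)"
        using ins[of C a c] o unfolding diff image_Un by blast
      show "?f ` D - {?f b, ?f d} \<subseteq> inside (?f ` C1 \<union> ?f ` C2)"
        using ins[of D b d] o unfolding diff image_Un by blast
    qed (use C1 C2 C D b d qJ qC qD i12 i1 i2 DC in
        \<open>auto intro!: arc_between_image cont inj simp: Int\<close>)
  qed
  moreover have "\<not> (C - {a, c} \<subseteq> inside ?J \<and> D - {b, d} \<subseteq> inside ?J)"
    using crossing_chords_inside[OF C1 C2 C i12 i1 i2 D b d DC] by blast
  moreover have "C - {a, c} \<subseteq> inside ?J \<or> C - {a, c} \<subseteq> outside ?J"
    using open_arc_in_side[OF C, of ?J] i1 i2 cJ by (auto simp: compact_imp_closed)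
  moreover have "D - {b, d} \<subseteq> inside ?J \<or> D - {b, d} \<subseteq> outside ?J"
    using open_arc_in_side[OF D DJ] cJ by (auto simp: compact_imp_closed)
  ultimately show ?thesis by blast
qed

section \<open>Drawings of \<open>K\<^sub>5\<close> and \<open>K\<^sub>3\<^sub>,\<^sub>3\<close>\<close>

text \<open>Edges are connected sets rather than arcs, so that subdivided edges can be merged without
  choosing an arc in a union.\<close>

definition point_drawing :: "'v set \<Rightarrow> 'v set set \<Rightarrow> ('v \<Rightarrow> complex) \<Rightarrow> ('v set \<Rightarrow> complex set) \<Rightarrow> bool" where
  "point_drawing V E p M \<longleftrightarrow> inj_on p V \<and>
     (\<forall>e\<in>E. (\<exists>u v. u \<in> V \<and> v \<in> V \<and> u \<noteq> v \<and> e = {u, v}) \<and>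
        path_connected (M e) \<and> p ` e \<subseteq> M e \<and> M e \<inter> p ` V \<subseteq> p ` e) \<and>
     (\<forall>e\<in>E. \<forall>f\<in>E. e \<noteq> f \<longrightarrow> M e \<inter> M f \<subseteq> p ` (e \<inter> f))"

text \<open>The vertices \<open>x1\<close> and \<open>x3\<close> cut the pentagon into
  \<open>A1 \<union> A2\<close>, which contains \<open>x2\<close>, and
  \<open>A3 \<union> A4 \<union> A5\<close>, which contains \<open>x4\<close>. Hence a diagonal and
  its shift by one vertex have interlaced ends.\<close>

lemma pentagon_chords:
  assumes a: "arc_between x1 x2 A1" "arc_between x2 x3 A2" "arc_between x3 x4 A3"
      "arc_between x4 x5 A4" "arc_between x5 x1 A5"
    and c: "arc_between x1 x3 C" "arc_between x2 x4 D"
    and i: "A1 \<inter> A2 \<subseteq> {x2}" "A2 \<inter> A3 \<subseteq> {x3}" "A3 \<inter> A4 \<subseteq> {x4}" "A4 \<inter> A5 \<subseteq> {x5}" "A1 \<inter> A5 \<subseteq> {x1}"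
      "A1 \<inter> A3 = {}" "A2 \<inter> A4 = {}" "A3 \<inter> A5 = {}" "A1 \<inter> A4 = {}" "A2 \<inter> A5 = {}"
    and k: "C \<inter> A1 \<subseteq> {x1}" "C \<inter> A2 \<subseteq> {x3}" "C \<inter> A3 \<subseteq> {x3}" "C \<inter> A4 = {}" "C \<inter> A5 \<subseteq> {x1}"
      "D \<inter> A1 \<subseteq> {x2}" "D \<inter> A2 \<subseteq> {x2}" "D \<inter> A3 \<subseteq> {x4}" "D \<inter> A4 \<subseteq> {x4}" "D \<inter> A5 = {}"
      "D \<inter> C = {}"
  shows "(C - {x1, x3} \<subseteq> inside (A1 \<union> A2 \<union> A3 \<union> A4 \<union> A5)) \<longleftrightarrow>
    \<not> (D - {x2, x4} \<subseteq> inside (A1 \<union> A2 \<union> A3 \<union> A4 \<union> A5))"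
proof -
  note e = a[THEN arc_between_ends] c[THEN arc_between_ends]
  have w: "X \<subseteq> {x, y}" if "X \<subseteq> {x} \<or> X \<subseteq> {y}" for X and x y :: complex using that by blast
  note f = i k Int_Un_distrib Int_Un_distrib2 w
  have B1: "arc_between x1 x3 (A1 \<union> A2)"
    by (rule arc_between_join[OF a(1,2) i(1)])
  have B: "arc_between x3 x5 (A3 \<union> A4)"
    by (rule arc_between_join[OF a(3,4) i(3)])
  have "(A3 \<union> A4) \<inter> A5 \<subseteq> {x5}" by (simp add: f)
  then have B2: "arc_between x1 x3 (A3 \<union> A4 \<union> A5)"
    using arc_between_join[OF B a(5)] arc_between_sym by blast
  have "(A1 \<union> A2) \<inter> (A3 \<union> A4 \<union> A5) \<subseteq> {x1, x3}" by (simp add: f)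
  then have 1: "(A1 \<union> A2) \<inter> (A3 \<union> A4 \<union> A5) = {x1, x3}" using e by auto
  have "C \<inter> (A1 \<union> A2) \<subseteq> {x1, x3}" by (simp add: f)
  then have 2: "(A1 \<union> A2) \<inter> C = {x1, x3}" using e by auto
  have "C \<inter> (A3 \<union> A4 \<union> A5) \<subseteq> {x1, x3}" by (simp add: f)
  then have 3: "(A3 \<union> A4 \<union> A5) \<inter> C = {x1, x3}" using e by auto
  have 4: "x2 \<in> A1 \<union> A2" "x4 \<in> A3 \<union> A4 \<union> A5" using e by auto
  have 6: "D \<inter> ((A1 \<union> A2) \<union> (A3 \<union> A4 \<union> A5)) \<subseteq> {x2, x4}" by (simp add: f)
  show ?thesis
    using crossing_chords[OF B1 B2 c(1) 1 2 3 c(2) 4 k(11) 6] by (simp only: Un_assoc)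
qed

text \<open>Merging \<open>A2\<close> and \<open>A3\<close> turns the hexagon into a pentagon with
  vertices \<open>x1\<close>, \<open>x2\<close>, \<open>x4\<close>, \<open>x5\<close>,
  \<open>x6\<close>, in which the long diagonals \<open>C\<close> and \<open>D\<close> differ by a
  shift by one vertex.\<close>

lemma hexagon_chords:
  assumes a: "arc_between x1 x2 A1" "arc_between x2 x3 A2" "arc_between x3 x4 A3"
      "arc_between x4 x5 A4" "arc_between x5 x6 A5" "arc_between x6 x1 A6"
    and c: "arc_between x1 x4 C" "arc_between x2 x5 D"
    and i: "A1 \<inter> A2 \<subseteq> {x2}" "A2 \<inter> A3 \<subseteq> {x3}" "A3 \<inter> A4 \<subseteq> {x4}" "A4 \<inter> A5 \<subseteq> {x5}" "A5 \<inter> A6 \<subseteq> {x6}"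
      "A1 \<inter> A6 \<subseteq> {x1}"
      "A1 \<inter> A3 = {}" "A2 \<inter> A4 = {}" "A3 \<inter> A5 = {}" "A4 \<inter> A6 = {}" "A1 \<inter> A5 = {}" "A2 \<inter> A6 = {}"
      "A1 \<inter> A4 = {}" "A2 \<inter> A5 = {}" "A3 \<inter> A6 = {}"
    and k: "C \<inter> A1 \<subseteq> {x1}" "C \<inter> A2 = {}" "C \<inter> A3 \<subseteq> {x4}" "C \<inter> A4 \<subseteq> {x4}" "C \<inter> A5 = {}" "C \<inter> A6 \<subseteq> {x1}"
      "D \<inter> A1 \<subseteq> {x2}" "D \<inter> A2 \<subseteq> {x2}" "D \<inter> A3 = {}" "D \<inter> A4 \<subseteq> {x5}" "D \<inter> A5 \<subseteq> {x5}" "D \<inter> A6 = {}"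
      "D \<inter> C = {}"
  shows "(C - {x1, x4} \<subseteq> inside (A1 \<union> A2 \<union> A3 \<union> A4 \<union> A5 \<union> A6)) \<longleftrightarrow>
    \<not> (D - {x2, x5} \<subseteq> inside (A1 \<union> A2 \<union> A3 \<union> A4 \<union> A5 \<union> A6))"
proof -
  have 1: "arc_between x2 x4 (A2 \<union> A3)"
    by (rule arc_between_join[OF a(2,3) i(2)])
  have "(C - {x1, x4} \<subseteq> inside (A1 \<union> (A2 \<union> A3) \<union> A4 \<union> A5 \<union> A6)) \<longleftrightarrow>
    \<not> (D - {x2, x5} \<subseteq> inside (A1 \<union> (A2 \<union> A3) \<union> A4 \<union> A5 \<union> A6))"
    by (rule pentagon_chords[OF a(1) 1 a(4,5,6) c]) (simp_all add: i k Int_Un_distrib Int_Un_distrib2)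
  then show ?thesis by (simp only: Un_assoc)
qed

lemma point_drawingD:
  assumes "point_drawing V E p M"
  shows "inj_on p V"
    and "e \<in> E \<Longrightarrow> \<exists>u v. u \<in> V \<and> v \<in> V \<and> u \<noteq> v \<and> e = {u, v}"
    and "e \<in> E \<Longrightarrow> path_connected (M e)"
    and "e \<in> E \<Longrightarrow> p ` e \<subseteq> M e"
    and "e \<in> E \<Longrightarrow> M e \<inter> p ` V \<subseteq> p ` e"
    and "e \<in> E \<Longrightarrow> f \<in> E \<Longrightarrow> e \<noteq> f \<Longrightarrow> M e \<inter> M f \<subseteq> p ` (e \<inter> f)"
  using assms unfolding point_drawing_def by simp_all

text \<open>Shrinking edges preserves every disjointness condition, so each path-connected edge set
  can be replaced by an arc inside it.\<close>

lemma point_drawing_arcs: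
  assumes pd: "point_drawing V E p M"
  obtains A where "point_drawing V E p A"
    "\<And>u v. {u, v} \<in> E \<Longrightarrow> arc_between (p u) (p v) (A {u, v})"
proof -
  note D = point_drawingD[OF pd]
  \<comment> \<open>Edges are unordered, so one and the same set has to be an arc for both orders of
    the ends.\<close>
  have ex: "\<exists>A. A \<subseteq> M e \<and> (\<forall>u v. e = {u, v} \<longrightarrow> arc_between (p u) (p v) A)" if e: "e \<in> E" for e
  proof -
    obtain u v where uv: "u \<in> V" "v \<in> V" "u \<noteq> v" "e = {u, v}"
      using D(2)[OF e] by metis
    have "p u \<in> M e" "p v \<in> M e" using D(4)[OF e] uv(4) by auto
    then obtain g where "path g" "path_image g \<subseteq> M e" "pathstart g = p u" "pathfinish g = p v"
      using D(3)[OF e] unfolding path_connected_def by metis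
    moreover have "p u \<noteq> p v"
      using inj_onD[OF D(1), of u v] uv by metis
    ultimately obtain h where h: "arc h" "path_image h \<subseteq> M e" "pathstart h = p u" "pathfinish h = p v"
      using path_contains_arc[of g "p u" "p v"] by (metis subset_trans)
    then have ab: "arc_between (p u) (p v) (path_image h)"
      unfolding arc_between_def by metis
    show ?thesis
      using h(2) uv(4) ab arc_between_sym[OF ab]
      by (intro exI[of _ "path_image h"]) (auto simp only: doubleton_eq_iff)
  qed
  define A where "A e = (SOME A. A \<subseteq> M e \<and> (\<forall>u v. e = {u, v} \<longrightarrow> arc_between (p u) (p v) A))" for e
  have A: "A e \<subseteq> M e" "\<And>u v. e = {u, v} \<Longrightarrow> arc_between (p u) (p v) (A e)" if "e \<in> E" for e
    using someI_ex[OF ex[OF that]] unfolding A_def by simp_all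
  show thesis
  proof (rule that)
    show arcs: "arc_between (p u) (p v) (A {u, v})" if "{u, v} \<in> E" for u v
      using A(2)[OF that refl] .
    show "point_drawing V E p A"
      unfolding point_drawing_def
    proof (intro conjI ballI impI)
      show "inj_on p V" by (rule D)
      fix e assume e: "e \<in> E"
      show "\<exists>u v. u \<in> V \<and> v \<in> V \<and> u \<noteq> v \<and> e = {u, v}" by (rule D(2)[OF e])
      then obtain u v where uv: "e = {u, v}" by metis
      show "path_connected (A e)" using A(2)[OF e uv] arc_between_path_connected by metis
      show "p ` e \<subseteq> A e" using arc_between_ends[OF A(2)[OF e uv]] uv by simp
      show "A e \<inter> p ` V \<subseteq> p ` e" using D(5)[OF e] A(1)[OF e] by fast
      fix f assume f: "f \<in> E" "e \<noteq> f"
      show "A e \<inter> A f \<subseteq> p ` (e \<inter> f)" using A(1)[OF e] A(1)[OF f(1)] D(6)[OF e f] by fast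
    qed
  qed
qed

lemma point_drawing_Int:
  assumes "point_drawing V E p A" "e \<in> E" "f \<in> E" "e \<noteq> f"
  shows "e \<inter> f \<subseteq> {y} \<Longrightarrow> A e \<inter> A f \<subseteq> {p y}" and "e \<inter> f = {} \<Longrightarrow> A e \<inter> A f = {}"
  using point_drawingD(6)[OF assms] by auto

text \<open>The five diagonals of a 5-cycle, taken in rotational order, lie alternately inside and
  outside of it by \<open>pentagon_chords\<close>; but five is odd.\<close>

lemma no_point_drawing_K5:
  assumes "point_drawing V E p M" and dist: "distinct [a, b, c, d, e]"
    and E: "\<And>x y. x \<in> {a, b, c, d, e} \<Longrightarrow> y \<in> {a, b, c, d, e} \<Longrightarrow> x \<noteq> y \<Longrightarrow> {x, y} \<in> E"
  shows False
proof -
  obtain A where A: "point_drawing V E p A"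
    and arc: "\<And>u v. {u, v} \<in> E \<Longrightarrow> arc_between (p u) (p v) (A {u, v})"
    using point_drawing_arcs[OF assms(1)] by metis
  note I = point_drawing_Int[OF A]
  have step: "(A {x1, x3} - {p x1, p x3} \<subseteq> inside (A {x1,x2} \<union> A {x2,x3} \<union> A {x3,x4} \<union> A {x4,x5} \<union> A {x5,x1}))
      \<longleftrightarrow> \<not> (A {x2, x4} - {p x2, p x4} \<subseteq> inside (A {x1,x2} \<union> A {x2,x3} \<union> A {x3,x4} \<union> A {x4,x5} \<union> A {x5,x1}))"
    if d: "distinct [x1, x2, x3, x4, x5]" and x: "{x1,x2} \<in> E" "{x2,x3} \<in> E" "{x3,x4} \<in> E" "{x4,x5} \<in> E" "{x5,x1} \<in> E"
      "{x1,x3} \<in> E" "{x2,x4} \<in> E" for x1 x2 x3 x4 x5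
    apply (rule pentagon_chords[where ?x5.0 = "p x5"])
                        apply (rule arc, rule x)+
                     apply (rule I, rule x, rule x,
        use d in \<open>force simp: doubleton_eq_iff\<close>, use d in force)+
    done
  have ne: "a \<noteq> b" "a \<noteq> c" "a \<noteq> d" "a \<noteq> e" "b \<noteq> c" "b \<noteq> d" "b \<noteq> e" "c \<noteq> d" "c \<noteq> e" "d \<noteq> e"
    using dist by auto
  define P where "P x y \<longleftrightarrow> A {x, y} - {p x, p y} \<subseteq> inside (A {a,b} \<union> A {b,c} \<union> A {c,d} \<union> A {d,e} \<union> A {e,a})" for x y
  have "P a c \<longleftrightarrow> \<not> P b d"
    using step[of a b c d e] by (simp add: E ne ne[symmetric] P_def Un_ac)
  moreover have "P b d \<longleftrightarrow> \<not> P c e"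
    using step[of b c d e a] by (simp add: E ne ne[symmetric] P_def Un_ac)
  moreover have "P c e \<longleftrightarrow> \<not> P d a"
    using step[of c d e a b] by (simp add: E ne ne[symmetric] P_def Un_ac)
  moreover have "P d a \<longleftrightarrow> \<not> P e b"
    using step[of d e a b c] by (simp add: E ne ne[symmetric] P_def Un_ac)
  moreover have "P e b \<longleftrightarrow> \<not> P a c"
    using step[of e a b c d] by (simp add: E ne ne[symmetric] P_def Un_ac)
  ultimately show False by blast
qed

text \<open>Along a Hamiltonian 6-cycle the three long diagonals alternate between the two sides.
  After three rotations the first diagonal returns, with its ends exchanged, on the wrong
  side.\<close>

lemma no_point_drawing_K33:
  assumes "point_drawing V E p M" and dist: "distinct [a1, a2, a3, b1, b2, b3]"
    and E0: "\<And>a b. a \<in> {a1, a2, a3} \<Longrightarrow> b \<in> {b1, b2, b3} \<Longrightarrow> {a, b} \<in> E"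
  shows False
proof -
  obtain A where A: "point_drawing V E p A"
    and arc: "\<And>u v. {u, v} \<in> E \<Longrightarrow> arc_between (p u) (p v) (A {u, v})"
    using point_drawing_arcs[OF assms(1)] by metis
  note I = point_drawing_Int[OF A]
  have E1: "{b, a} \<in> E" if "a \<in> {a1, a2, a3}" "b \<in> {b1, b2, b3}" for a b
    using E0[OF that] by (simp add: insert_commute)
  have step: "(A {x1, x4} - {p x1, p x4} \<subseteq> inside (A {x1,x2} \<union> A {x2,x3} \<union> A {x3,x4} \<union> A {x4,x5} \<union> A {x5,x6} \<union> A {x6,x1}))
      \<longleftrightarrow> \<not> (A {x2, x5} - {p x2, p x5} \<subseteq> inside (A {x1,x2} \<union> A {x2,x3} \<union> A {x3,x4} \<union> A {x4,x5} \<union> A {x5,x6} \<union> A {x6,x1}))"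
    if d: "distinct [x1, x2, x3, x4, x5, x6]" and x: "{x1,x2} \<in> E" "{x2,x3} \<in> E" "{x3,x4} \<in> E" "{x4,x5} \<in> E" "{x5,x6} \<in> E"
      "{x6,x1} \<in> E" "{x1,x4} \<in> E" "{x2,x5} \<in> E" for x1 x2 x3 x4 x5 x6
    apply (rule hexagon_chords[where ?x3.0 = "p x3" and ?x6.0 = "p x6"])
                        apply (rule arc, rule x)+
                     apply (rule I, rule x, rule x,
        use d in \<open>force simp: doubleton_eq_iff\<close>, use d in force)+
    done
  have ne: "a1 \<noteq> a2" "a1 \<noteq> a3" "a2 \<noteq> a3" "b1 \<noteq> b2" "b1 \<noteq> b3" "b2 \<noteq> b3"
    "a1 \<noteq> b1" "a1 \<noteq> b2" "a1 \<noteq> b3" "a2 \<noteq> b1" "a2 \<noteq> b2" "a2 \<noteq> b3" "a3 \<noteq> b1" "a3 \<noteq> b2" "a3 \<noteq> b3"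
    using dist by auto
  define P where "P x y \<longleftrightarrow> A {x, y} - {p x, p y} \<subseteq>
    inside (A {a1,b1} \<union> A {b1,a2} \<union> A {a2,b2} \<union> A {b2,a3} \<union> A {a3,b3} \<union> A {b3,a1})" for x y
  have "P a1 b2 \<longleftrightarrow> \<not> P b1 a3"
    using step[of a1 b1 a2 b2 a3 b3] by (simp add: E0 E1 ne ne[symmetric] P_def Un_ac)
  moreover have "P b1 a3 \<longleftrightarrow> \<not> P a2 b3"
    using step[of b1 a2 b2 a3 b3 a1] by (simp add: E0 E1 ne ne[symmetric] P_def Un_ac)
  moreover have "P a2 b3 \<longleftrightarrow> \<not> P b2 a1"
    using step[of a2 b2 a3 b3 a1 b1] by (simp add: E0 E1 ne ne[symmetric] P_def Un_ac)
  moreover have "P b2 a1 \<longleftrightarrow> P a1 b2" unfolding P_def by (simp only: insert_commute)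
  ultimately show False by blast
qed

section \<open>Contraction\<close>

text \<open>Vertices are connected regions, and an edge meets the regions of its ends in one point each;
  unlike drawings with points as vertices, such drawings are visibly closed under contraction.\<close>

definition region_drawing ::
  "'v set \<Rightarrow> 'v set set \<Rightarrow> ('v \<Rightarrow> complex set) \<Rightarrow> ('v set \<Rightarrow> complex set) \<Rightarrow> bool" where
  "region_drawing V E B M \<longleftrightarrow>
     (\<forall>v\<in>V. path_connected (B v) \<and> B v \<noteq> {}) \<and>
     (\<forall>u\<in>V. \<forall>v\<in>V. u \<noteq> v \<longrightarrow> B u \<inter> B v = {}) \<and>
     (\<forall>e\<in>E. (\<exists>u v. u \<in> V \<and> v \<in> V \<and> u \<noteq> v \<and> e = {u, v}) \<and> path_connected (M e) \<and>
        (\<forall>v\<in>e. \<exists>z. M e \<inter> B v = {z}) \<and> (\<forall>v\<in>V - e. M e \<inter> B v = {})) \<and>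
     (\<forall>e\<in>E. \<forall>f\<in>E. e \<noteq> f \<longrightarrow> M e \<inter> M f \<subseteq> \<Union>(B ` (e \<inter> f)))"

definition fat_planar :: "'v set \<Rightarrow> 'v set set \<Rightarrow> bool" where
  "fat_planar V E \<longleftrightarrow> (\<exists>B M. region_drawing V E B M)"

lemma region_drawingD:
  assumes "region_drawing V E B M"
  shows "v \<in> V \<Longrightarrow> path_connected (B v)" and "v \<in> V \<Longrightarrow> B v \<noteq> {}"
    and "u \<in> V \<Longrightarrow> v \<in> V \<Longrightarrow> u \<noteq> v \<Longrightarrow> B u \<inter> B v = {}"
    and "e \<in> E \<Longrightarrow> \<exists>u v. u \<in> V \<and> v \<in> V \<and> u \<noteq> v \<and> e = {u, v}"
    and "e \<in> E \<Longrightarrow> path_connected (M e)"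
    and "e \<in> E \<Longrightarrow> v \<in> e \<Longrightarrow> \<exists>z. M e \<inter> B v = {z}"
    and "e \<in> E \<Longrightarrow> v \<in> V \<Longrightarrow> v \<notin> e \<Longrightarrow> M e \<inter> B v = {}"
    and "e \<in> E \<Longrightarrow> f \<in> E \<Longrightarrow> e \<noteq> f \<Longrightarrow> M e \<inter> M f \<subseteq> \<Union>(B ` (e \<inter> f))"
  using assms unfolding region_drawing_def by simp_all

lemma fat_planar_edge:
  "fat_planar V E \<Longrightarrow> e \<in> E \<Longrightarrow> \<exists>u v. u \<in> V \<and> v \<in> V \<and> u \<noteq> v \<and> e = {u, v}"
  unfolding fat_planar_def using region_drawingD(4) by metis

lemma fat_planar_mono:
  assumes "fat_planar V E" "W \<subseteq> V" "F \<subseteq> E" "\<And>e. e \<in> F \<Longrightarrow> e \<subseteq> W"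
  shows "fat_planar W F"
proof -
  obtain B M where D: "region_drawing V E B M" using assms(1) unfolding fat_planar_def by auto
  note R = region_drawingD[OF D]
  have "region_drawing W F B M"
    unfolding region_drawing_def
  proof (intro conjI ballI impI)
    fix e assume e: "e \<in> F"
    then have eE: "e \<in> E" using assms(3) by auto
    obtain u v where "u \<noteq> v" "e = {u, v}" using R(4)[OF eE] by metis
    then show "\<exists>u v. u \<in> W \<and> v \<in> W \<and> u \<noteq> v \<and> e = {u, v}" using assms(4)[OF e] by auto
    show "path_connected (M e)" using R(5)[OF eE] .
    show "\<exists>z. M e \<inter> B v = {z}" if "v \<in> e" for v using R(6)[OF eE that] .
    show "M e \<inter> B v = {}" if "v \<in> W - e" for v using R(7)[OF eE] that assms(2) by auto
    show "M e \<inter> M f \<subseteq> \<Union>(B ` (e \<inter> f))" if "f \<in> F" "e \<noteq> f" for f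
      using R(8)[OF eE] that assms(3) by auto
  next
    fix u assume "u \<in> W"
    then have u: "u \<in> V" using assms(2) by auto
    show "path_connected (B u)" "B u \<noteq> {}" using R(1,2)[OF u] .
    fix v assume "v \<in> W" "u \<noteq> v"
    then show "B u \<inter> B v = {}" using R(3)[OF u] assms(2) by auto
  qed
  then show ?thesis unfolding fat_planar_def by blast
qed

text \<open>The region of \<open>u\<close> swallows the edge and the region of \<open>v\<close>, and
  an edge \<open>{v, w}\<close> keeps its point set under the new name \<open>{u, w}\<close>. An
  edge that ended at one of the two regions still meets the union in one point, because whatever it
  shares with \<open>M {u, v}\<close> already lies in the region of the common end.\<close>

lemma fat_planar_contract:
  assumes "fat_planar V E" "{u, v} \<in> E"
  shows "fat_planar (V - {v}) ({e \<in> E. v \<notin> e} \<union> {{u, w} |w. {v, w} \<in> E \<and> w \<noteq> u})"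
proof -
  obtain B M where D: "region_drawing V E B M" using assms(1) unfolding fat_planar_def by auto
  note R = region_drawingD[OF D]
  let ?F = "{e \<in> E. v \<notin> e} \<union> {{u, w} |w. {v, w} \<in> E \<and> w \<noteq> u}"
  have uv: "u \<in> V" "v \<in> V" "u \<noteq> v"
    using R(4)[OF assms(2)] by (auto simp: doubleton_eq_iff)
  \<comment> \<open>\<open>g\<close> sends a new edge to the old edge whose point set it inherits;
    if both \<open>{u, w}\<close> and \<open>{v, w}\<close> exist, the former is used.\<close>
  define g where "g e = (if e \<in> E \<and> v \<notin> e then e else insert v (e - {u}))" for e
  define B' where "B' = B(u := B u \<union> M {u, v} \<union> B v)"
  have g: "g e \<in> E" "g e = e \<and> v \<notin> e \<or> (\<exists>w. e = {u, w} \<and> g e = {v, w} \<and> w \<noteq> u \<and> w \<noteq> v)" if "e \<in> ?F" for e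
  proof -
    have "g e \<in> E \<and> (g e = e \<and> v \<notin> e \<or> (\<exists>w. e = {u, w} \<and> g e = {v, w} \<and> w \<noteq> u \<and> w \<noteq> v))"
    proof (cases "e \<in> E \<and> v \<notin> e")
      case True
      then show ?thesis by (simp add: g_def)
    next
      case False
      with that obtain w where w: "e = {u, w}" "{v, w} \<in> E" "w \<noteq> u" by blast
      moreover have "w \<noteq> v" using R(4)[OF w(2)] by (auto simp: doubleton_eq_iff)
      moreover have "g e = {v, w}" using False w uv by (auto simp: g_def)
      ultimately show ?thesis by metis
    qed
    then show "g e \<in> E" "g e = e \<and> v \<notin> e \<or> (\<exists>w. e = {u, w} \<and> g e = {v, w} \<and> w \<noteq> u \<and> w \<noteq> v)"
      by simp_all
  qed
  have BB': "B x \<subseteq> B' x" for x unfolding B'_def by auto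
  have "region_drawing (V - {v}) ?F B' (\<lambda>e. M (g e))"
    unfolding region_drawing_def
  proof (intro conjI ballI impI)
    fix x assume x: "x \<in> V - {v}"
    show "B' x \<noteq> {}" using R(2)[of x] x BB'[of x] by auto
    show "path_connected (B' x)"
    proof (cases "x = u")
      case True
      obtain z y where z: "M {u, v} \<inter> B u = {z}" and y: "M {u, v} \<inter> B v = {y}"
        using R(6)[OF assms(2), of u] R(6)[OF assms(2), of v] by auto
      have "B u \<inter> M {u, v} \<noteq> {}" using z by auto
      note pc = path_connected_Un[OF R(1)[OF uv(1)] R(5)[OF assms(2)] this]
      have "(B u \<union> M {u, v}) \<inter> B v \<noteq> {}" using y by auto
      note path_connected_Un[OF pc R(1)[OF uv(2)] this]
      then show ?thesis unfolding B'_def True by simp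
    next
      case False
      then show ?thesis unfolding B'_def using R(1) x by simp
    qed
    fix y assume y: "y \<in> V - {v}" "x \<noteq> y"
    have *: "(B u \<union> M {u, v} \<union> B v) \<inter> B t = {}" if "t \<in> V" "t \<noteq> u" "t \<noteq> v" for t
      using R(3)[of u t] R(3)[of v t] R(7)[OF assms(2), of t] uv that by auto
    show "B' x \<inter> B' y = {}"
      using *[of x] *[of y] R(3)[of x y] x y unfolding B'_def by (auto simp: Int_commute)
  next
    fix e assume e: "e \<in> ?F"
    note ge = g[OF e]
    show "path_connected (M (g e))" using R(5)[OF ge(1)] .
    obtain a b where ab: "a \<in> V" "b \<in> V" "a \<noteq> b" "g e = {a, b}" using R(4)[OF ge(1)] by metis
    show "\<exists>a b. a \<in> V - {v} \<and> b \<in> V - {v} \<and> a \<noteq> b \<and> e = {a, b}"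
    proof (cases "g e = e \<and> v \<notin> e")
      case True then show ?thesis using ab by auto
    next
      case False
      then obtain w where "e = {u, w}" "g e = {v, w}" "w \<noteq> u" "w \<noteq> v" using ge(2) by metis
      moreover have "w \<in> {a, b}" using calculation(2) ab(4) by simp
      then have "w \<in> V" using ab(1,2) by auto
      ultimately show ?thesis using uv
        by (intro exI[of _ u] exI[of _ w]) simp
    qed
    have guv: "g e \<noteq> {u, v}" using ge(2) uv by (auto simp: doubleton_eq_iff)
    note G = R(8)[OF ge(1) assms(2) guv]
    show "\<exists>z. M (g e) \<inter> B' x = {z}" if x: "x \<in> e" for x
    proof (cases "x = u")
      case False
      then have "x \<in> g e" using ge(2) x by auto
      then show ?thesis using R(6)[OF ge(1)] False unfolding B'_def by simp
    next
      case True
      show ?thesis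
      proof (cases "g e = e \<and> v \<notin> e")
        case t: True
        then obtain z where z: "M (g e) \<inter> B u = {z}" using R(6)[OF ge(1), of u] x True by auto
        have "M (g e) \<inter> B v = {}" using R(7)[OF ge(1) uv(2)] t by auto
        moreover have "M (g e) \<inter> M {u, v} \<subseteq> B u" using G t by auto
        ultimately have "M (g e) \<inter> B' x = {z}" unfolding B'_def True using z by auto
        then show ?thesis by blast
      next
        case False
        then obtain w where w: "e = {u, w}" "g e = {v, w}" "w \<noteq> u" "w \<noteq> v" using ge(2) by metis
        obtain z where z: "M (g e) \<inter> B v = {z}" using R(6)[OF ge(1), of v] w by auto
        have "M (g e) \<inter> B u = {}" using R(7)[OF ge(1) uv(1)] w uv by auto
        moreover have "M (g e) \<inter> M {u, v} \<subseteq> B v" using G w by auto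
        ultimately have "M (g e) \<inter> B' x = {z}" unfolding B'_def True using z by auto
        then show ?thesis by blast
      qed
    qed
    show "M (g e) \<inter> B' x = {}" if x: "x \<in> V - {v} - e" for x
    proof (cases "x = u")
      case False
      then have "x \<notin> g e" using ge(2) x by auto
      then show ?thesis using R(7)[OF ge(1), of x] False x unfolding B'_def by auto
    next
      case True
      then have t: "g e = e" "v \<notin> e" using ge(2) x by auto
      then have "M (g e) \<inter> B v = {}" "M (g e) \<inter> B u = {}"
        using R(7)[OF ge(1)] uv x True by auto
      moreover have "M (g e) \<inter> M {u, v} = {}" using G t x True by auto
      ultimately show ?thesis unfolding B'_def True by auto
    qed
    fix f assume f: "f \<in> ?F" "e \<noteq> f"
    note gf = g[OF f(1)]
    have "g e \<noteq> g f" using ge(2) gf(2) f(2) by (auto simp: doubleton_eq_iff)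
    then have "M (g e) \<inter> M (g f) \<subseteq> \<Union>(B ` (g e \<inter> g f))" using R(8)[OF ge(1) gf(1)] by simp
    also have "\<dots> \<subseteq> \<Union>(B' ` (e \<inter> f))"
    proof clarsimp
      fix z x assume x: "x \<in> g e" "x \<in> g f" "z \<in> B x"
      show "\<exists>x\<in>e \<inter> f. z \<in> B' x"
      proof (cases "x = v")
        case True
        then have "u \<in> e \<inter> f" using ge(2) gf(2) x by auto
        moreover have "z \<in> B' u" using True x unfolding B'_def by simp
        ultimately show ?thesis by blast
      next
        case False
        then have "x \<in> e \<inter> f" using ge(2) gf(2) x by auto
        then show ?thesis using x BB' by blast
      qed
    qed
    finally show "M (g e) \<inter> M (g f) \<subseteq> \<Union>(B' ` (e \<inter> f))" .
  qed
  then show ?thesis unfolding fat_planar_def by blast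
qed

section \<open>Replacing regions by points in graphs of maximum degree three\<close>

lemma path_first_hit:
  fixes g :: "real \<Rightarrow> complex"
  assumes "path g" "closed S" "pathstart g \<notin> S" "pathfinish g \<in> S"
  obtains h where "path h" "pathstart h = pathstart g" "path_image h \<subseteq> path_image g"
    "path_image h \<inter> S = {pathfinish h}"
proof -
  obtain h where h: "path h" "pathstart h = pathstart g" "path_image h \<subseteq> path_image g"
     "path_image h - {pathfinish h} \<subseteq> interior (- S)" "pathfinish h \<in> frontier (- S)"
  proof (rule exists_path_subpath_to_frontier[OF assms(1), of "- S"])
    show "pathstart g \<in> closure (- S)" using assms(3) closure_subset[of "- S"] by auto
    show "pathfinish g \<notin> - S" using assms(4) by simp
  qed blast
  then have "pathfinish h \<in> S"
    using frontier_subset_closed[OF assms(2)] unfolding frontier_complement by auto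
  moreover have "path_image h - {pathfinish h} \<subseteq> - S" using h(4) interior_subset by blast
  ultimately have "path_image h \<inter> S = {pathfinish h}"
    using pathfinish_in_path_image[of h] by blast
  then show thesis using that h by blast
qed

lemma arc_split:
  fixes g :: "real \<Rightarrow> complex"
  assumes "arc g" "c \<in> path_image g"
  obtains L1 L2 where "path_connected L1" "path_connected L2" "L1 \<subseteq> path_image g" "L2 \<subseteq> path_image g"
    "pathstart g \<in> L1" "pathfinish g \<in> L2" "L1 \<inter> L2 = {c}"
proof -
  obtain t where t: "t \<in> {0..1}" "c = g t" using assms(2) unfolding path_image_def by auto
  have cont: "continuous_on {0..1} g" and inj: "inj_on g {0..1}"
    using assms(1) unfolding arc_def path_def by auto
  show thesis
  proof (rule that[of "g ` {0..t}" "g ` {t..1}"])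
    show "path_connected (g ` {0..t})" "path_connected (g ` {t..1})"
      by (rule path_connected_continuous_image[OF continuous_on_subset[OF cont]];
          use t in \<open>auto intro: convex_imp_path_connected\<close>)+
    have "g ` {0..t} \<inter> g ` {t..1} = g ` ({0..t} \<inter> {t..1})"
      using t by (intro inj_on_image_Int[symmetric, OF inj]) auto
    also have "{0..t} \<inter> {t..1} = {t}" using t by auto
    finally show "g ` {0..t} \<inter> g ` {t..1} = {c}" using t by simp
  qed (use t in \<open>auto simp: path_image_def pathstart_def pathfinish_def\<close>)
qed

text \<open>Take an arc from \<open>p1\<close> to \<open>p2\<close> and a path from
  \<open>p3\<close> that stops at its first point \<open>c\<close> on the arc. The path is one leg,
  and \<open>c\<close> cuts the arc into the other two.\<close>

lemma tripod3:
  fixes X :: "complex set"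
  assumes X: "path_connected X" and p: "p1 \<in> X" "p2 \<in> X" "p3 \<in> X"
  shows "\<exists>c L1 L2 L3. path_connected L1 \<and> path_connected L2 \<and> path_connected L3 \<and>
    L1 \<subseteq> X \<and> L2 \<subseteq> X \<and> L3 \<subseteq> X \<and> p1 \<in> L1 \<and> p2 \<in> L2 \<and> p3 \<in> L3 \<and>
    L1 \<inter> L2 = {c} \<and> L1 \<inter> L3 = {c} \<and> L2 \<inter> L3 = {c}"
proof (cases "p1 = p2")
  case True
  \<comment> \<open>Two legs shrink to the common point, and the third is all of
    \<open>X\<close>.\<close>
  then show ?thesis
    using X p by (intro exI[of _ p1] exI[of _ "{p1}"] exI[of _ X]) auto
next
  case False
  obtain g0 where "path g0" "path_image g0 \<subseteq> X" "pathstart g0 = p1" "pathfinish g0 = p2"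
    using X p unfolding path_connected_def by metis
  then obtain g where g: "arc g" "path_image g \<subseteq> X" "pathstart g = p1" "pathfinish g = p2"
    using path_contains_arc[of g0 p1 p2] False by (metis subset_trans)
  obtain c L3 where c: "c \<in> path_image g" and L3: "path_connected L3" "L3 \<subseteq> X" "p3 \<in> L3"
    "L3 \<inter> path_image g = {c}"
  proof (cases "p3 \<in> path_image g")
    case True
    then show thesis using that[of p3 "{p3}"] p by auto
  next
    case False
    obtain h0 where h0: "path h0" "path_image h0 \<subseteq> X" "pathstart h0 = p3" "pathfinish h0 = p1"
      using X p unfolding path_connected_def by metis
    have "closed (path_image g)" using g(1) closed_arc_image by blast
    moreover have "pathfinish h0 \<in> path_image g" using h0 g(3) pathstart_in_path_image[of g] by simp
    ultimately obtain h where h: "path h" "pathstart h = p3" "path_image h \<subseteq> path_image h0"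
      "path_image h \<inter> path_image g = {pathfinish h}"
      using path_first_hit[OF h0(1), of "path_image g"] False h0 by metis
    show thesis
    proof (rule that[of "pathfinish h" "path_image h"])
      show "p3 \<in> path_image h" using h(2) pathstart_in_path_image[of h] by simp
    qed (use h h0 path_connected_path_image[OF h(1)] in auto)
  qed
  obtain L1 L2 where L: "path_connected L1" "path_connected L2" "L1 \<subseteq> path_image g" "L2 \<subseteq> path_image g"
    "p1 \<in> L1" "p2 \<in> L2" "L1 \<inter> L2 = {c}"
    using arc_split[OF g(1) c] g(3,4) by metis
  have "L1 \<inter> L3 = {c}" "L2 \<inter> L3 = {c}"
    using L3(4) L(3,4,7) by blast+
  moreover have "L1 \<subseteq> X" "L2 \<subseteq> X" using L(3,4) g(2) by simp_all
  ultimately show ?thesis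
    by (intro exI[of _ c] exI[of _ L1] exI[of _ L2] exI[of _ L3] conjI L L3)
qed

lemma tripod:
  fixes X :: "complex set"
  assumes X: "path_connected X" "X \<noteq> {}" and I: "finite I" "card I \<le> 3" and s: "\<And>i. i \<in> I \<Longrightarrow> s i \<in> X"
  shows "\<exists>c L. c \<in> X \<and> (\<forall>i\<in>I. path_connected (L i) \<and> L i \<subseteq> X \<and> s i \<in> L i \<and> c \<in> L i) \<and>
    (\<forall>i\<in>I. \<forall>j\<in>I. i \<noteq> j \<longrightarrow> L i \<inter> L j \<subseteq> {c})"
proof -
  consider "I = {}" | i where "I = {i}" | i j where "I = {i, j}" "i \<noteq> j" | "card I = 3"
  proof -
    have "card I = 0 \<or> card I = 1 \<or> card I = 2 \<or> card I = 3" using I(2) by linarith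
    then show thesis using that I(1) by (metis card_0_eq card_1_singletonE card_2_iff)
  qed
  then show ?thesis
  proof cases
    case 1 then show ?thesis using X(2) by auto
  next
    case (2 i)
    then show ?thesis using s[of i] X by (intro exI[of _ "s i"] exI[of _ "\<lambda>_. X"]) auto
  next
    case (3 i j)
    then show ?thesis using s[of i] s[of j] X
      by (intro exI[of _ "s i"] exI[of _ "(\<lambda>_. X)(i := {s i})"]) auto
  next
    case 4
    then obtain i j k where ijk: "I = {i, j, k}" "i \<noteq> j" "j \<noteq> k" "i \<noteq> k"
      using card_3_iff[of I] by auto
    obtain c L1 L2 L3 where L: "path_connected L1" "path_connected L2" "path_connected L3"
      "L1 \<subseteq> X" "L2 \<subseteq> X" "L3 \<subseteq> X" "s i \<in> L1" "s j \<in> L2" "s k \<in> L3"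
      "L1 \<inter> L2 = {c}" "L1 \<inter> L3 = {c}" "L2 \<inter> L3 = {c}"
      using tripod3[OF X(1), of "s i" "s j" "s k"] s ijk(1) by auto
    then have "c \<in> L1" "c \<in> L2" "c \<in> L3" by auto
    with L ijk show ?thesis
      by (intro exI[of _ c] exI[of _ "\<lambda>x. if x = i then L1 else if x = j then L2 else L3"]) auto
  qed
qed

text \<open>A region with at most three contact points contains a centre with legs to these points
  that meet only there; the legs are added to the edges. For four contact points at the tips of an
  H-shaped region there is no such centre, which is why the degree is limited to three.\<close>

lemma region_drawing_cubic:
  assumes D: "region_drawing V E B M" and deg: "\<And>v. v \<in> V \<Longrightarrow> finite {e \<in> E. v \<in> e} \<and> card {e \<in> E. v \<in> e} \<le> 3"
  obtains p N where "point_drawing V E p N"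
proof -
  note R = region_drawingD[OF D]
  define s where "s v e = (SOME z. M e \<inter> B v = {z})" for v e
  have s: "M e \<inter> B v = {s v e}" if "e \<in> E" "v \<in> e" for v e
    using someI_ex[OF R(6)[OF that]] unfolding s_def .
  define Q where "Q v c L \<longleftrightarrow> c \<in> B v \<and>
      (\<forall>i\<in>{e \<in> E. v \<in> e}. path_connected (L i) \<and> L i \<subseteq> B v \<and> s v i \<in> L i \<and> c \<in> L i) \<and>
      (\<forall>i\<in>{e \<in> E. v \<in> e}. \<forall>j\<in>{e \<in> E. v \<in> e}. i \<noteq> j \<longrightarrow> L i \<inter> L j \<subseteq> {c})" for v c L
  have ex: "\<exists>c L. Q v c L" if "v \<in> V" for v
    unfolding Q_def
    by (rule tripod[OF R(1)[OF that] R(2)[OF that]]) (use deg[OF that] s in auto)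
  define c where "c v = (SOME c. \<exists>L. Q v c L)" for v
  define L where "L v = (SOME L. Q v (c v) L)" for v
  have "Q v (c v) (L v)" if "v \<in> V" for v
    unfolding L_def using someI_ex[OF ex[OF that]] unfolding c_def by (rule someI_ex)
  note cL = this[unfolded Q_def]
  have eV: "v \<in> V" if "e \<in> E" "v \<in> e" for e v using R(4)[OF that(1)] that(2) by auto
  have c: "c v \<in> B v" if "v \<in> V" for v using cL[OF that] by simp
  have L: "path_connected (L v e)" "L v e \<subseteq> B v" "s v e \<in> L v e" "c v \<in> L v e" if "e \<in> E" "v \<in> e" for v e
    using cL[OF eV[OF that]] that by simp_all
  have LL: "z = c v" if "e \<in> E" "f \<in> E" "v \<in> e" "v \<in> f" "e \<noteq> f" "z \<in> L v e" "z \<in> L v f" for v e f z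
    using cL[OF eV[OF that(1,3)]] that by blast
  have same: "x = y" if "z \<in> B x" "z \<in> B y" "x \<in> V" "y \<in> V" for x y z
    using R(3)[of x y] that by blast
  define N where "N e = M e \<union> (\<Union>v\<in>e. L v e)" for e
  have "point_drawing V E c N"
    unfolding point_drawing_def
  proof (intro conjI ballI impI)
    show "inj_on c V"
      using c same by (metis inj_onI)
    fix e assume e: "e \<in> E"
    show "\<exists>u v. u \<in> V \<and> v \<in> V \<and> u \<noteq> v \<and> e = {u, v}" using R(4)[OF e] .
    then obtain u v where uv: "e = {u, v}" by metis
    then have m: "u \<in> e" "v \<in> e" by auto
    have "M e \<inter> L u e \<noteq> {}" using s[OF e m(1)] L(3)[OF e m(1)] by auto
    note pc = path_connected_Un[OF R(5)[OF e] L(1)[OF e m(1)] this]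
    have "(M e \<union> L u e) \<inter> L v e \<noteq> {}" using s[OF e m(2)] L(3)[OF e m(2)] by auto
    note path_connected_Un[OF pc L(1)[OF e m(2)] this]
    then show "path_connected (N e)" unfolding N_def uv by (simp add: Un_assoc)
    show "c ` e \<subseteq> N e" unfolding N_def using L(4)[OF e] by auto
    show "N e \<inter> c ` V \<subseteq> c ` e"
    proof
      fix z assume z: "z \<in> N e \<inter> c ` V"
      then obtain w where w: "w \<in> V" "z = c w" by auto
      then have zw: "z \<in> B w" using c by auto
      have "w \<in> e"
      proof (cases "z \<in> M e")
        case True
        then show ?thesis using R(7)[OF e w(1)] zw by auto
      next
        case False
        then obtain x where x: "x \<in> e" "z \<in> L x e" using z unfolding N_def by auto
        then show ?thesis using same[of z x w] L(2)[OF e x(1)] zw w(1) eV[OF e x(1)] by auto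
      qed
      then show "z \<in> c ` e" using w by auto
    qed
    fix f assume f: "f \<in> E" "e \<noteq> f"
    \<comment> \<open>A point of one edge on a leg of another lies in a region, so it is the contact
      point of the first edge with that region. It then also belongs to the leg of the first edge,
      and two legs meet only in the centre.\<close>
    have mixed: "z = c x \<and> x \<in> e \<inter> f" if a: "a \<in> E" "b \<in> E" "a \<noteq> b" "{a, b} = {e, f}" "z \<in> M a" "x \<in> b" "z \<in> L x b" for a b x z
    proof -
      have zB: "z \<in> B x" using L(2)[OF a(2,6)] a(7) by auto
      then have xa: "x \<in> a" using R(7)[OF a(1) eV[OF a(2,6)]] a(5) by auto
      then have "z \<in> {s x a}" using s[OF a(1) xa] zB a(5) by blast
      then have "z \<in> L x a" using L(3)[OF a(1) xa] by simp
      then have "z = c x" using LL[OF a(1,2) xa a(6,3)] a(7) by auto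
      then show ?thesis using xa a(4,6) by (auto simp: doubleton_eq_iff)
    qed
    show "N e \<inter> N f \<subseteq> c ` (e \<inter> f)"
    proof
      fix z assume "z \<in> N e \<inter> N f"
      then consider "z \<in> M e" "z \<in> M f" | x where "z \<in> M e" "x \<in> f" "z \<in> L x f"
        | x where "z \<in> M f" "x \<in> e" "z \<in> L x e" | x y where "x \<in> e" "z \<in> L x e" "y \<in> f" "z \<in> L y f"
        unfolding N_def by auto
      then show "z \<in> c ` (e \<inter> f)"
      proof cases
        case 1
        then obtain x where x: "x \<in> e" "x \<in> f" "z \<in> B x" using R(8)[OF e f] by auto
        then have "z = s x e" "z = s x f" using s[OF e x(1)] s[OF f(1) x(2)] 1 by auto
        then have "z = c x" using LL[OF e f(1) x(1,2) f(2)] L(3)[OF e x(1)] L(3)[OF f(1) x(2)] by auto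
        then show ?thesis using x by auto
      next
        case (2 x)
        then show ?thesis using mixed[OF e f(1) f(2), of z x] by auto
      next
        case (3 x)
        then show ?thesis using mixed[OF f(1) e, of z x] f(2) by auto
      next
        case (4 x y)
        then have xy: "x = y"
          using same[of z x y] L(2)[OF e] L(2)[OF f(1)] eV[OF e] eV[OF f(1)] by blast
        then have "z = c x" using LL[OF e f(1) _ _ f(2)] 4 by auto
        then show ?thesis using xy 4 by auto
      qed
    qed
  qed
  then show thesis using that by blast
qed

text \<open>Vertices may have large degree in the given graph, so the subgraph
  \<open>K\<^sub>3\<^sub>,\<^sub>3\<close> is isolated first; it is cubic, and its region drawing
  becomes a point drawing.\<close>

lemma fat_planar_no_K33:
  assumes fp: "fat_planar V E" and dist: "distinct [a1, a2, a3, b1, b2, b3]"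
    and E: "\<And>a b. a \<in> {a1, a2, a3} \<Longrightarrow> b \<in> {b1, b2, b3} \<Longrightarrow> {a, b} \<in> E"
  shows False
proof -
  define A B F where "A = {a1, a2, a3}" and "B = {b1, b2, b3}" and "F = (\<lambda>(a, b). {a, b}) ` (A \<times> B)"
  have dis: "A \<inter> B = {}" using dist by (auto simp: A_def B_def)
  have cAB: "card A \<le> 3" "card B \<le> 3" "finite A" "finite B"
    unfolding A_def B_def by (simp_all add: card_insert_if)
  have E: "{a, b} \<in> E" if "a \<in> A" "b \<in> B" for a b using E that unfolding A_def B_def by metis
  then have FE: "F \<subseteq> E" unfolding F_def by auto
  have eV: "e \<subseteq> V" if "e \<in> E" for e using fat_planar_edge[OF fp that] by auto
  have "a \<in> V" if "a \<in> A" for a using eV[OF E[OF that, of b1]] by (simp add: B_def)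
  moreover have "b \<in> V" if "b \<in> B" for b using eV[OF E[OF _ that, of a1]] by (simp add: A_def)
  ultimately have "A \<union> B \<subseteq> V" by auto
  moreover have "e \<subseteq> A \<union> B" if "e \<in> F" for e using that unfolding F_def by auto
  ultimately have "fat_planar (A \<union> B) F"
    by (intro fat_planar_mono[OF fp _ FE])
  then obtain R M where D: "region_drawing (A \<union> B) F R M" unfolding fat_planar_def by auto
  have deg: "finite {e \<in> F. v \<in> e} \<and> card {e \<in> F. v \<in> e} \<le> 3" if v: "v \<in> A \<union> B" for v
  proof -
    have "\<exists>C. finite C \<and> card C \<le> 3 \<and> {e \<in> F. v \<in> e} \<subseteq> (\<lambda>b. {v, b}) ` C"
    proof (cases "v \<in> A")
      case True
      then have "v \<notin> B" using dis by auto
      then have "{e \<in> F. v \<in> e} \<subseteq> (\<lambda>b. {v, b}) ` B" unfolding F_def by auto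
      then show ?thesis using cAB by blast
    next
      case False
      then have "{e \<in> F. v \<in> e} \<subseteq> (\<lambda>b. {v, b}) ` A" unfolding F_def by (auto simp: insert_commute)
      then show ?thesis using cAB by blast
    qed
    then obtain C where C: "finite C" "card C \<le> 3" "{e \<in> F. v \<in> e} \<subseteq> (\<lambda>b. {v, b}) ` C" by auto
    have "card {e \<in> F. v \<in> e} \<le> card ((\<lambda>b. {v, b}) ` C)" using C by (intro card_mono) auto
    also have "\<dots> \<le> 3" using card_image_le[OF C(1)] C(2) le_trans by metis
    finally show ?thesis using finite_subset[OF C(3)] C(1) by simp
  qed
  obtain p N where pd: "point_drawing (A \<union> B) F p N"
    using region_drawing_cubic[OF D deg] by metis
  have "{a, b} \<in> F" if "a \<in> {a1, a2, a3}" "b \<in> {b1, b2, b3}" for a b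
    using that unfolding F_def A_def B_def by (intro image_eqI[of _ _ "(a, b)"]) auto
  then show False
    using no_point_drawing_K33[OF pd dist] by metis
qed

section \<open>Sparsity\<close>

definition neigh :: "'v set set \<Rightarrow> 'v \<Rightarrow> 'v set" where
  "neigh E v = {w. {v, w} \<in> E}"

definition simple_graph :: "'v set \<Rightarrow> 'v set set \<Rightarrow> bool" where
  "simple_graph V E \<longleftrightarrow> finite V \<and> (\<forall>e\<in>E. \<exists>u v. u \<in> V \<and> v \<in> V \<and> u \<noteq> v \<and> e = {u, v})"

lemma fat_planar_simple_graph: "fat_planar V E \<Longrightarrow> finite V \<Longrightarrow> simple_graph V E"
  unfolding simple_graph_def using fat_planar_edge[of V E] by simp

lemma simple_graph_finite_vertices: "simple_graph V E \<Longrightarrow> finite V"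
  unfolding simple_graph_def by simp

lemma in_neigh_commute: "u \<in> neigh E v \<longleftrightarrow> v \<in> neigh E u"
  unfolding neigh_def by (simp add: insert_commute)

lemma simple_graph_neigh:
  assumes "simple_graph V E" "w \<in> neigh E v"
  shows "v \<in> V" "w \<in> V" "v \<noteq> w"
proof -
  obtain a b where "a \<in> V" "b \<in> V" "a \<noteq> b" "{v, w} = {a, b}"
    using assms unfolding simple_graph_def neigh_def by blast
  then show "v \<in> V" "w \<in> V" "v \<noteq> w" by (auto simp: doubleton_eq_iff)
qed

lemma simple_graph_finite_neigh: "simple_graph V E \<Longrightarrow> finite (neigh E v)"
  using simple_graph_neigh(2)[of V E _ v] unfolding simple_graph_def
  by (meson finite_subset subsetI)

lemma simple_graph_finite: "simple_graph V E \<Longrightarrow> finite E"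
  unfolding simple_graph_def by (rule finite_subset[of _ "Pow V"]) auto

lemma simple_graph_card_neigh:
  assumes "simple_graph V E"
  shows "card (neigh E v) = card {e \<in> E. v \<in> e}"
proof (rule bij_betw_same_card[of "\<lambda>w. {v, w}"])
  show "bij_betw (\<lambda>w. {v, w}) (neigh E v) {e \<in> E. v \<in> e}"
    unfolding bij_betw_def
  proof
    show "inj_on (\<lambda>w. {v, w}) (neigh E v)"
      by (auto simp: inj_on_def doubleton_eq_iff)
    show "(\<lambda>w. {v, w}) ` neigh E v = {e \<in> E. v \<in> e}"
    proof (intro equalityI subsetI)
      fix e assume e: "e \<in> {e \<in> E. v \<in> e}"
      then obtain a b where "e = {a, b}" using assms unfolding simple_graph_def by blast
      then have "\<exists>w. e = {v, w}" using e by auto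
      then show "e \<in> (\<lambda>w. {v, w}) ` neigh E v" using e unfolding neigh_def by auto
    qed (auto simp: neigh_def)
  qed
qed

lemma handshake:
  assumes "simple_graph V E"
  shows "(\<Sum>v\<in>V. card (neigh E v)) = 2 * card E"
proof -
  have "(\<Sum>v\<in>V. card (neigh E v)) = (\<Sum>v\<in>V. card {e \<in> E. v \<in> e})"
    using simple_graph_card_neigh[OF assms] by simp
  also have "\<dots> = (\<Sum>e\<in>E. 2)"
  proof (rule sum_multicount_gen)
    show "finite V" using assms unfolding simple_graph_def by simp
    show "finite E" using simple_graph_finite[OF assms] .
    show "\<forall>e\<in>E. card {v \<in> V. v \<in> e} = 2"
    proof
      fix e assume "e \<in> E"
      then obtain a b where ab: "a \<in> V" "b \<in> V" "a \<noteq> b" "e = {a, b}"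
        using assms unfolding simple_graph_def by blast
      then have "{v \<in> V. v \<in> e} = {a, b}" by auto
      then show "card {v \<in> V. v \<in> e} = 2" using ab(3) by simp
    qed
  qed
  finally show ?thesis by simp
qed

lemma exists_low_degree:
  assumes "simple_graph V E" "2 * card E < k * card V"
  obtains v where "v \<in> V" "card (neigh E v) < k"
proof (rule ccontr)
  assume "\<not> thesis"
  then have "\<And>v. v \<in> V \<Longrightarrow> k \<le> card (neigh E v)" using that by (meson not_less)
  then have "(\<Sum>v\<in>V. k) \<le> (\<Sum>v\<in>V. card (neigh E v))" by (intro sum_mono)
  then show False using assms(2) handshake[OF assms(1)] by (simp add: mult.commute)
qed

lemma fat_planar_common_neigh:
  assumes fp: "fat_planar V E" and fin: "finite V" and ne: "a \<noteq> b" "a \<noteq> c" "b \<noteq> c"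
    and T: "T \<subseteq> neigh E a \<inter> neigh E b \<inter> neigh E c"
  shows "card T \<le> 2"
proof (rule ccontr)
  assume "\<not> card T \<le> 2"
  then obtain T' where T': "T' \<subseteq> T" "card T' = 3"
    by (metis Suc_leI not_less numeral_3_eq_3 obtain_subset_with_card_n numeral_2_eq_2 not_le)
  then obtain x y z where xyz: "T' = {x, y, z}" "x \<noteq> y" "y \<noteq> z" "x \<noteq> z"
    using card_3_iff[of T'] by auto
  note sg = fat_planar_simple_graph[OF fp fin]
  have inT: "t \<in> neigh E a" "t \<in> neigh E b" "t \<in> neigh E c" if "t \<in> {x, y, z}" for t
    using that T T'(1) xyz(1) by blast+
  then have d: "a \<noteq> t" "b \<noteq> t" "c \<noteq> t" if "t \<in> {x, y, z}" for t
    using simple_graph_neigh(3)[OF sg] that by blast+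
  have dist: "distinct [a, b, c, x, y, z]"
    using ne xyz d[of x] d[of y] d[of z] by simp
  show False
  proof (rule fat_planar_no_K33[OF fp dist])
    fix s t assume "s \<in> {a, b, c}" "t \<in> {x, y, z}"
    then show "{s, t} \<in> E" using inT[of t] unfolding neigh_def by auto
  qed
qed

text \<open>Contract \<open>s\<close> into \<open>a\<close>; of the edges that arise, only the one
  to \<open>b\<close> is kept.\<close>

lemma fat_planar_suppress:
  assumes "fat_planar V E" "{s, a} \<in> E" "{s, b} \<in> E" "a \<noteq> b"
  shows "fat_planar (V - {s}) (insert {a, b} {e \<in> E. s \<notin> e})"
proof (rule fat_planar_mono[OF fat_planar_contract[OF assms(1), of a s]])
  show "{a, s} \<in> E" using assms(2) by (simp add: insert_commute)
  show "insert {a, b} {e \<in> E. s \<notin> e} \<subseteq> {e \<in> E. s \<notin> e} \<union> {{a, w} |w. {s, w} \<in> E \<and> w \<noteq> a}"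
    using assms(3,4) by blast
  fix e assume "e \<in> insert {a, b} {e \<in> E. s \<notin> e}"
  then consider "e = {a, b}" | "e \<in> E" "s \<notin> e" by auto
  then show "e \<subseteq> V - {s}"
  proof cases
    case 1
    then show ?thesis
      using fat_planar_edge[OF assms(1,2)] fat_planar_edge[OF assms(1,3)] by (auto simp: doubleton_eq_iff)
  next
    case 2
    then show ?thesis using fat_planar_edge[OF assms(1), of e] by auto
  qed
qed simp

text \<open>A counterexample trimmed to \<open>4n - 1\<close> edges has a vertex \<open>v\<close> of
  degree at most 7. Contracting \<open>{v, a}\<close> loses one edge, and one more for each common
  neighbour of \<open>v\<close> and \<open>a\<close>; by induction there are thus at least four
  common neighbours. Among at most 7 neighbours of \<open>v\<close>, this forces two,
  \<open>a\<close> and \<open>b\<close>, with three common neighbours there, and together with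
  \<open>v\<close> they form a \<open>K\<^sub>3\<^sub>,\<^sub>3\<close>.\<close>

lemma fat_planar_card_edges:
  assumes "fat_planar V E" "finite V" "V \<noteq> {}"
  shows "card E + 2 \<le> 4 * card V"
  using assms
proof (induction "card V" arbitrary: V E rule: less_induct)
  case (less V E)
  note fin = less.prems(2)
  show ?case
  proof (rule ccontr)
    assume "\<not> card E + 2 \<le> 4 * card V"
    then have "4 * card V - 1 \<le> card E" by simp
    then obtain F where F: "F \<subseteq> E" "card F = 4 * card V - 1"
      by (meson obtain_subset_with_card_n)
    have V1: "card V \<ge> 1" using less.prems by (simp add: Suc_leI card_gt_0_iff)
    have eV: "e \<subseteq> V" if "e \<in> E" for e using fat_planar_edge[OF less.prems(1) that] by auto
    have fF: "fat_planar V F"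
      by (rule fat_planar_mono[OF less.prems(1) _ F(1)]) (use eV F in auto)
    note sg = fat_planar_simple_graph[OF fF fin]
    note nb = simple_graph_neigh[OF sg]
    have finF: "finite F" and finN: "\<And>x. finite (neigh F x)"
      using simple_graph_finite[OF sg] simple_graph_finite_neigh[OF sg] by auto
    have "2 * card F < 8 * card V" using F(2) V1 by simp
    then obtain v where v: "v \<in> V" "card (neigh F v) < 8"
      using exists_low_degree[OF sg] by metis
    have cV: "card (V - {v}) = card V - 1" "card (V - {v}) < card V"
      using v(1) fin V1 by auto
    have small: False if "fat_planar (V - {v}) F'" "card F' + 5 \<ge> 4 * card V" "card V \<ge> 2" for F'
    proof -
      have "card F' + 2 \<le> 4 * card (V - {v})"
        using less.hyps[OF cV(2) that(1)] fin cV(1) that(3) by fastforce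
      then show False using that(2,3) cV(1) by simp
    qed
    have "F \<noteq> {}" using F(2) V1 by auto
    then obtain e where "e \<in> F" by blast
    then obtain x y where "x \<in> V" "y \<in> V" "x \<noteq> y" using fat_planar_edge[OF fF] by blast
    then have V2: "card V \<ge> 2"
      using card_mono[OF fin, of "{x, y}"] by simp
    have split: "card F = card {e \<in> F. v \<notin> e} + card (neigh F v)"
    proof -
      have "F = {e \<in> F. v \<notin> e} \<union> {e \<in> F. v \<in> e}" by auto
      then show ?thesis using simple_graph_card_neigh[OF sg, of v] finF
        by (metis (no_types, lifting) card_Un_disjoint disjoint_iff finite_Un mem_Collect_eq)
    qed
    have codeg: "card (neigh F v \<inter> neigh F a) \<ge> 4" if a: "a \<in> neigh F v" for a
    proof (rule ccontr)
      assume "\<not> 4 \<le> card (neigh F v \<inter> neigh F a)"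
      then have le3: "card (neigh F v \<inter> neigh F a) \<le> 3" by simp
      have av: "{a, v} \<in> F" using a unfolding neigh_def by (simp add: insert_commute)
      let ?G = "{e \<in> F. v \<notin> e} \<union> {{a, w} |w. {v, w} \<in> F \<and> w \<noteq> a}"
      have fG: "fat_planar (V - {v}) ?G" by (rule fat_planar_contract[OF fF av])
      let ?N = "neigh F v - {a} - neigh F a"
      have "?G = {e \<in> F. v \<notin> e} \<union> (\<lambda>w. {a, w}) ` ?N"
      proof -
        have "e \<in> {e \<in> F. v \<notin> e} \<union> (\<lambda>w. {a, w}) ` ?N" if eG: "e \<in> ?G" for e
        proof (cases "e \<in> F \<and> v \<notin> e")
          case False
          then obtain w where w: "e = {a, w}" "{v, w} \<in> F" "w \<noteq> a" using eG by blast
          have "v \<noteq> a" "v \<noteq> w" using nb(3) a w(2) unfolding neigh_def by auto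
          then have "w \<in> ?N" using w False unfolding neigh_def by auto
          then show ?thesis using w(1) by blast
        qed simp
        moreover have "(\<lambda>w. {a, w}) ` ?N \<subseteq> ?G" unfolding neigh_def by auto
        ultimately show ?thesis by blast
      qed
      moreover have "{e \<in> F. v \<notin> e} \<inter> (\<lambda>w. {a, w}) ` ?N = {}" unfolding neigh_def by auto
      moreover have "card ((\<lambda>w. {a, w}) ` ?N) = card ?N"
        by (intro card_image) (auto simp: inj_on_def doubleton_eq_iff)
      ultimately have "card ?G = card {e \<in> F. v \<notin> e} + card ?N"
        using finF finN by (simp add: card_Un_disjoint)
      moreover have "card (neigh F v) \<le> card ?N + 4"
      proof -
        have "neigh F v \<subseteq> ?N \<union> ({a} \<union> (neigh F v \<inter> neigh F a))" by auto
        then have "card (neigh F v) \<le> card (?N \<union> ({a} \<union> (neigh F v \<inter> neigh F a)))"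
          using finN by (intro card_mono) auto
        also have "\<dots> \<le> card ?N + card ({a} \<union> (neigh F v \<inter> neigh F a))" by (rule card_Un_le)
        also have "card ({a} \<union> (neigh F v \<inter> neigh F a)) \<le> card {a} + card (neigh F v \<inter> neigh F a)"
          by (rule card_Un_le)
        finally show ?thesis using le3 by simp
      qed
      ultimately have "card ?G + 5 \<ge> 4 * card V" using split F(2) V1 by linarith
      then show False using small[OF fG _ V2] by blast
    qed
    have "neigh F v \<noteq> {}"
    proof
      assume e: "neigh F v = {}"
      have "fat_planar (V - {v}) {e \<in> F. v \<notin> e}"
        by (rule fat_planar_mono[OF fF]) (use eV F in auto)
      moreover have "card {e \<in> F. v \<notin> e} = card F" using split e by simp
      then have "card {e \<in> F. v \<notin> e} + 5 \<ge> 4 * card V" using F(2) by linarith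
      ultimately show False using small V2 by metis
    qed
    then obtain a where a: "a \<in> neigh F v" by (meson equals0I)
    let ?N = "neigh F v"
    \<comment> \<open>If some \<open>b\<close> is not adjacent to \<open>a\<close>, two sets of size
      at least four lie among at most five vertices and share three. If \<open>a\<close> is adjacent
      to all others, each common neighbour of \<open>v\<close> and \<open>b\<close> other than
      \<open>a\<close> is also adjacent to \<open>a\<close>.\<close>
    obtain b where b: "b \<in> ?N" "b \<noteq> a" "card (?N \<inter> neigh F a \<inter> neigh F b) \<ge> 3"
    proof (cases "\<exists>b\<in>?N. b \<noteq> a \<and> b \<notin> neigh F a")
      case True
      then obtain b where b: "b \<in> ?N" "b \<noteq> a" "b \<notin> neigh F a" by blast
      then have "a \<notin> neigh F b" by (simp add: in_neigh_commute)
      let ?X = "?N \<inter> neigh F a" let ?Y = "?N \<inter> neigh F b"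
      have "?X \<union> ?Y \<subseteq> ?N - {a, b}"
        using b \<open>a \<notin> neigh F b\<close> nb(3) by blast
      then have "card (?X \<union> ?Y) \<le> card (?N - {a, b})" using finN by (intro card_mono) auto
      also have "\<dots> = card ?N - 2" using a b finN by (subst card_Diff_subset) auto
      finally have "card (?X \<union> ?Y) \<le> 5" using v(2) by simp
      moreover have "card ?X + card ?Y = card (?X \<union> ?Y) + card (?X \<inter> ?Y)"
        using finN by (intro card_Un_Int) auto
      ultimately have "card (?X \<inter> ?Y) \<ge> 3"
        using codeg[OF a] codeg[OF b(1)] by linarith
      also have "?X \<inter> ?Y = ?N \<inter> neigh F a \<inter> neigh F b" by auto
      finally show thesis by (rule that[OF b(1,2)])
    next
      case False
      have "?N \<inter> neigh F a \<noteq> {}" using codeg[OF a] by auto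
      then obtain b where b: "b \<in> ?N" "b \<in> neigh F a" by blast
      then have "b \<noteq> a" using nb(3) by blast
      have "?N \<inter> neigh F b - {a} \<subseteq> ?N \<inter> neigh F a \<inter> neigh F b" using False by blast
      then have "card (?N \<inter> neigh F b - {a}) \<le> card (?N \<inter> neigh F a \<inter> neigh F b)"
        using finN by (intro card_mono) auto
      moreover have "card (?N \<inter> neigh F b) - 1 \<le> card (?N \<inter> neigh F b - {a})"
        using finN by (simp add: card_Diff_singleton_if)
      ultimately have "card (?N \<inter> neigh F a \<inter> neigh F b) \<ge> 3" using codeg[OF b(1)] by linarith
      then show thesis by (rule that[OF b(1) \<open>b \<noteq> a\<close>])
    qed
    have "v \<noteq> a" "v \<noteq> b" using nb(3) a b(1) by blast+
    then have "card (?N \<inter> neigh F a \<inter> neigh F b) \<le> 2"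
      using fat_planar_common_neigh[OF fF fin, of v a b] b(2) by blast
    then show False using b(3) by simp
  qed
qed

lemma fat_planar_card_edges_le:
  assumes "fat_planar V E" "finite V"
  shows "card E \<le> 4 * card V"
proof (cases "V = {}")
  case True
  then have "E = {}" using fat_planar_edge[OF assms(1)] by auto
  then show ?thesis by simp
next
  case False
  then show ?thesis using fat_planar_card_edges[OF assms] by simp
qed

section \<open>Edges between two vertex sets\<close>

lemma fat_planar_low_degree:
  assumes "fat_planar V E" "finite V" "V \<noteq> {}"
  obtains v where "v \<in> V" "card (neigh E v) \<le> 7"
proof -
  have "2 * card E < 8 * card V" using fat_planar_card_edges[OF assms] by simp
  then obtain v where "v \<in> V" "card (neigh E v) < 8"
    using exists_low_degree[OF fat_planar_simple_graph[OF assms(1,2)]] by metis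
  then show thesis using that by simp
qed

lemma fat_planar_induced:
  assumes "fat_planar V E" "W \<subseteq> V"
  shows "fat_planar W {e \<in> E. e \<subseteq> W}"
  by (rule fat_planar_mono[OF assms]) auto

text \<open>Induction by deleting a vertex \<open>l\<close> with at most 7 neighbours in
  \<open>L\<close>. Since subtraction is truncated, a vertex of \<open>S\<close> loses excess only
  if it is adjacent to \<open>l\<close> and to two more vertices of \<open>L\<close>. By the clique
  condition these form one of at most \<open>7 choose 2 = 21\<close> pairs of neighbours of
  \<open>l\<close>, and each pair has together with \<open>l\<close> at most two common neighbours.
  This gives 42 per vertex of \<open>L\<close>.\<close>

lemma clique_excess:
  assumes fp: "fat_planar V E" and fin: "finite V"
  shows "L \<subseteq> V \<Longrightarrow> S \<subseteq> V \<Longrightarrow>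
    (\<And>s a b. s \<in> S \<Longrightarrow> a \<in> neigh E s \<inter> L \<Longrightarrow> b \<in> neigh E s \<inter> L \<Longrightarrow> a \<noteq> b \<Longrightarrow> {a, b} \<in> E) \<Longrightarrow>
    (\<Sum>s\<in>S. card (neigh E s \<inter> L) - 2) \<le> 42 * card L"
proof (induction "card L" arbitrary: L rule: less_induct)
  case (less L)
  note sg = fat_planar_simple_graph[OF fp fin]
  note finN = simple_graph_finite_neigh[OF sg]
  have finL: "finite L" and finS: "finite S"
    using finite_subset[OF less.prems(1) fin] finite_subset[OF less.prems(2) fin] by simp_all
  show ?case
  proof (cases "L = {}")
    case True
    then show ?thesis by simp
  next
    case False
    obtain l where l: "l \<in> L" "card (neigh {e \<in> E. e \<subseteq> L} l) \<le> 7"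
      using fat_planar_low_degree[OF fat_planar_induced[OF fp less.prems(1)] finL False] by metis
    define N where "N = neigh E l \<inter> L"
    have "neigh {e \<in> E. e \<subseteq> L} l = N" unfolding N_def neigh_def using l(1) by auto
    then have cN: "card N \<le> 7" "finite N" using l(2) finL unfolding N_def by auto
    define D where "D = {s \<in> S. l \<in> neigh E s \<and> 3 \<le> card (neigh E s \<inter> L)}"
    define Q where "Q = {P. P \<subseteq> N \<and> card P = 2}"
    have finQ: "finite Q" unfolding Q_def using cN(2) by simp
    have "card Q = card N choose 2" unfolding Q_def using n_subsets[OF cN(2)] by simp
    also have "\<dots> \<le> 7 choose 2" using cN(1) by (intro binomial_right_mono)
    also have "\<dots> = 21" by (simp add: choose_two)
    finally have cQ: "card Q \<le> 21" .
    have "D \<subseteq> (\<Union>P\<in>Q. {s \<in> S. insert l P \<subseteq> neigh E s})"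
    proof
      fix s assume s: "s \<in> D"
      then have "2 \<le> card (neigh E s \<inter> L - {l})"
        using l(1) unfolding D_def by (auto simp: card_Diff_singleton)
      then obtain P where P: "P \<subseteq> neigh E s \<inter> L - {l}" "card P = 2"
        by (meson obtain_subset_with_card_n)
      have "P \<subseteq> N"
      proof
        fix a assume a: "a \<in> P"
        have "{l, a} \<in> E" using less.prems(3)[of s l a] s l(1) P(1) a unfolding D_def by auto
        then show "a \<in> N" using P(1) a unfolding N_def neigh_def by auto
      qed
      then have "P \<in> Q" using P(2) unfolding Q_def by simp
      moreover have "insert l P \<subseteq> neigh E s" using P(1) s unfolding D_def by auto
      ultimately show "s \<in> (\<Union>P\<in>Q. {s \<in> S. insert l P \<subseteq> neigh E s})" using s unfolding D_def by auto
    qed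
    then have "card D \<le> card (\<Union>P\<in>Q. {s \<in> S. insert l P \<subseteq> neigh E s})"
      using finS finQ by (intro card_mono) auto
    also have "\<dots> \<le> (\<Sum>P\<in>Q. card {s \<in> S. insert l P \<subseteq> neigh E s})" by (rule card_UN_le[OF finQ])
    also have "\<dots> \<le> (\<Sum>P\<in>Q. 2)"
    proof (rule sum_mono)
      fix P assume "P \<in> Q"
      then obtain a b where ab: "P = {a, b}" "a \<noteq> b" "a \<in> N" "b \<in> N"
        unfolding Q_def card_2_iff by auto
      have "l \<noteq> a" "l \<noteq> b" using simple_graph_neigh(3)[OF sg] ab(3,4) unfolding N_def by auto
      then show "card {s \<in> S. insert l P \<subseteq> neigh E s} \<le> 2"
        using ab by (intro fat_planar_common_neigh[OF fp fin, of l a b]) (auto simp: in_neigh_commute)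
    qed
    also have "\<dots> \<le> 42" using cQ by simp
    finally have cD: "card D \<le> 42" .
    have "(\<Sum>s\<in>S. card (neigh E s \<inter> L) - 2) \<le>
        (\<Sum>s\<in>S. (card (neigh E s \<inter> (L - {l})) - 2) + (if s \<in> D then 1 else 0))"
    proof (rule sum_mono)
      fix s assume s: "s \<in> S"
      show "card (neigh E s \<inter> L) - 2 \<le> (card (neigh E s \<inter> (L - {l})) - 2) + (if s \<in> D then 1 else 0)"
      proof (cases "l \<in> neigh E s")
        case False
        then have "neigh E s \<inter> L = neigh E s \<inter> (L - {l})" by auto
        then show ?thesis by simp
      next
        case True
        have "neigh E s \<inter> (L - {l}) = neigh E s \<inter> L - {l}" by auto
        then have "card (neigh E s \<inter> (L - {l})) = card (neigh E s \<inter> L) - 1"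
          using True l(1) by (simp add: card_Diff_singleton_if)
        then show ?thesis using True s unfolding D_def by auto
      qed
    qed
    also have "\<dots> = (\<Sum>s\<in>S. card (neigh E s \<inter> (L - {l})) - 2) + card D"
    proof -
      have "S \<inter> {s. s \<in> D} = D" unfolding D_def by auto
      then show ?thesis using finS by (simp add: sum.distrib sum.If_cases)
    qed
    also have "(\<Sum>s\<in>S. card (neigh E s \<inter> (L - {l})) - 2) \<le> 42 * card (L - {l})"
    proof (rule less.hyps)
      show "card (L - {l}) < card L" using l(1) finL by (rule card_Diff1_less[rotated])
      show "L - {l} \<subseteq> V" "S \<subseteq> V" using less.prems(1,2) by auto
      show "{a, b} \<in> E" if "s \<in> S" "a \<in> neigh E s \<inter> (L - {l})" "b \<in> neigh E s \<inter> (L - {l})" "a \<noteq> b" for s a b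
        by (rule less.prems(3)[OF that(1)]) (use that in auto)
    qed
    finally show ?thesis using cD card_Suc_Diff1[OF finL l(1)] by linarith
  qed
qed

text \<open>As many vertices of \<open>S\<close> as possible are contracted into new edges between two of their
  neighbours in \<open>L\<close>. For the others, the neighbours in \<open>L\<close> then form cliques, and \<open>clique_excess\<close>
  applies.\<close>

lemma bipartite_degree_sum:
  assumes fp: "fat_planar V E" and fin: "finite V" and LV: "L \<subseteq> V" and SV: "S \<subseteq> V" and LS: "L \<inter> S = {}"
  shows "(\<Sum>s\<in>S. card (neigh E s \<inter> L)) \<le> 2 * card S + 54 * card L"
proof -
  have finL: "finite L" and finS: "finite S" using finite_subset[OF LV fin] finite_subset[OF SV fin] by simp_all
  define B where "B T = {e \<in> E. \<exists>l\<in>L. \<exists>s\<in>T. e = {l, s}}" for T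
  \<comment> \<open>\<open>T\<close> consists of the contracted vertices, each traded for one new
    edge in \<open>F\<close>, while the edges between \<open>L\<close> and the rest of
    \<open>S\<close> stay intact.\<close>
  define P where "P = (\<lambda>(T, F). T \<subseteq> S \<and> F \<subseteq> Pow L \<and> card F = card T \<and> fat_planar (L \<union> (S - T)) (F \<union> B (S - T)))"
  have "fat_planar (L \<union> S) (B S)"
    by (rule fat_planar_mono[OF fp]) (use LV SV in \<open>auto simp: B_def\<close>)
  then have "P ({}, {})" unfolding P_def by simp
  moreover have "\<forall>q. P q \<longrightarrow> card (fst q) < Suc (card S)"
    unfolding P_def using finS by (auto intro!: le_imp_less_Suc card_mono)
  ultimately have "\<exists>q. P q \<and> (\<forall>r. P r \<longrightarrow> card (fst r) \<le> card (fst q))"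
    by (rule Lattices_Big.ex_has_greatest_nat)
  then obtain T F where PT: "P (T, F)" and maxT: "\<And>T' F'. P (T', F') \<Longrightarrow> card T' \<le> card T"
    by fastforce
  then have TS: "T \<subseteq> S" and FL: "F \<subseteq> Pow L" and cF: "card F = card T"
    and fp1: "fat_planar (L \<union> (S - T)) (F \<union> B (S - T))" unfolding P_def by auto
  let ?E = "F \<union> B (S - T)"
  have finT: "finite T" and finF: "finite F"
    using finite_subset[OF TS finS] finite_subset[OF FL] finL by simp_all
  have nb: "neigh ?E s \<inter> L = neigh E s \<inter> L" if s: "s \<in> S - T" for s
  proof -
    have "s \<notin> L" using s LS by auto
    then have "{s, x} \<notin> F" for x using FL by auto
    then show ?thesis using s unfolding neigh_def B_def by (auto simp: insert_commute)
  qed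
  have clique: "{a, b} \<in> F" if s: "s \<in> S - T" and a: "a \<in> neigh E s \<inter> L" and b: "b \<in> neigh E s \<inter> L"
    and ab: "a \<noteq> b" for s a b
  proof (rule ccontr)
    assume abF: "{a, b} \<notin> F"
    have sL: "s \<notin> L" using s LS by auto
    have "a \<in> neigh ?E s" "b \<in> neigh ?E s" using nb[OF s] a b by auto
    then have "{s, a} \<in> ?E" "{s, b} \<in> ?E" unfolding neigh_def by auto
    note sup = fat_planar_suppress[OF fp1 this ab]
    have "fat_planar (L \<union> (S - insert s T)) (insert {a, b} F \<union> B (S - insert s T))"
    proof (rule fat_planar_mono[OF sup])
      show "L \<union> (S - insert s T) \<subseteq> L \<union> (S - T) - {s}" using sL by auto
      have "s \<notin> e" if "e \<in> F" for e using that FL sL by auto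
      moreover have "e \<in> B (S - T) \<and> s \<notin> e" if "e \<in> B (S - insert s T)" for e
        using that sL unfolding B_def by auto
      ultimately show "insert {a, b} F \<union> B (S - insert s T) \<subseteq> insert {a, b} {e \<in> ?E. s \<notin> e}"
        by auto
      show "e \<subseteq> L \<union> (S - insert s T)" if "e \<in> insert {a, b} F \<union> B (S - insert s T)" for e
        using that a b FL unfolding B_def by auto
    qed
    then have "P (insert s T, insert {a, b} F)"
      unfolding P_def using s TS FL a b cF abF finF finT by auto
    from maxT[OF this] show False using s finT by simp
  qed
  have "(\<Sum>s\<in>S - T. card (neigh ?E s \<inter> L) - 2) \<le> 42 * card L"
  proof (rule clique_excess[OF fp1])
    fix s a b assume "s \<in> S - T" "a \<in> neigh ?E s \<inter> L" "b \<in> neigh ?E s \<inter> L" "a \<noteq> b"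
    then show "{a, b} \<in> ?E" using clique nb by blast
  qed (use finL finS in auto)
  moreover have "(\<Sum>s\<in>S - T. card (neigh E s \<inter> L)) \<le> (\<Sum>s\<in>S - T. 2 + (card (neigh ?E s \<inter> L) - 2))"
    using nb by (intro sum_mono) simp
  ultimately have 1: "(\<Sum>s\<in>S - T. card (neigh E s \<inter> L)) \<le> 2 * card (S - T) + 42 * card L"
    by (simp only: sum.distrib) simp
  have "(\<Sum>s\<in>T. card (neigh E s \<inter> L)) = card (SIGMA s:T. neigh E s \<inter> L)"
    using finT finL by simp
  also have "\<dots> \<le> card (B T)"
  proof (rule card_inj_on_le[of "\<lambda>(s, l). {l, s}"])
    show "inj_on (\<lambda>(s, l). {l, s}) (SIGMA s:T. neigh E s \<inter> L)"
      using TS LS by (auto simp: inj_on_def doubleton_eq_iff)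
    show "(\<lambda>(s, l). {l, s}) ` (SIGMA s:T. neigh E s \<inter> L) \<subseteq> B T"
      unfolding B_def neigh_def by (auto simp: insert_commute)
    show "finite (B T)" using simple_graph_finite[OF fat_planar_simple_graph[OF fp fin]] unfolding B_def by simp
  qed
  also have "\<dots> \<le> 4 * card (L \<union> T)"
  proof (rule fat_planar_card_edges_le)
    show "fat_planar (L \<union> T) (B T)"
      by (rule fat_planar_mono[OF fp]) (use LV SV TS in \<open>auto simp: B_def\<close>)
  qed (use finL finT in auto)
  also have "card (L \<union> T) \<le> card L + card T" by (rule card_Un_le)
  finally have 2: "(\<Sum>s\<in>T. card (neigh E s \<inter> L)) \<le> 4 * (card L + card T)" by simp
  \<comment> \<open>The traded edges form a planar graph on \<open>L\<close>, so \<open>T\<close> is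
    small and the crude edge bound is good enough for it. Altogether
    \<open>54 = 42 + 4 + 2 * 4\<close>.\<close>
  have "fat_planar L F"
    by (rule fat_planar_mono[OF fp1]) (use FL in auto)
  then have 3: "card T \<le> 4 * card L" using fat_planar_card_edges_le finL cF by metis
  have "(\<Sum>s\<in>S. card (neigh E s \<inter> L)) = (\<Sum>s\<in>S - T. card (neigh E s \<inter> L)) + (\<Sum>s\<in>T. card (neigh E s \<inter> L))"
    by (rule sum.subset_diff[OF TS finS])
  moreover have "card S = card (S - T) + card T"
    using TS finS finT by (metis card_Diff_subset card_mono le_add_diff_inverse2)
  ultimately show ?thesis using 1 2 3 by simp
qed

text \<open>The part of \<open>A\<close> inside \<open>L\<close> adds at most twice the number of
  edges within \<open>L\<close>, which is at most \<open>4 * card L\<close>; this raises 54 to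
  62.\<close>

lemma neighbourhood_sum:
  assumes fp: "fat_planar V E" and fin: "finite V" and L: "L \<subseteq> V" and A: "A \<subseteq> V"
  shows "(\<Sum>v\<in>A. card (neigh E v \<inter> L)) \<le> 2 * card A + 62 * card L"
proof -
  have finL: "finite L" and finA: "finite A" using finite_subset[OF L fin] finite_subset[OF A fin] by simp_all
  have "(\<Sum>v\<in>A - L. card (neigh E v \<inter> L)) \<le> 2 * card (A - L) + 54 * card L"
    by (rule bipartite_degree_sum[OF fp fin L]) (use A in auto)
  moreover have "card (A - L) \<le> card A" using finA by (intro card_mono) auto
  moreover have "(\<Sum>v\<in>A \<inter> L. card (neigh E v \<inter> L)) \<le> 8 * card L"
  proof -
    have fL: "fat_planar L {e \<in> E. e \<subseteq> L}" by (rule fat_planar_induced[OF fp L])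
    have "(\<Sum>v\<in>A \<inter> L. card (neigh E v \<inter> L)) \<le> (\<Sum>v\<in>L. card (neigh E v \<inter> L))"
      using finL by (intro sum_mono2) auto
    also have "\<dots> = (\<Sum>v\<in>L. card (neigh {e \<in> E. e \<subseteq> L} v))"
      by (intro sum.cong arg_cong[where f = card]) (auto simp: neigh_def)
    also have "\<dots> = 2 * card {e \<in> E. e \<subseteq> L}" by (rule handshake[OF fat_planar_simple_graph[OF fL finL]])
    also have "\<dots> \<le> 8 * card L" using fat_planar_card_edges_le[OF fL finL] by simp
    finally show ?thesis .
  qed
  moreover have "(\<Sum>v\<in>A. card (neigh E v \<inter> L)) =
      (\<Sum>v\<in>A \<inter> L. card (neigh E v \<inter> L)) + (\<Sum>v\<in>A - L. card (neigh E v \<inter> L))"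
    using sum.Int_Diff[OF finA] by metis
  ultimately show ?thesis by linarith
qed

section \<open>Weighted edge bounds\<close>

lemma sum_neigh_swap:
  fixes f :: "'v \<Rightarrow> real"
  assumes "finite A" "finite B"
  shows "(\<Sum>v\<in>A. \<Sum>y\<in>neigh E v \<inter> B. f y) = (\<Sum>y\<in>B. f y * card (neigh E y \<inter> A))"
proof -
  have "(\<Sum>v\<in>A. \<Sum>y\<in>neigh E v \<inter> B. f y) = (\<Sum>v\<in>A. sum f {y \<in> B. y \<in> neigh E v})"
    by (intro sum.cong) auto
  also have "\<dots> = (\<Sum>y\<in>B. \<Sum>v\<in>{v \<in> A. y \<in> neigh E v}. f y)"
    by (rule sum.swap_restrict[OF assms])
  also have "\<dots> = (\<Sum>y\<in>B. f y * card (neigh E y \<inter> A))"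
    by (intro sum.cong) (auto simp: in_neigh_commute[of _ E] Int_def conj_commute)
  finally show ?thesis .
qed

text \<open>With \<open>d y\<close> the number of neighbours of \<open>y\<close> in
  \<open>A\<close>, the claim bounds the sum of \<open>x y * (d y - 62)\<close>. This is linear in
  \<open>x\<close>, so for entries between 0 and 1 the worst case is the indicator of
  \<open>L\<close>, to which the unweighted bound applies.\<close>

lemma weighted_neighbourhood_sum:
  fixes x :: "'v \<Rightarrow> real"
  assumes fp: "fat_planar V E" and fin: "finite V" and A: "A \<subseteq> V"
    and x: "\<And>v. v \<in> V \<Longrightarrow> 0 \<le> x v \<and> x v \<le> 1"
  shows "(\<Sum>v\<in>A. \<Sum>y\<in>neigh E v \<inter> V. x y) \<le> 2 * card A + 62 * (\<Sum>y\<in>V. x y)"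
proof -
  have finA: "finite A" by (rule finite_subset[OF A fin])
  define d where "d y = real (card (neigh E y \<inter> A))" for y
  define L where "L = {y \<in> V. 62 \<le> d y}"
  have LV: "L \<subseteq> V" and finL: "finite L" unfolding L_def using fin by auto
  have "(\<Sum>y\<in>L. d y) = (\<Sum>v\<in>A. \<Sum>y\<in>neigh E v \<inter> L. 1)"
    unfolding d_def by (subst sum_neigh_swap[OF finA finL]) simp
  also have "\<dots> = real (\<Sum>v\<in>A. card (neigh E v \<inter> L))" by simp
  also have "\<dots> \<le> real (2 * card A + 62 * card L)"
    using neighbourhood_sum[OF fp fin LV A] of_nat_le_iff by blast
  finally have L: "(\<Sum>y\<in>L. d y) \<le> 2 * card A + 62 * card L" by simp
  have "(\<Sum>y\<in>V. x y * (d y - 62)) \<le> (\<Sum>y\<in>V. if y \<in> L then d y - 62 else 0)"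
  proof (rule sum_mono)
    fix y assume y: "y \<in> V"
    show "x y * (d y - 62) \<le> (if y \<in> L then d y - 62 else 0)"
      using x[OF y] y unfolding L_def
      by (auto simp: mult_left_le_one_le mult_nonneg_nonpos)
  qed
  also have "\<dots> = (\<Sum>y\<in>L. d y - 62)"
    using fin LV by (simp add: sum.If_cases Int_absorb1)
  also have "\<dots> = (\<Sum>y\<in>L. d y) - 62 * card L" by (simp add: sum_subtractf)
  also have "\<dots> \<le> 2 * card A" using L by simp
  finally have "(\<Sum>y\<in>V. x y * d y) \<le> 2 * card A + 62 * (\<Sum>y\<in>V. x y)"
    by (simp add: right_diff_distrib sum_subtractf sum_distrib_right[symmetric])
  then show ?thesis unfolding d_def sum_neigh_swap[OF finA fin] .
qed

text \<open>Subtracting the least weight \<open>m\<close> from all vertices costs \<open>m\<close>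
  for each ordered adjacent pair, at most \<open>8 * card W * m\<close> in all; a vertex of least
  weight then has weight 0 and drops out. In effect the edge bound is summed over the level sets of
  \<open>x\<close>.\<close>

lemma min_weight_sum:
  fixes x :: "'v \<Rightarrow> real"
  assumes fp: "fat_planar V E" and fin: "finite V"
  shows "W \<subseteq> V \<Longrightarrow> (\<And>v. v \<in> W \<Longrightarrow> 0 \<le> x v) \<Longrightarrow>
    (\<Sum>v\<in>W. \<Sum>y\<in>neigh E v \<inter> W. min (x v) (x y)) \<le> 8 * (\<Sum>v\<in>W. x v)"
proof (induction "card W" arbitrary: W x rule: less_induct)
  case (less W x)
  have finW: "finite W" by (rule finite_subset[OF less.prems(1) fin])
  show ?case
  proof (cases "W = {}")
    case True
    then show ?thesis by simp
  next
    case False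
    define m where "m = Min (x ` W)"
    have mW: "m \<in> x ` W" unfolding m_def using finW False by (intro Min_in) auto
    then obtain w where w: "w \<in> W" "x w = m" by auto
    have m: "m \<le> x v" if "v \<in> W" for v unfolding m_def using finW that by simp
    have m0: "0 \<le> m" using w less.prems(2) by auto
    define z where "z v = x v - m" for v
    define W' where "W' = W - {w}"
    have zw: "z w = 0" unfolding z_def using w by simp
    have z0: "0 \<le> z v" if "v \<in> W" for v unfolding z_def using m[OF that] by simp
    have "(\<Sum>v\<in>W. \<Sum>y\<in>neigh E v \<inter> W. min (x v) (x y)) =
        (\<Sum>v\<in>W. \<Sum>y\<in>neigh E v \<inter> W. m + min (z v) (z y))"
      unfolding z_def by (intro sum.cong) auto
    also have "\<dots> = m * (\<Sum>v\<in>W. card (neigh E v \<inter> W)) + (\<Sum>v\<in>W. \<Sum>y\<in>neigh E v \<inter> W. min (z v) (z y))"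
      by (simp add: sum.distrib sum_distrib_left mult.commute)
    also have "(\<Sum>v\<in>W. \<Sum>y\<in>neigh E v \<inter> W. min (z v) (z y)) = (\<Sum>v\<in>W'. \<Sum>y\<in>neigh E v \<inter> W'. min (z v) (z y))"
    proof -
      have "(\<Sum>v\<in>W. \<Sum>y\<in>neigh E v \<inter> W. min (z v) (z y)) = (\<Sum>v\<in>W'. \<Sum>y\<in>neigh E v \<inter> W. min (z v) (z y))"
      proof (rule sum.mono_neutral_right[OF finW])
        show "\<forall>v\<in>W - W'. (\<Sum>y\<in>neigh E v \<inter> W. min (z v) (z y)) = 0"
          unfolding W'_def using w(1) zw z0 by (auto intro!: sum.neutral)
      qed (auto simp: W'_def)
      also have "\<dots> = (\<Sum>v\<in>W'. \<Sum>y\<in>neigh E v \<inter> W'. min (z v) (z y))"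
      proof (rule sum.cong[OF refl], rule sum.mono_neutral_right)
        fix v assume "v \<in> W'"
        then show "\<forall>y\<in>neigh E v \<inter> W - neigh E v \<inter> W'. min (z v) (z y) = 0"
          unfolding W'_def using zw z0 by auto
      qed (use finW in \<open>auto simp: W'_def\<close>)
      finally show ?thesis .
    qed
    also have "\<dots> \<le> 8 * (\<Sum>v\<in>W'. z v)"
    proof (rule less.hyps)
      show "card W' < card W" unfolding W'_def by (rule card_Diff1_less[OF finW w(1)])
    qed (use less.prems(1) z0 in \<open>auto simp: W'_def\<close>)
    also have "(\<Sum>v\<in>W'. z v) = (\<Sum>v\<in>W. z v)"
      using zw w(1) finW unfolding W'_def by (simp add: sum_diff1)
    also have "\<dots> = (\<Sum>v\<in>W. x v) - card W * m" unfolding z_def by (simp add: sum_subtractf)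
    also have "m * (\<Sum>v\<in>W. card (neigh E v \<inter> W)) \<le> m * (8 * card W)"
    proof (intro mult_left_mono m0)
      have fW: "fat_planar W {e \<in> E. e \<subseteq> W}" by (rule fat_planar_induced[OF fp less.prems(1)])
      have "(\<Sum>v\<in>W. card (neigh E v \<inter> W)) = (\<Sum>v\<in>W. card (neigh {e \<in> E. e \<subseteq> W} v))"
        by (intro sum.cong arg_cong[where f = card]) (auto simp: neigh_def)
      also have "\<dots> = 2 * card {e \<in> E. e \<subseteq> W}" by (rule handshake[OF fat_planar_simple_graph[OF fW finW]])
      also have "\<dots> \<le> 8 * card W" using fat_planar_card_edges_le[OF fW finW] by simp
      finally show "real (\<Sum>v\<in>W. card (neigh E v \<inter> W)) \<le> real (8 * card W)"
        using of_nat_le_iff by blast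
    qed
    finally show ?thesis by (simp add: algebra_simps)
  qed
qed

section \<open>Paths and cycles\<close>

definition path_edges :: "'v list \<Rightarrow> 'v set set" where
  "path_edges c = {{c ! i, c ! Suc i} |i. Suc i < length c}"

lemma path_edges_Cons: "path_edges (a # b # c) = insert {a, b} (path_edges (b # c))"
proof (intro equalityI subsetI)
  fix e assume "e \<in> path_edges (a # b # c)"
  then obtain i where i: "Suc i < length (a # b # c)" "e = {(a # b # c) ! i, (a # b # c) ! Suc i}"
    unfolding path_edges_def by auto
  then show "e \<in> insert {a, b} (path_edges (b # c))"
    unfolding path_edges_def by (cases i) auto
next
  fix e assume "e \<in> insert {a, b} (path_edges (b # c))"
  then consider "e = {a, b}" | i where "Suc i < length (b # c)" "e = {(b # c) ! i, (b # c) ! Suc i}"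
    unfolding path_edges_def by auto
  then show "e \<in> path_edges (a # b # c)"
  proof cases
    case 1
    then show ?thesis unfolding path_edges_def by (intro CollectI exI[of _ 0]) simp
  next
    case (2 i)
    then show ?thesis unfolding path_edges_def by (intro CollectI exI[of _ "Suc i"]) simp
  qed
qed

lemma path_edges_Nil [simp]: "path_edges [] = {}" and path_edges_single [simp]: "path_edges [a] = {}"
  unfolding path_edges_def by auto

lemma path_edges_append:
  "path_edges c \<union> path_edges d \<subseteq> path_edges (c @ d)"
proof
  fix e assume "e \<in> path_edges c \<union> path_edges d"
  then consider i where "Suc i < length c" "e = {c ! i, c ! Suc i}" | i where "Suc i < length d" "e = {d ! i, d ! Suc i}"
    unfolding path_edges_def by auto
  then show "e \<in> path_edges (c @ d)"
  proof cases
    case (1 i)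
    then show ?thesis unfolding path_edges_def
      by (intro CollectI exI[of _ i]) (simp add: nth_append)
  next
    case (2 i)
    then show ?thesis unfolding path_edges_def
      by (intro CollectI exI[of _ "length c + i"]) (simp add: nth_append)
  qed
qed

lemma path_edges_subset_set: "e \<in> path_edges c \<Longrightarrow> e \<subseteq> set c"
  unfolding path_edges_def by auto

lemma path_edges_snoc:
  "c \<noteq> [] \<Longrightarrow> path_edges (c @ [b]) \<subseteq> insert {last c, b} (path_edges c)"
proof
  fix e assume c: "c \<noteq> []" and "e \<in> path_edges (c @ [b])"
  then obtain i where i: "i < length c" "e = {(c @ [b]) ! i, (c @ [b]) ! Suc i}"
    unfolding path_edges_def by auto
  show "e \<in> insert {last c, b} (path_edges c)"
  proof (cases "Suc i < length c")
    case True
    then show ?thesis using i unfolding path_edges_def by (auto simp: nth_append)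
  next
    case False
    then have "i = length c - 1" "Suc i = length c" using i(1) by auto
    then show ?thesis using i c by (simp add: nth_append last_conv_nth)
  qed
qed

text \<open>A longest path is a whole component, so it can be split off; either it is a cycle or it is
  a path, and then the rest is ordered by induction.\<close>

lemma linear_forest_or_cycle:
  assumes sg: "simple_graph V E"
  shows "R \<subseteq> V \<Longrightarrow> \<forall>v\<in>R. card (neigh E v \<inter> R) \<le> 2 \<Longrightarrow>
    (\<exists>c. distinct c \<and> set c = R \<and> (\<forall>a\<in>R. \<forall>b\<in>R. {a, b} \<in> E \<longrightarrow> {a, b} \<in> path_edges c)) \<or>
    (\<exists>c. distinct c \<and> set c \<subseteq> R \<and> 3 \<le> length c \<and> path_edges c \<subseteq> E \<and> {last c, hd c} \<in> E \<and>
      (\<forall>a\<in>set c. \<forall>b\<in>R. {a, b} \<in> E \<longrightarrow> {a, b} \<in> insert {last c, hd c} (path_edges c)))"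
proof (induction "card R" arbitrary: R rule: less_induct)
  case (less R)
  have finR: "finite R" using finite_subset[OF less.prems(1)] sg unfolding simple_graph_def by simp
  have deg: "card (neigh E v \<inter> R) \<le> 2" if "v \<in> R" for v using less.prems(2) that by simp
  show ?case
  proof (cases "R = {}")
    case True
    then show ?thesis by (intro disjI1 exI[of _ "[]"]) simp
  next
    case False
    then obtain r where r: "r \<in> R" by auto
    define P where "P c \<longleftrightarrow> c \<noteq> [] \<and> distinct c \<and> set c \<subseteq> R \<and> path_edges c \<subseteq> E" for c
    have "P [r]" unfolding P_def using r by simp
    moreover have "\<forall>c. P c \<longrightarrow> length c < Suc (card R)"
    proof (intro allI impI)
      fix c assume "P c"
      then have "card (set c) = length c" "card (set c) \<le> card R"
        unfolding P_def using distinct_card[of c] card_mono[OF finR, of "set c"] by simp_all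
      then show "length c < Suc (card R)" by simp
    qed
    ultimately have "\<exists>c. P c \<and> (\<forall>d. P d \<longrightarrow> length d \<le> length c)"
      by (rule Lattices_Big.ex_has_greatest_nat)
    then obtain c where Pc: "P c" and maxc: "\<And>d. P d \<Longrightarrow> length d \<le> length c" by auto
    then have c: "c \<noteq> []" "distinct c" "set c \<subseteq> R" "path_edges c \<subseteq> E" unfolding P_def by simp_all
    have cE: "{c ! i, c ! Suc i} \<in> E" if "Suc i < length c" for i
      using c(4) that unfolding path_edges_def by auto
    have cR: "c ! i \<in> R" if "i < length c" for i using c(3) nth_mem[OF that] by auto
    \<comment> \<open>An inner vertex already has two neighbours on the path, and the degree bound
      leaves no room for others.\<close>
    have inner: "neigh E (c ! i) \<inter> R = {c ! (i - 1), c ! Suc i}" if i: "0 < i" "Suc i < length c" for i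
    proof (rule sym, rule card_subset_eq)
      show "finite (neigh E (c ! i) \<inter> R)" using finR by simp
      have "{c ! (i - 1), c ! i} \<in> E" using cE[of "i - 1"] i by simp
      then show sub: "{c ! (i - 1), c ! Suc i} \<subseteq> neigh E (c ! i) \<inter> R"
        using cE[OF i(2)] cR[of "i - 1"] cR[OF i(2)] i unfolding neigh_def by (auto simp: insert_commute)
      have "c ! (i - 1) \<noteq> c ! Suc i"
        using nth_eq_iff_index_eq[OF c(2), of "i - 1" "Suc i"] i by simp
      then have "card {c ! (i - 1), c ! Suc i} = 2" by simp
      moreover have "card {c ! (i - 1), c ! Suc i} \<le> card (neigh E (c ! i) \<inter> R)"
        using sub finR by (intro card_mono) auto
      ultimately show "card {c ! (i - 1), c ! Suc i} = card (neigh E (c ! i) \<inter> R)"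
        using deg[OF cR[of i]] i by simp
    qed
    \<comment> \<open>A neighbour of an end that is off the path would give a longer path.\<close>
    have end_in: "b \<in> set c" if ab: "a = hd c \<or> a = last c" "{a, b} \<in> E" "b \<in> R" for a b
    proof (rule ccontr)
      assume b: "b \<notin> set c"
      show False
      proof (cases "a = hd c")
        case True
        obtain a' c' where c': "c = a' # c'" using c(1) by (cases c) auto
        have "P (b # c)" unfolding P_def
          using c ab b True c' by (auto simp: path_edges_Cons insert_commute)
        then show False using maxc by fastforce
      next
        case False
        then have "{last c, b} \<in> E" using ab by simp
        then have "path_edges (c @ [b]) \<subseteq> E" using path_edges_snoc[OF c(1), of b] c(4) by blast
        then have "P (c @ [b])" unfolding P_def using c ab(3) b by simp
        then show False using maxc by fastforce
      qed
    qed
    let ?cl = "{last c, hd c}"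
    have hl: "hd c = c ! 0" "last c = c ! (length c - 1)" using c(1) by (simp_all add: hd_conv_nth last_conv_nth)
    have pe: "{c ! i, c ! j} \<in> path_edges c" if "j = Suc i \<or> i = Suc j" "i < length c" "j < length c" for i j
      using that unfolding path_edges_def by (auto simp: insert_commute)
    have touch: "{a, b} \<in> insert ?cl (path_edges c) \<and> b \<in> set c" if a: "a \<in> set c" and b: "b \<in> R" and ab: "{a, b} \<in> E" for a b
    proof -
      obtain i where i: "i < length c" "a = c ! i" using a by (auto simp: in_set_conv_nth)
      have bn: "b \<in> neigh E a \<inter> R" using ab b unfolding neigh_def by simp
      show ?thesis
      proof (cases "0 < i \<and> Suc i < length c")
        case True
        then have "b = c ! (i - 1) \<or> b = c ! Suc i" using inner[of i] bn i(2) by auto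
        moreover have i': "0 < i" "Suc i < length c" using True by blast+
        then have "i - 1 < length c" "i = Suc (i - 1)" by arith+
        moreover have "{c ! i, c ! (i - 1)} \<in> path_edges c"
          by (rule pe) (use \<open>i = Suc (i - 1)\<close> \<open>i - 1 < length c\<close> i(1) in blast)+
        moreover have "{c ! i, c ! Suc i} \<in> path_edges c" by (rule pe) (use i' i(1) in blast)+
        ultimately show ?thesis using i(2) nth_mem[of "i - 1" c] nth_mem[OF i'(2)] by auto
      next
        case False
        then have "i = 0 \<or> i = length c - 1" using i(1) by auto
        then have "a = hd c \<or> a = last c" using i(2) hl by auto
        then have bc: "b \<in> set c" using end_in ab b by blast
        then obtain j where j: "j < length c" "b = c ! j" by (auto simp: in_set_conv_nth)
        have "a \<noteq> b" using simple_graph_neigh(3)[OF sg] bn by blast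
        then have ij: "i \<noteq> j" using i j by auto
        have "{c ! i, c ! j} \<in> insert ?cl (path_edges c)"
        proof (cases "0 < j \<and> Suc j < length c")
          case True
          have "a \<in> neigh E b \<inter> R" using bn a c(3) by (auto simp: in_neigh_commute)
          then have "c ! i = c ! (j - 1) \<or> c ! i = c ! Suc j" using inner[of j] True i j by auto
          then have "i = j - 1 \<or> i = Suc j" using nth_eq_iff_index_eq[OF c(2)] True i j by auto
          then show ?thesis using pe[where i = i and j = j] i j True by auto
        next
          case jF: False
          have "i = 0 \<and> j = length c - 1 \<or> i = length c - 1 \<and> j = 0"
            using False jF ij i(1) j(1) by auto
          then show ?thesis using hl by (auto simp: insert_commute)
        qed
        then show ?thesis using i j bc by simp
      qed
    qed
    show ?thesis
    proof (cases "?cl \<in> E \<and> 3 \<le> length c")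
      case True
      then show ?thesis using c touch by (intro disjI2 exI[of _ c]) simp
    next
      case False
      \<comment> \<open>On two vertices the closing edge is the path edge itself; a genuine cycle
        needs three.\<close>
      have clp: "?cl \<in> path_edges c" if "?cl \<in> E"
      proof -
        have "last c \<noteq> hd c" using simple_graph_neigh(3)[OF sg, of "hd c" "last c"] that unfolding neigh_def by auto
        then have "length c \<noteq> 1" using hl by auto
        moreover have "length c < 3" "length c \<noteq> 0" using False that c(1) by auto
        ultimately have "length c = 2" by linarith
        then show ?thesis using pe[of 0 1] hl by (simp add: insert_commute)
      qed
      have touch': "{a, b} \<in> path_edges c \<and> b \<in> set c" if "a \<in> set c" "b \<in> R" "{a, b} \<in> E" for a b
        using touch[OF that] clp that(3) by auto
      define R' where "R' = R - set c"
      have "hd c \<in> R" "hd c \<notin> R'" using hd_in_set[OF c(1)] c(3) unfolding R'_def by blast+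
      then have "R' \<subset> R" unfolding R'_def by blast
      then have lessR: "card R' < card R" by (rule psubset_card_mono[OF finR])
      have R'V: "R' \<subseteq> V" using less.prems(1) unfolding R'_def by auto
      have R'deg: "\<forall>v\<in>R'. card (neigh E v \<inter> R') \<le> 2"
      proof
        fix v assume that: "v \<in> R'"
        have "card (neigh E v \<inter> R') \<le> card (neigh E v \<inter> R)"
          using finR unfolding R'_def by (intro card_mono) auto
        moreover have "v \<in> R" using that unfolding R'_def by simp
        ultimately show "card (neigh E v \<inter> R') \<le> 2" using deg[of v] by linarith
      qed
      from less.hyps[OF lessR R'V R'deg] show ?thesis
      proof (elim disjE exE conjE)
        fix d assume 1: "distinct d" "set d = R'" "\<forall>a\<in>R'. \<forall>b\<in>R'. {a, b} \<in> E \<longrightarrow> {a, b} \<in> path_edges d"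
        \<comment> \<open>Concatenation creates a consecutive pair that may be no edge; this is
          harmless, as the list only has to cover the edges.\<close>
        have "{a, b} \<in> path_edges (c @ d)" if ab: "a \<in> R" "b \<in> R" "{a, b} \<in> E" for a b
        proof -
          have "{a, b} \<in> path_edges c \<union> path_edges d"
          proof (cases "a \<in> set c")
            case True
            show ?thesis using touch'[OF True ab(2,3)] by simp
          next
            case aF: False
            have "{b, a} \<in> E" using ab(3) by (simp add: insert_commute)
            then have "b \<notin> set c" using touch'[of b a] aF ab(1) by auto
            then show ?thesis using 1(3) aF ab unfolding R'_def by auto
          qed
          then show ?thesis using path_edges_append by blast
        qed
        then show ?thesis
          using 1(1,2) c(2,3) unfolding R'_def by (intro disjI1 exI[of _ "c @ d"]) auto
      next
        fix d assume 2: "distinct d" "set d \<subseteq> R'" "3 \<le> length d" "path_edges d \<subseteq> E" "{last d, hd d} \<in> E"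
          "\<forall>a\<in>set d. \<forall>b\<in>R'. {a, b} \<in> E \<longrightarrow> {a, b} \<in> insert {last d, hd d} (path_edges d)"
        have "{a, b} \<in> insert {last d, hd d} (path_edges d)" if ab: "a \<in> set d" "b \<in> R" "{a, b} \<in> E" for a b
        proof -
          have a: "a \<notin> set c" "a \<in> R" using ab(1) 2(2) unfolding R'_def by auto
          have "{b, a} \<in> E" using ab(3) by (simp add: insert_commute)
          then have "b \<notin> set c" using touch'[of b a] a by auto
          then have "b \<in> R'" using ab(2) unfolding R'_def by simp
          then show ?thesis using 2(6) ab by blast
        qed
        then show ?thesis using 2(1-5) unfolding R'_def by (intro disjI2 exI[of _ d]) auto
      qed
    qed
  qed
qed

text \<open>\<open>g e\<close> is the set of old edges merged into the new edge \<open>e\<close>. Of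
  any two new edges, one is unchanged or their paths have disjoint vertex sets; this suffices for
  subdividing two disjoint edges.\<close>

lemma point_drawing_subdivision:
  assumes pd: "point_drawing V E p M" and W: "W \<subseteq> V"
    and F: "\<And>e. e \<in> F \<Longrightarrow> \<exists>a b. a \<in> W \<and> b \<in> W \<and> a \<noteq> b \<and> e = {a, b}"
    and g: "\<And>e. e \<in> F \<Longrightarrow> g e \<subseteq> E \<and> path_connected (\<Union>(M ` g e)) \<and> e \<subseteq> \<Union>(g e) \<and> \<Union>(g e) \<inter> W \<subseteq> e"
    and gg: "\<And>e e'. e \<in> F \<Longrightarrow> e' \<in> F \<Longrightarrow> e \<noteq> e' \<Longrightarrow> g e = {e} \<or> g e' = {e'} \<or> \<Union>(g e) \<inter> \<Union>(g e') = {}"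
  shows "point_drawing W F p (\<lambda>e. \<Union>(M ` g e))"
  unfolding point_drawing_def
proof (intro conjI ballI impI)
  note D = point_drawingD[OF pd]
  show "inj_on p W" using inj_on_subset[OF D(1) W] .
  fix e assume e: "e \<in> F"
  note ge = g[OF e]
  show "\<exists>u v. u \<in> W \<and> v \<in> W \<and> u \<noteq> v \<and> e = {u, v}" using F[OF e] .
  show "path_connected (\<Union>(M ` g e))" using ge by simp
  have fV: "f \<subseteq> V" if "f \<in> E" for f using D(2)[OF that] by auto
  show "p ` e \<subseteq> \<Union>(M ` g e)"
  proof
    fix z assume "z \<in> p ` e"
    then obtain a where a: "a \<in> e" "z = p a" by auto
    then obtain f where f: "f \<in> g e" "a \<in> f" using ge by blast
    then have "f \<in> E" using ge by auto
    then have "p a \<in> M f" using D(4)[of f] f(2) by auto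
    then show "z \<in> \<Union>(M ` g e)" using a f by auto
  qed
  show "\<Union>(M ` g e) \<inter> p ` W \<subseteq> p ` e"
  proof
    fix z assume "z \<in> \<Union>(M ` g e) \<inter> p ` W"
    then obtain f a where fa: "f \<in> g e" "z \<in> M f" "a \<in> W" "z = p a" by auto
    then have fE: "f \<in> E" using ge by auto
    then have "z \<in> p ` f" using D(5)[OF fE] fa W by auto
    then obtain b where b: "b \<in> f" "z = p b" by auto
    then have "a = b" using inj_onD[OF D(1), of a b] fa W fV[OF fE] by auto
    then have "a \<in> e" using ge fa b by auto
    then show "z \<in> p ` e" using fa by auto
  qed
  fix e' assume e': "e' \<in> F" "e \<noteq> e'"
  note ge' = g[OF e'(1)]
  have main: "M f \<inter> M f' \<subseteq> p ` (e \<inter> e')" if f: "f \<in> g e" and f': "f' \<in> g e'" for f f'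
  proof -
    have E: "f \<in> E" "f' \<in> E" using ge ge' f f' by auto
    have c2: "card e = 2" "card e' = 2" "e \<subseteq> W" "e' \<subseteq> W" using F[OF e] F[OF e'(1)] by auto
    have fin: "finite e" "finite e'" using c2 by (auto intro: card_ge_0_finite)
    have "f \<noteq> f' \<and> f \<inter> f' \<subseteq> e \<inter> e'"
    proof -
      consider "g e = {e}" | "g e' = {e'}" | "\<Union>(g e) \<inter> \<Union>(g e') = {}" using gg[OF e e'] by blast
      then show ?thesis
      proof cases
        case 1
        then have "f = e" using f by simp
        moreover have "f' \<inter> W \<subseteq> e'" using ge' f' by auto
        moreover have "e \<noteq> f'"
        proof
          assume "e = f'"
          then have "e \<subseteq> e'" using \<open>f' \<inter> W \<subseteq> e'\<close> c2 by auto
          then show False using card_subset_eq[OF fin(2) \<open>e \<subseteq> e'\<close>] c2 e'(2) by simp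
        qed
        ultimately show ?thesis using c2 by auto
      next
        case 2
        then have "f' = e'" using f' by simp
        moreover have "f \<inter> W \<subseteq> e" using ge f by auto
        moreover have "f \<noteq> e'"
        proof
          assume "f = e'"
          then have "e' \<subseteq> e" using \<open>f \<inter> W \<subseteq> e\<close> c2 by auto
          then show False using card_subset_eq[OF fin(1) \<open>e' \<subseteq> e\<close>] c2 e'(2) by simp
        qed
        ultimately show ?thesis using c2 by auto
      next
        case 3
        then have "f \<inter> f' = {}" using f f' by blast
        moreover have "f \<noteq> {}" using D(2)[OF E(1)] by auto
        ultimately show ?thesis by auto
      qed
    qed
    then show ?thesis using D(6)[OF E] by blast
  qed
  show "\<Union>(M ` g e) \<inter> \<Union>(M ` g e') \<subseteq> p ` (e \<inter> e')"
    using main by blast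
qed

lemma path_connected_path_edges:
  assumes pd: "point_drawing V E p M"
  shows "path_edges c \<subseteq> E \<Longrightarrow> 2 \<le> length c \<Longrightarrow>
    path_connected (\<Union>(M ` path_edges c)) \<and> p ` set c \<subseteq> \<Union>(M ` path_edges c)"
proof (induction c)
  case Nil
  then show ?case by simp
next
  case (Cons a c)
  note D = point_drawingD[OF pd]
  from Cons.prems(2) obtain b d where c: "c = b # d" by (cases c) auto
  have e: "{a, b} \<in> E" and sub: "path_edges c \<subseteq> E"
    using Cons.prems(1) unfolding c path_edges_Cons by auto
  have ab: "p a \<in> M {a, b}" "p b \<in> M {a, b}" using D(4)[OF e] by auto
  show ?case
  proof (cases d)
    case Nil
    then show ?thesis using D(3)[OF e] ab unfolding c by (simp add: path_edges_Cons)
  next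
    case (Cons d1 d2)
    then have IH: "path_connected (\<Union>(M ` path_edges c))" "p ` set c \<subseteq> \<Union>(M ` path_edges c)"
      using Cons.IH[OF sub] c by auto
    have "M {a, b} \<inter> \<Union>(M ` path_edges c) \<noteq> {}" using IH(2) ab(2) c by auto
    then have "path_connected (M {a, b} \<union> \<Union>(M ` path_edges c))"
      by (rule path_connected_Un[OF D(3)[OF e] IH(1)])
    then show ?thesis using IH(2) ab(1) unfolding c path_edges_Cons by auto
  qed
qed

text \<open>The vertices \<open>u\<close>, \<open>w\<close> and three consecutive vertices of the
  cycle span a subdivided \<open>K\<^sub>5\<close>: the rest of the cycle joins \<open>c0\<close> to
  \<open>c2\<close>, and \<open>link\<close> joins \<open>u\<close> to \<open>w\<close> off the
  cycle.\<close>

lemma two_apices_over_cycle: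
  assumes pd: "point_drawing V E p M" and c: "distinct c" "3 \<le> length c" "path_edges c \<subseteq> E" "{last c, hd c} \<in> E"
    and uw: "u \<noteq> w" "u \<notin> set c" "w \<notin> set c" "\<And>a. a \<in> set c \<Longrightarrow> {u, a} \<in> E \<and> {w, a} \<in> E"
    and link: "{u, w} \<in> E \<or> (\<exists>r. r \<notin> set c \<and> {u, r} \<in> E \<and> {w, r} \<in> E)"
  shows False
proof -
  note D = point_drawingD[OF pd]
  obtain c0 c1 c2 d where cd: "c = c0 # c1 # c2 # d"
    using c(2) by (metis Suc_le_length_iff numeral_3_eq_3)
  define W where "W = {u, w, c0, c1, c2}"
  define F where "F = {{a, b} |a b. a \<in> W \<and> b \<in> W \<and> a \<noteq> b}"
  \<comment> \<open>For a cycle of length three this is only the closing edge, since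
    \<open>last c\<close> is \<open>c2\<close>.\<close>
  define Q1 where "Q1 = insert {last c, c0} (path_edges (c2 # d))"
  obtain Q2 where Q2: "Q2 \<subseteq> E" "path_connected (\<Union>(M ` Q2))" "{u, w} \<subseteq> \<Union>Q2" "\<Union>Q2 \<inter> set c = {}"
  proof (cases "{u, w} \<in> E")
    case True
    then show thesis using that[of "{{u, w}}"] D(3)[OF True] uw by simp
  next
    case False
    then obtain r where r: "r \<notin> set c" "{u, r} \<in> E" "{w, r} \<in> E" using link by blast
    have "M {u, r} \<inter> M {w, r} \<noteq> {}" using D(4)[OF r(2)] D(4)[OF r(3)] by auto
    then have "path_connected (M {u, r} \<union> M {w, r})"
      by (rule path_connected_Un[OF D(3)[OF r(2)] D(3)[OF r(3)]])
    then show thesis using that[of "{{u, r}, {w, r}}"] r uw by simp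
  qed
  have Q1: "Q1 \<subseteq> E" "path_connected (\<Union>(M ` Q1))" "{c0, c2} \<subseteq> \<Union>Q1" "\<Union>Q1 \<subseteq> insert c0 (set (c2 # d))"
  proof -
    have sub: "path_edges (c2 # d) \<subseteq> E" using c(3) unfolding cd path_edges_Cons by auto
    have l: "{last c, c0} \<in> E" using c(4) cd by simp
    have last: "last c = last (c2 # d)" using cd by simp
    show "Q1 \<subseteq> E" unfolding Q1_def using sub l by simp
    show "\<Union>Q1 \<subseteq> insert c0 (set (c2 # d))"
      unfolding Q1_def using path_edges_subset_set[of _ "c2 # d"] last_in_set[of "c2 # d"] last by auto
    show "path_connected (\<Union>(M ` Q1))"
    proof (cases d)
      case Nil
      then show ?thesis unfolding Q1_def using D(3)[OF l] by simp
    next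
      case (Cons d1 d2)
      then have pc: "path_connected (\<Union>(M ` path_edges (c2 # d)))" "p ` set (c2 # d) \<subseteq> \<Union>(M ` path_edges (c2 # d))"
        using path_connected_path_edges[OF pd sub] by auto
      have "p (last c) \<in> M {last c, c0}" using D(4)[OF l] by auto
      moreover have "last c \<in> set (c2 # d)" unfolding last by (rule last_in_set) simp
      then have "p (last c) \<in> \<Union>(M ` path_edges (c2 # d))" using pc(2) by (meson image_eqI subsetD)
      ultimately have "p (last c) \<in> M {last c, c0} \<inter> \<Union>(M ` path_edges (c2 # d))" by (rule IntI)
      then have "M {last c, c0} \<inter> \<Union>(M ` path_edges (c2 # d)) \<noteq> {}"
        by (metis empty_iff)
      then have "path_connected (M {last c, c0} \<union> \<Union>(M ` path_edges (c2 # d)))"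
        by (rule path_connected_Un[OF D(3)[OF l] pc(1)])
      then show ?thesis unfolding Q1_def by simp
    qed
    show "{c0, c2} \<subseteq> \<Union>Q1"
    proof (cases d)
      case Nil
      then have "c2 = last c" using last by simp
      then show ?thesis unfolding Q1_def by blast
    next
      case (Cons d1 d2)
      then have "{c2, d1} \<in> Q1" unfolding Q1_def by (simp add: path_edges_Cons)
      then show ?thesis unfolding Q1_def by auto
    qed
  qed
  define g where "g e = (if e = {c0, c2} then Q1 else if e = {u, w} then Q2 else {e})" for e
  have dW: "distinct [u, w, c0, c1, c2]" using uw c(1) cd by auto
  have ne: "{c0, c2} \<noteq> {u, w}" using dW by (auto simp: doubleton_eq_iff)
  have WV: "W \<subseteq> V"
  proof
    have "{u, c0} \<in> E" "{w, c0} \<in> E" "{u, c1} \<in> E" "{u, c2} \<in> E" using uw(4) cd by auto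
    from this[THEN D(2)] show "a \<in> V" if "a \<in> W" for a
      using that unfolding W_def by (auto simp: doubleton_eq_iff)
  qed
  have simple: "e \<in> E" if e: "e \<in> F" "e \<noteq> {c0, c2}" "e \<noteq> {u, w}" for e
  proof -
    have c01: "{c0, c1} \<in> E" "{c1, c2} \<in> E" using c(3) unfolding cd path_edges_Cons by auto
    have a: "{u, a} \<in> E" "{w, a} \<in> E" if "a \<in> {c0, c1, c2}" for a using uw(4) that cd by auto
    obtain x y where "e = {x, y}" "x \<in> W" "y \<in> W" "x \<noteq> y" using e(1) unfolding F_def by auto
    then show ?thesis
      using e(2,3) c01 a[of c0] a[of c1] a[of c2] unfolding W_def by (auto simp: insert_commute)
  qed
  have "point_drawing W F p (\<lambda>e. \<Union>(M ` g e))"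
  proof (rule point_drawing_subdivision[OF pd WV])
    show "\<exists>a b. a \<in> W \<and> b \<in> W \<and> a \<noteq> b \<and> e = {a, b}" if "e \<in> F" for e using that unfolding F_def by auto
    show "g e \<subseteq> E \<and> path_connected (\<Union>(M ` g e)) \<and> e \<subseteq> \<Union>(g e) \<and> \<Union>(g e) \<inter> W \<subseteq> e" if e: "e \<in> F" for e
    proof -
      consider "e = {c0, c2}" | "e = {u, w}" | "e \<noteq> {c0, c2}" "e \<noteq> {u, w}" by blast
      then show ?thesis
      proof cases
        case 1
        then have "g e = Q1" unfolding g_def by simp
        moreover have "\<Union>Q1 \<inter> W \<subseteq> {c0, c2}"
          using Q1(4) uw c(1) unfolding W_def cd by auto
        ultimately show ?thesis using Q1(1-3) 1 by simp
      next
        case 2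
        then have "g e = Q2" unfolding g_def using ne by simp
        moreover have "\<Union>Q2 \<inter> W \<subseteq> {u, w}" using Q2(4) unfolding W_def cd by auto
        ultimately show ?thesis using Q2(1-3) 2 by simp
      next
        case 3
        then have "g e = {e}" unfolding g_def by simp
        then show ?thesis using simple[OF e 3] D(3) by simp
      qed
    qed
    fix e e' assume "e \<in> F" "e' \<in> F" "e \<noteq> e'"
    have "insert c0 (set (c2 # d)) \<subseteq> set c" unfolding cd by auto
    then have disj: "\<Union>Q1 \<inter> \<Union>Q2 = {}" using Q1(4) Q2(4) by blast
    consider "e \<noteq> {c0, c2} \<and> e \<noteq> {u, w}" | "e' \<noteq> {c0, c2} \<and> e' \<noteq> {u, w}"
      | "e = {c0, c2} \<and> e' = {u, w}" | "e = {u, w} \<and> e' = {c0, c2}"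
      using \<open>e \<noteq> e'\<close> by blast
    then show "g e = {e} \<or> g e' = {e'} \<or> \<Union>(g e) \<inter> \<Union>(g e') = {}"
    proof cases
      case 3
      then have "g e = Q1" "g e' = Q2" unfolding g_def using ne by simp_all
      then show ?thesis using disj by simp
    next
      case 4
      then have "g e = Q2" "g e' = Q1" unfolding g_def using ne by simp_all
      then show ?thesis using disj by (simp add: Int_commute)
    qed (simp_all add: g_def)
  qed
  then show False
    by (rule no_point_drawing_K5[OF _ dW]) (auto simp: F_def W_def)
qed

section \<open>Two dominant vertices\<close>

text \<open>By the weighted neighbourhood bound, \<open>l\<^sup>2 x\<^sub>z\<close> is at most \<open>2 deg z\<close> up to an error of
  about 4 percent of \<open>n\<close>. Hence large entries need degree close to \<open>n\<close>, and \<open>K\<^sub>3\<^sub>,\<^sub>3\<close>-freeness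
  leaves room for only two such vertices.\<close>

lemma two_dominant_vertices:
  fixes x :: "'v \<Rightarrow> real"
  assumes fp: "fat_planar V E" and fin: "finite V" and n: "4500000 \<le> real (card V)"
    and x: "\<And>v. v \<in> V \<Longrightarrow> 0 \<le> x v \<and> x v \<le> 1"
    and eig: "\<And>v. v \<in> V \<Longrightarrow> (\<Sum>y\<in>neigh E v. x y) = l * x v"
    and l0: "0 < l" and l2: "2 * real (card V) - 4 \<le> l\<^sup>2" and u: "u \<in> V" "x u = 1"
  obtains w where "w \<in> V" "w \<noteq> u" "19 / 20 \<le> x w" "\<And>v. v \<in> V - {u, w} \<Longrightarrow> x v \<le> 11 / 100"
proof -
  note sg = fat_planar_simple_graph[OF fp fin]
  note nb = simple_graph_neigh[OF sg]
  note finN = simple_graph_finite_neigh[OF sg]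
  define n where "n = real (card V)"
  define M where "M = (\<Sum>v\<in>V. x v)"
  define d where "d v = real (card (neigh E v))" for v
  have n45: "4500000 \<le> n" using n unfolding n_def .
  have NV: "neigh E v \<inter> V = neigh E v" for v using nb(2) by blast
  have NV': "neigh E v \<subseteq> V" for v using nb(2) by blast
  have W: "(\<Sum>v\<in>A. \<Sum>y\<in>neigh E v. z y) \<le> 2 * card A + 62 * (\<Sum>y\<in>V. z y)"
    if "A \<subseteq> V" "\<And>v. v \<in> V \<Longrightarrow> 0 \<le> z v \<and> z v \<le> 1" for A and z :: "'v \<Rightarrow> real"
    using weighted_neighbourhood_sum[OF fp fin that] unfolding NV .
  \<comment> \<open>\<open>2 * 4500000 - 4\<close> exceeds
    \<open>2999\<^sup>2 = 8994001\<close>.\<close>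
  have l: "2999 \<le> l"
  proof (rule ccontr)
    assume "\<not> 2999 \<le> l"
    then have "l\<^sup>2 \<le> 2999\<^sup>2" using l0 by (intro power_mono) auto
    then show False using l2 n by simp
  qed
  have M0: "0 \<le> M" unfolding M_def using x by (intro sum_nonneg) auto
  have "l * M = (\<Sum>v\<in>V. \<Sum>y\<in>neigh E v. x y)"
    unfolding M_def sum_distrib_left using eig by (intro sum.cong) auto
  also have "\<dots> \<le> 2 * n + 62 * M" using W[of V x] x unfolding n_def M_def by simp
  finally have "(l - 62) * M \<le> 2 * n" by (simp add: algebra_simps)
  moreover have "2937 * M \<le> (l - 62) * M" using l M0 by (intro mult_right_mono) auto
  \<comment> \<open>\<open>62 * 2 / 2937\<close> is about 0.0422; this is the error, relative to
    \<open>n\<close>, in all estimates below.\<close>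
  ultimately have K: "62 * M \<le> 423 / 10000 * n" using n45 by linarith
  have two_step: "l\<^sup>2 * x z = (\<Sum>v\<in>neigh E z. \<Sum>y\<in>neigh E v. x y)" if z: "z \<in> V" for z
  proof -
    have "l\<^sup>2 * x z = l * (\<Sum>v\<in>neigh E z. x v)" using eig[OF z] by (simp add: power2_eq_square)
    also have "\<dots> = (\<Sum>v\<in>neigh E z. \<Sum>y\<in>neigh E v. x y)"
      unfolding sum_distrib_left using eig nb(2) by (intro sum.cong) auto
    finally show ?thesis .
  qed
  have upper: "(2 * n - 4) * x z \<le> 2 * d z + 423 / 10000 * n" if z: "z \<in> V" for z
  proof -
    have "(2 * n - 4) * x z \<le> l\<^sup>2 * x z" using l2 x[OF z] unfolding n_def by (intro mult_right_mono) auto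
    also have "\<dots> \<le> 2 * d z + 62 * M"
      unfolding two_step[OF z] d_def M_def using W[OF NV'[of z] x] by simp
    finally show ?thesis using K by simp
  qed
  have dle: "d v \<le> n" for v
    unfolding d_def n_def using card_mono[OF fin NV'] by simp
  have du: "2 * n - 4 \<le> 2 * d u + 423 / 10000 * n" using upper[OF u(1)] u(2) by simp
  have "V - {u} \<noteq> {}"
  proof
    assume "V - {u} = {}"
    then have "card V \<le> card {u}" by (intro card_mono) auto
    then show False using n by simp
  qed
  then have Mx: "Max (x ` (V - {u})) \<in> x ` (V - {u})" using fin by (intro Max_in) auto
  then obtain w where "Max (x ` (V - {u})) = x w" "w \<in> V - {u}" by (rule imageE)
  then have w: "w \<in> V" "w \<noteq> u" "x w = Max (x ` (V - {u}))" by simp_all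
  define b where "b = x w"
  have le_b: "x v \<le> b" if "v \<in> V" "v \<noteq> u" for v
    unfolding b_def w(3) using that fin by (intro Max_ge) auto
  have b1: "b \<le> 1" "0 \<le> b" unfolding b_def using x[OF w(1)] by auto
  have b0: "0 < b"
  proof (rule ccontr)
    assume "\<not> 0 < b"
    have "x v = 0" if v: "v \<in> neigh E u" for v
    proof -
      have "v \<in> V" "v \<noteq> u" using nb(2)[OF v] nb(3)[OF v] by simp_all
      then show ?thesis using le_b x \<open>\<not> 0 < b\<close> by (metis antisym linorder_not_less order_trans)
    qed
    then have "(\<Sum>y\<in>neigh E u. x y) = 0" by (intro sum.neutral) auto
    then show False using eig[OF u(1)] u(2) l0 by simp
  qed
  define S where "S = (\<Sum>v\<in>neigh E u. \<Sum>y\<in>neigh E v - {u}. x y)"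
  have split: "(\<Sum>v\<in>neigh E u. \<Sum>y\<in>neigh E v. z y) = d u * z u + (\<Sum>v\<in>neigh E u. \<Sum>y\<in>neigh E v - {u}. z y)"
    for z :: "'v \<Rightarrow> real"
  proof -
    have "(\<Sum>v\<in>neigh E u. \<Sum>y\<in>neigh E v. z y) = (\<Sum>v\<in>neigh E u. z u + (\<Sum>y\<in>neigh E v - {u}. z y))"
    proof (intro sum.cong refl)
      fix v assume "v \<in> neigh E u"
      then have "u \<in> neigh E v" by (simp add: in_neigh_commute)
      then show "(\<Sum>y\<in>neigh E v. z y) = z u + (\<Sum>y\<in>neigh E v - {u}. z y)"
        by (rule sum.remove[OF finN])
    qed
    then show ?thesis unfolding d_def by (simp only: sum.distrib sum_constant)
  qed
  have SS: "l\<^sup>2 = d u + S" using two_step[OF u(1)] split[of x] u(2) unfolding S_def by simp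
  \<comment> \<open>Applied to \<open>x\<close> itself, the neighbourhood bound would not involve
    \<open>b\<close>. As \<open>b\<close> is the largest entry apart from that of \<open>u\<close>,
    dividing the other entries by \<open>b\<close> keeps them at most 1, and the bound then yields
    \<open>S \<le> b * d u\<close> up to the error.\<close>
  define z where "z y = (if y = u then 1 else x y / b)" for y
  have "(\<Sum>v\<in>neigh E u. \<Sum>y\<in>neigh E v. z y) \<le> 2 * card (neigh E u) + 62 * (\<Sum>y\<in>V. z y)"
  proof (rule W[OF NV'])
    fix v assume v: "v \<in> V"
    show "0 \<le> z v \<and> z v \<le> 1"
      unfolding z_def using x[OF v] le_b[OF v] b0 by auto
  qed
  moreover have "(\<Sum>v\<in>neigh E u. \<Sum>y\<in>neigh E v. z y) = d u + S / b"
  proof -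
    have "(\<Sum>v\<in>neigh E u. \<Sum>y\<in>neigh E v - {u}. z y) = (\<Sum>v\<in>neigh E u. \<Sum>y\<in>neigh E v - {u}. x y / b)"
      unfolding z_def by (intro sum.cong) auto
    then show ?thesis unfolding split S_def by (simp add: z_def sum_divide_distrib)
  qed
  moreover have "(\<Sum>y\<in>V. z y) = 1 + (M - 1) / b"
  proof -
    have "(\<Sum>y\<in>V. z y) = z u + (\<Sum>y\<in>V - {u}. z y)" by (rule sum.remove[OF fin u(1)])
    also have "(\<Sum>y\<in>V - {u}. z y) = (\<Sum>y\<in>V - {u}. x y) / b"
      unfolding z_def sum_divide_distrib by (intro sum.cong) auto
    also have "(\<Sum>y\<in>V - {u}. x y) = M - 1" unfolding M_def using sum.remove[OF fin u(1), of x] u(2) by simp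
    finally show ?thesis unfolding z_def by simp
  qed
  ultimately have "d u + S / b \<le> 2 * d u + 62 * (1 + (M - 1) / b)" unfolding d_def by simp
  then have "b * (d u + S / b) \<le> b * (2 * d u + 62 * (1 + (M - 1) / b))"
    using b0 by (intro mult_left_mono) auto
  moreover have "b * (d u + S / b) = b * d u + S" using b0 by (simp add: distrib_left)
  moreover have "b * (2 * d u + 62 * (1 + (M - 1) / b)) = 2 * (b * d u) + 62 * (b + M - 1)"
    using b0 by (simp add: field_simps)
  ultimately have "S \<le> b * d u + 62 * (b + M - 1)" by linarith
  also have "\<dots> \<le> b * n + 62 * M"
    using mult_left_mono[OF dle[of u], of b] b1 by simp
  \<comment> \<open>So \<open>l\<^sup>2 = d u + S\<close> is at most about
    \<open>(1 + b) * n\<close>, while it is at least about \<open>2 * n\<close>; hence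
    \<open>b\<close> is nearly 1.\<close>
  finally have "2 * n - 4 \<le> n + b * n + 423 / 10000 * n"
    using SS l2 dle[of u] K unfolding n_def by simp
  then have "(9577 / 10000 - b) * n \<le> 4" by (simp add: algebra_simps)
  have bb: "957 / 1000 \<le> b"
  proof (rule ccontr)
    assume "\<not> 957 / 1000 \<le> b"
    then have "7 / 10000 * n \<le> (9577 / 10000 - b) * n" using n45 by (intro mult_right_mono) auto
    then have "7 / 10000 * n \<le> 4" using \<open>(9577 / 10000 - b) * n \<le> 4\<close> by (rule order_trans)
    then show False using n45 by simp
  qed
  have "(2 * n - 4) * (957 / 1000) \<le> (2 * n - 4) * x w"
    using bb n45 unfolding b_def by (intro mult_left_mono) auto
  then have dw: "(2 * n - 4) * (957 / 1000) \<le> 2 * d w + 423 / 10000 * n" using upper[OF w(1)] by linarith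
  \<comment> \<open>The degrees of \<open>u\<close> and \<open>w\<close> are at least about
    \<open>0.978 * n\<close> and \<open>0.935 * n\<close>, so all but about
    \<open>0.0853 * n\<close> vertices lie in \<open>C\<close>. Any third vertex has at most two
    neighbours in \<open>C\<close>.\<close>
  define C where "C = neigh E u \<inter> neigh E w"
  have finC: "finite C" unfolding C_def using finN by simp
  have "card (neigh E u) + card (neigh E w) = card (neigh E u \<union> neigh E w) + card C"
    unfolding C_def using finN by (intro card_Un_Int) auto
  moreover have "card (neigh E u \<union> neigh E w) \<le> card V" using fin NV' by (intro card_mono) auto
  ultimately have "d u + d w \<le> n + card C" unfolding d_def n_def by linarith
  have "x v \<le> 11 / 100" if v: "v \<in> V - {u, w}" for v
  proof -
    have "card (neigh E v \<inter> C) \<le> 2"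
      by (rule fat_planar_common_neigh[OF fp fin, of v u w]) (use v w(2) in \<open>auto simp: C_def\<close>)
    moreover have "card (neigh E v - C) \<le> card (V - C)" using fin NV' by (intro card_mono) auto
    moreover have "card (V - C) = card V - card C" "card C \<le> card V"
      using finC fin NV' unfolding C_def by (auto intro!: card_Diff_subset card_mono)
    moreover have "card (neigh E v) = card (neigh E v \<inter> C) + card (neigh E v - C)"
      using finN[of v] by (metis card_Int_Diff)
    ultimately have "d v \<le> 2 + n - card C" unfolding d_def n_def by linarith
    \<comment> \<open>\<open>2 * 0.0853 + 0.0423 = 0.2129\<close>; the slack up to 0.2134 absorbs
      additive constants, and half of it is below 0.11.\<close>
    then have "2 * d v + 423 / 10000 * n \<le> 2134 / 10000 * n + 12"
      using \<open>d u + d w \<le> n + card C\<close> du dw n45 by (simp add: algebra_simps)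
    moreover have "(2 * n - 4) * x v \<le> 2 * d v + 423 / 10000 * n" using upper[of v] v by simp
    ultimately have "(2 * n - 4) * x v \<le> 2134 / 10000 * n + 12" by linarith
    also have "\<dots> \<le> (2 * n - 4) * (11 / 100)" using n45 by simp
    finally show ?thesis by (rule mult_left_le_imp_le) (use n45 in simp)
  qed
  then show thesis using that[of w] w bb unfolding b_def by simp
qed

section \<open>Comparison with a fan\<close>

text \<open>The quadratic form of the adjacency matrix, in which each edge counts twice.\<close>

definition quad :: "'v set \<Rightarrow> 'v set set \<Rightarrow> ('v \<Rightarrow> real) \<Rightarrow> real" where
  "quad V E x = (\<Sum>a\<in>V. \<Sum>b\<in>neigh E a. x a * x b)"

text \<open>The join of \<open>K\<^sub>2\<close> and a path on arbitrary labels: the comparison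
  takes place on the vertex set of the given graph, with hubs \<open>u\<close>, \<open>w\<close> and
  the path in the order of \<open>rs\<close>.\<close>

definition fan_edges :: "'v \<Rightarrow> 'v \<Rightarrow> 'v list \<Rightarrow> 'v set set" where
  "fan_edges u w rs = insert {u, w} ((\<lambda>r. {u, r}) ` set rs \<union> (\<lambda>r. {w, r}) ` set rs \<union> path_edges rs)"

lemma simple_graph_fan:
  assumes "distinct (u # w # rs)"
  shows "simple_graph (set (u # w # rs)) (fan_edges u w rs)"
  unfolding simple_graph_def
proof (intro conjI ballI)
  fix e assume "e \<in> fan_edges u w rs"
  then consider "e = {u, w}" | r where "r \<in> set rs" "e = {u, r}" | r where "r \<in> set rs" "e = {w, r}"
    | i where "Suc i < length rs" "e = {rs ! i, rs ! Suc i}"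
    unfolding fan_edges_def path_edges_def by auto
  then show "\<exists>a b. a \<in> set (u # w # rs) \<and> b \<in> set (u # w # rs) \<and> a \<noteq> b \<and> e = {a, b}"
  proof cases
    case 1
    then show ?thesis using assms by (intro exI[of _ u] exI[of _ w]) simp
  next
    case (2 r)
    then show ?thesis using assms by (intro exI[of _ u] exI[of _ r]) auto
  next
    case (3 r)
    then show ?thesis using assms by (intro exI[of _ w] exI[of _ r]) auto
  next
    case (4 i)
    have "rs ! i \<noteq> rs ! Suc i" using assms 4(1) by (simp add: nth_eq_iff_index_eq)
    then show ?thesis using 4 by (intro exI[of _ "rs ! i"] exI[of _ "rs ! Suc i"]) simp
  qed
qed simp

lemma point_drawing_fat_planar:
  assumes "point_drawing V E p M"
  shows "fat_planar V E"
proof -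
  note D = point_drawingD[OF assms]
  have "region_drawing V E (\<lambda>v. {p v}) M"
    unfolding region_drawing_def
  proof (intro conjI ballI impI)
    fix u v assume "u \<in> V" "v \<in> V" "u \<noteq> v"
    then show "{p u} \<inter> {p v} = {}" using inj_onD[OF D(1), of u v] by auto
  next
    fix e assume e: "e \<in> E"
    show "\<exists>u v. u \<in> V \<and> v \<in> V \<and> u \<noteq> v \<and> e = {u, v}" by (rule D(2)[OF e])
    show "path_connected (M e)" by (rule D(3)[OF e])
    fix v assume v: "v \<in> e"
    have "p v \<in> M e" using D(4)[OF e] v by auto
    then show "\<exists>z. M e \<inter> {p v} = {z}" by auto
  next
    fix e v assume e: "e \<in> E" and v: "v \<in> V - e"
    have "p v \<notin> p ` e" using inj_onD[OF D(1)] D(2)[OF e] v by blast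
    then show "M e \<inter> {p v} = {}" using D(5)[OF e] v by auto
  next
    fix e f assume "e \<in> E" "f \<in> E" "e \<noteq> f"
    from D(6)[OF this] show "M e \<inter> M f \<subseteq> \<Union> ((\<lambda>v. {p v}) ` (e \<inter> f))" by auto
  qed auto
  then show ?thesis unfolding fat_planar_def by blast
qed

definition entry :: "'v set set \<Rightarrow> ('v \<Rightarrow> real) \<Rightarrow> 'v \<Rightarrow> 'v \<Rightarrow> real" where
  "entry E x a b = (if {a, b} \<in> E then x a * x b else 0)"

lemma entry_commute: "entry E x a b = entry E x b a"
  unfolding entry_def by (simp add: insert_commute)

lemma sum_entry:
  "finite S \<Longrightarrow> (\<Sum>b\<in>S. entry E x a b) = (\<Sum>b\<in>neigh E a \<inter> S. x a * x b)"
  unfolding entry_def neigh_def by (simp add: sum.If_cases Int_commute Int_def conj_commute)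

lemma quad_entry:
  assumes "simple_graph V E"
  shows "quad V E x = (\<Sum>a\<in>V. \<Sum>b\<in>V. entry E x a b)"
proof -
  have "finite V" using assms unfolding simple_graph_def by simp
  moreover have "neigh E a \<inter> V = neigh E a" for a using simple_graph_neigh(2)[OF assms] by blast
  ultimately show ?thesis unfolding quad_def by (simp add: sum_entry)
qed

lemma quad_split:
  fixes x :: "'v \<Rightarrow> real"
  assumes sg: "simple_graph V E" and V: "V = insert u (insert w R)" "u \<noteq> w" "u \<notin> R" "w \<notin> R"
  shows "quad V E x = 2 * entry E x u w + 2 * (\<Sum>r\<in>R. entry E x u r + entry E x w r) +
    (\<Sum>a\<in>R. \<Sum>b\<in>R. entry E x a b)"
proof -
  have fin: "finite R" using sg V unfolding simple_graph_def by simp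
  have loop: "entry E x a a = 0" for a
    using simple_graph_neigh(3)[OF sg, of a a] unfolding entry_def neigh_def by auto
  have s: "sum f V = f u + f w + sum f R" for f :: "'v \<Rightarrow> real"
    using V fin by simp
  have "(\<Sum>a\<in>V. \<Sum>b\<in>V. entry E x a b) = 2 * entry E x u w + (\<Sum>r\<in>R. entry E x u r) + (\<Sum>r\<in>R. entry E x w r)
     + (\<Sum>r\<in>R. entry E x r u + entry E x r w + (\<Sum>b\<in>R. entry E x r b))"
    unfolding s by (simp add: loop entry_commute[of E x w u])
  also have "(\<Sum>r\<in>R. entry E x r u + entry E x r w + (\<Sum>b\<in>R. entry E x r b)) =
    (\<Sum>r\<in>R. entry E x u r) + (\<Sum>r\<in>R. entry E x w r) + (\<Sum>a\<in>R. \<Sum>b\<in>R. entry E x a b)"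
    by (simp add: sum.distrib entry_commute[of E x _ u] entry_commute[of E x _ w])
  finally show ?thesis unfolding quad_entry[OF sg] by (simp add: sum.distrib)
qed

lemma quad_eq_imp_edges_eq:
  assumes sg: "simple_graph V F" and E: "E \<subseteq> F" and x: "\<And>v. v \<in> V \<Longrightarrow> 0 < x v"
    and eq: "quad V E x = quad V F x"
  shows "E = F"
proof (rule ccontr)
  assume "E \<noteq> F"
  then obtain e where e: "e \<in> F" "e \<notin> E" using E by blast
  then obtain a b where ab: "a \<in> V" "b \<in> V" "e = {a, b}" using sg unfolding simple_graph_def by blast
  have NF: "neigh E v \<subseteq> neigh F v" for v using E unfolding neigh_def by auto
  have pos: "0 < x v * x y" if "y \<in> neigh F v" for v y
    using simple_graph_neigh[OF sg that] x by simp
  have fin: "finite V" using sg unfolding simple_graph_def by simp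
  have "quad V E x < quad V F x"
    unfolding quad_def
  proof (rule sum_strict_mono_ex1[OF fin])
    show "\<forall>v\<in>V. (\<Sum>b\<in>neigh E v. x v * x b) \<le> (\<Sum>b\<in>neigh F v. x v * x b)"
      using pos less_imp_le by (intro ballI sum_mono2 simple_graph_finite_neigh[OF sg] NF) blast
    have "b \<in> neigh F a - neigh E a" using e ab unfolding neigh_def by simp
    then have "(\<Sum>b\<in>neigh E a. x a * x b) < (\<Sum>b\<in>neigh F a. x a * x b)"
      using pos less_imp_le by (intro sum_strict_mono2[of _ _ b] simple_graph_finite_neigh[OF sg] NF) blast+
    then show "\<exists>v\<in>V. (\<Sum>b\<in>neigh E v. x v * x b) < (\<Sum>b\<in>neigh F v. x v * x b)" using ab by blast
  qed
  then show False using eq by simp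
qed

text \<open>A vertex outside \<open>R0\<close> loses at least \<open>x w\<close> times its entry by missing a hub, while its edges within
  \<open>R\<close> contribute, by degeneracy, only a small multiple of it; closing up a cycle costs the edge \<open>{u, w}\<close>.\<close>

lemma planar_quad_le_fan:
  fixes x :: "'v \<Rightarrow> real"
  assumes pd: "point_drawing V E p M" and fin: "finite V"
    and uw: "u \<in> V" "w \<in> V" "u \<noteq> w" "x u = 1" "19 / 20 \<le> x w" "x w \<le> 1"
    and x0: "\<And>v. v \<in> V \<Longrightarrow> 0 \<le> x v" and small: "\<And>v. v \<in> V - {u, w} \<Longrightarrow> x v \<le> 11 / 100"
  obtains rs where "distinct (u # w # rs)" "V = set (u # w # rs)"
    "quad V E x \<le> quad V (fan_edges u w rs) x"
    "(\<And>v. v \<in> V \<Longrightarrow> 0 < x v) \<Longrightarrow> quad V E x = quad V (fan_edges u w rs) x \<Longrightarrow> E = fan_edges u w rs"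
proof -
  note fp = point_drawing_fat_planar[OF pd]
  note sg = fat_planar_simple_graph[OF fp fin]
  define R where "R = V - {u, w}"
  define R0 where "R0 = R \<inter> neigh E u \<inter> neigh E w"
  define R1 where "R1 = R - R0"
  define dl :: real where "dl = 11 / 100"
  have finR: "finite R" "finite R0" "finite R1" using fin unfolding R_def R0_def R1_def by auto
  have RV: "R \<subseteq> V" "R0 \<subseteq> V" "R1 \<subseteq> V" unfolding R_def R0_def R1_def by auto
  have R01: "R = R0 \<union> R1" "R0 \<inter> R1 = {}" unfolding R0_def R1_def by auto
  have xR: "0 \<le> x v \<and> x v \<le> dl" if "v \<in> R" for v
    using x0 small that unfolding R_def dl_def by auto
  have deg: "card (neigh E v \<inter> R0) \<le> 2" if "v \<in> R" for v
    by (rule fat_planar_common_neigh[OF fp fin, of v u w]) (use that uw in \<open>auto simp: R_def R0_def\<close>)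
  have "\<exists>c. distinct c \<and> set c = R0 \<and> ((\<forall>a\<in>R0. \<forall>b\<in>R0. {a, b} \<in> E \<longrightarrow> {a, b} \<in> path_edges c) \<or>
      {u, w} \<notin> E \<and> c \<noteq> [] \<and> (\<forall>a\<in>R0. \<forall>b\<in>R0. {a, b} \<in> E \<longrightarrow> {a, b} \<in> insert {last c, hd c} (path_edges c)))"
  proof -
    have degR0: "\<forall>v\<in>R0. card (neigh E v \<inter> R0) \<le> 2" using deg R01(1) by blast
    from linear_forest_or_cycle[OF sg RV(2) degR0] show ?thesis
    proof (elim disjE exE conjE)
      fix c assume "distinct c" "set c = R0" "\<forall>a\<in>R0. \<forall>b\<in>R0. {a, b} \<in> E \<longrightarrow> {a, b} \<in> path_edges c"
      then show ?thesis by (intro exI[of _ c]) simp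
    next
      fix c assume c: "distinct c" "set c \<subseteq> R0" "3 \<le> length c" "path_edges c \<subseteq> E" "{last c, hd c} \<in> E"
        "\<forall>a\<in>set c. \<forall>b\<in>R0. {a, b} \<in> E \<longrightarrow> {a, b} \<in> insert {last c, hd c} (path_edges c)"
      have adj: "{u, a} \<in> E \<and> {w, a} \<in> E" if "a \<in> R0" for a
        using that unfolding R0_def neigh_def by simp
      have "u \<notin> set c" "w \<notin> set c" using c(2) unfolding R0_def R_def by auto
      \<comment> \<open>A connection of \<open>u\<close> and \<open>w\<close> off the cycle would
        give a subdivided \<open>K\<^sub>5\<close>. So the hubs are not adjacent, and all their
        common neighbours lie on the cycle.\<close>
      then have nolink: "\<not> ({u, w} \<in> E \<or> (\<exists>r. r \<notin> set c \<and> {u, r} \<in> E \<and> {w, r} \<in> E))"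
        using two_apices_over_cycle[OF pd c(1,3,4,5) uw(3)] adj c(2) by blast
      then have "set c = R0" using adj c(2) by blast
      then show ?thesis using c nolink by (intro exI[of _ c]) auto
    qed
  qed
  then obtain c where c: "distinct c" "set c = R0" and
    cc: "(\<forall>a\<in>R0. \<forall>b\<in>R0. {a, b} \<in> E \<longrightarrow> {a, b} \<in> path_edges c) \<or>
      {u, w} \<notin> E \<and> c \<noteq> [] \<and> (\<forall>a\<in>R0. \<forall>b\<in>R0. {a, b} \<in> E \<longrightarrow> {a, b} \<in> insert {last c, hd c} (path_edges c))"
    by auto
  \<comment> \<open>Path edges of the fan that meet \<open>R1\<close> contribute nonnegatively, so
    any order of \<open>R1\<close> will do.\<close>
  obtain d where d: "distinct d" "set d = R1" using finite_distinct_list[OF finR(3)] by auto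
  define rs where "rs = c @ d"
  define F where "F = fan_edges u w rs"
  have rs: "distinct rs" "set rs = R" unfolding rs_def using c d R01 by auto
  have dist: "distinct (u # w # rs)" using rs uw(3) unfolding R_def by simp
  have Vrs: "V = set (u # w # rs)" using rs uw(1,2) unfolding R_def by auto
  have V: "V = insert u (insert w R)" "u \<notin> R" "w \<notin> R" using uw unfolding R_def by auto
  have sgF: "simple_graph V F" unfolding F_def Vrs by (rule simple_graph_fan[OF dist])
  have pF: "path_edges c \<subseteq> F" unfolding F_def fan_edges_def rs_def using path_edges_append by blast
  have entF: "entry F x u w = x w" "\<And>r. r \<in> R \<Longrightarrow> entry F x u r = x r" "\<And>r. r \<in> R \<Longrightarrow> entry F x w r = x w * x r"
    using uw rs unfolding entry_def F_def fan_edges_def by auto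
  have entF0: "0 \<le> entry F x a b" if "a \<in> R" "b \<in> R" for a b
    unfolding entry_def using xR[OF that(1)] xR[OF that(2)] by simp
  define s where "s = (\<Sum>r\<in>R1. x r)"
  have s0: "0 \<le> s" unfolding s_def using xR R01(1) by (intro sum_nonneg) auto
  define Wt where "Wt G S T = (\<Sum>a\<in>S. \<Sum>b\<in>T. entry G x a b)" for G S T
  have b1: "Wt E R0 R0 \<le> Wt F R0 R0 + (if {u, w} \<in> E then 0 else 2 * dl\<^sup>2)"
    using cc
  proof
    assume i: "\<forall>a\<in>R0. \<forall>b\<in>R0. {a, b} \<in> E \<longrightarrow> {a, b} \<in> path_edges c"
    have "Wt E R0 R0 \<le> Wt F R0 R0"
      unfolding Wt_def
    proof (intro sum_mono)
      fix a b assume ab: "a \<in> R0" "b \<in> R0"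
      then have "{a, b} \<in> E \<Longrightarrow> {a, b} \<in> F" using i pF by blast
      moreover have "0 \<le> x a * x b" using xR ab R01(1) by simp
      ultimately show "entry E x a b \<le> entry F x a b" unfolding entry_def by simp
    qed
    then show ?thesis by (simp add: add_increasing2)
  next
    assume ii: "{u, w} \<notin> E \<and> c \<noteq> [] \<and> (\<forall>a\<in>R0. \<forall>b\<in>R0. {a, b} \<in> E \<longrightarrow> {a, b} \<in> insert {last c, hd c} (path_edges c))"
    define D where "D = dl\<^sup>2"
    have D0: "0 \<le> D" unfolding D_def by simp
    define h k where "h = hd c" and "k = last c"
    have hk: "h \<in> R0" "k \<in> R0" using ii c(2) unfolding h_def k_def by auto
    \<comment> \<open>The correction covers both orders of the closing edge; nested conditionals let
      the double sum collapse.\<close>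
    have "Wt E R0 R0 \<le> (\<Sum>a\<in>R0. \<Sum>b\<in>R0. entry F x a b + ((if b = k then if a = h then D else 0 else 0) +
        (if b = h then if a = k then D else 0 else 0)))"
      unfolding Wt_def
    proof (intro sum_mono)
      fix a b assume ab: "a \<in> R0" "b \<in> R0"
      have xa: "0 \<le> x a" "x a \<le> dl" "0 \<le> x b" "x b \<le> dl" using xR ab R01(1) by auto
      have "x a * x b \<le> D" unfolding D_def power2_eq_square using xa by (intro mult_mono) auto
      moreover have "{a, b} \<in> E \<Longrightarrow> {a, b} \<in> F \<or> a = h \<and> b = k \<or> a = k \<and> b = h"
        using ii ab pF unfolding h_def k_def by (fastforce simp: doubleton_eq_iff)
      moreover have "0 \<le> x a * x b" using xa by simp
      ultimately have le: "entry E x a b \<le> entry F x a b + (if a = h \<and> b = k \<or> a = k \<and> b = h then D else 0)"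
        using D0 unfolding entry_def by (cases "{a, b} \<in> E"; cases "{a, b} \<in> F") auto
      show "entry E x a b \<le> entry F x a b + ((if b = k then if a = h then D else 0 else 0) +
        (if b = h then if a = k then D else 0 else 0))"
        by (rule order_trans[OF le]) (use D0 in \<open>cases "h = k"; auto\<close>)
    qed
    also have "\<dots> = Wt F R0 R0 + 2 * D"
      unfolding Wt_def using hk finR(2) by (simp add: sum.distrib)
    finally show ?thesis using ii unfolding D_def by simp
  qed
  have b2: "Wt E R1 R0 \<le> 2 * dl * s"
  proof -
    have "Wt E R1 R0 \<le> (\<Sum>a\<in>R1. 2 * dl * x a)"
      unfolding Wt_def
    proof (rule sum_mono)
      fix a assume a: "a \<in> R1"
      then have aR: "a \<in> R" using R01(1) by auto
      have "(\<Sum>b\<in>R0. entry E x a b) = (\<Sum>b\<in>neigh E a \<inter> R0. x a * x b)" by (rule sum_entry[OF finR(2)])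
      also have "\<dots> \<le> (\<Sum>b\<in>neigh E a \<inter> R0. x a * dl)"
        using xR aR R01(1) by (intro sum_mono mult_left_mono) auto
      also have "\<dots> = card (neigh E a \<inter> R0) * (x a * dl)" by simp
      also have "\<dots> \<le> 2 * (x a * dl)"
        using deg[OF aR] xR[OF aR] by (intro mult_right_mono) (auto simp: dl_def)
      finally show "(\<Sum>b\<in>R0. entry E x a b) \<le> 2 * dl * x a" by (simp add: mult.commute mult.left_commute)
    qed
    then show ?thesis unfolding s_def by (simp add: sum_distrib_left)
  qed
  have b3: "Wt E R1 R1 \<le> 8 * dl * s"
  proof -
    \<comment> \<open>A product of two entries is at most \<open>dl\<close> times the smaller one,
      and such minima are what \<open>min_weight_sum\<close> controls.\<close>
    have "Wt E R1 R1 \<le> (\<Sum>a\<in>R1. \<Sum>b\<in>neigh E a \<inter> R1. dl * min (x a) (x b))"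
      unfolding Wt_def sum_entry[OF finR(3)]
    proof (intro sum_mono)
      fix a b assume "a \<in> R1" "b \<in> neigh E a \<inter> R1"
      then have "0 \<le> x a" "x a \<le> dl" "0 \<le> x b" "x b \<le> dl" using xR R01(1) by auto
      then have "x a * x b \<le> dl * x b" "x b * x a \<le> dl * x a"
        by (auto intro: mult_right_mono)
      then show "x a * x b \<le> dl * min (x a) (x b)" by (simp add: min_def mult.commute)
    qed
    also have "\<dots> = dl * (\<Sum>a\<in>R1. \<Sum>b\<in>neigh E a \<inter> R1. min (x a) (x b))"
      by (simp add: sum_distrib_left)
    also have "\<dots> \<le> dl * (8 * s)"
      unfolding s_def using min_weight_sum[OF fp fin RV(3), of x] xR R01(1)
      by (intro mult_left_mono) (auto simp: dl_def)
    finally show ?thesis by simp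
  qed
  have Wsym: "Wt G S T = Wt G T S" for G S T
    unfolding Wt_def by (subst sum.swap) (simp add: entry_commute)
  have Wsplit: "Wt G R R = Wt G R0 R0 + 2 * Wt G R1 R0 + Wt G R1 R1" for G
  proof -
    have "Wt G R R = Wt G R0 R0 + Wt G R0 R1 + (Wt G R1 R0 + Wt G R1 R1)"
      unfolding Wt_def R01(1) using finR R01(2) by (simp add: sum.union_disjoint sum.distrib)
    then show ?thesis using Wsym[of G R0 R1] by simp
  qed
  have b4: "Wt F R0 R0 \<le> Wt F R R"
  proof -
    have "0 \<le> Wt F R1 R0" "0 \<le> Wt F R1 R1"
      unfolding Wt_def using R01(1) by (auto intro!: sum_nonneg entF0)
    then show ?thesis unfolding Wsplit by simp
  qed
  have b5: "(\<Sum>r\<in>R. entry E x u r + entry E x w r) \<le> (\<Sum>r\<in>R. entry F x u r + entry F x w r) - x w * s"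
  proof -
    have "(\<Sum>r\<in>R. entry E x u r + entry E x w r) \<le> (\<Sum>r\<in>R. entry F x u r + entry F x w r - (if r \<in> R1 then x w * x r else 0))"
    proof (rule sum_mono)
      fix r assume r: "r \<in> R"
      have p: "0 \<le> x r" "x w * x r \<le> x r" "0 \<le> x w * x r"
        using xR[OF r] uw by (auto simp: mult_left_le_one_le)
      have "{u, r} \<notin> E \<or> {w, r} \<notin> E" if "r \<in> R1" using that r unfolding R1_def R0_def neigh_def by auto
      then show "entry E x u r + entry E x w r \<le> entry F x u r + entry F x w r - (if r \<in> R1 then x w * x r else 0)"
        using p uw(4) unfolding entF(2,3)[OF r] unfolding entry_def
        by (cases "r \<in> R1"; cases "{u, r} \<in> E"; cases "{w, r} \<in> E"; simp)
    qed
    also have "\<dots> = (\<Sum>r\<in>R. entry F x u r + entry F x w r) - (\<Sum>r\<in>R. if r \<in> R1 then x w * x r else 0)"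
      by (simp add: sum_subtractf)
    also have "(\<Sum>r\<in>R. if r \<in> R1 then x w * x r else 0) = x w * s"
    proof -
      have "R \<inter> R1 = R1" using R01(1) by auto
      then show ?thesis unfolding s_def using finR(1) by (simp add: sum.If_cases sum_distrib_left)
    qed
    finally show ?thesis .
  qed
  have b6: "entry E x u w = (if {u, w} \<in> E then x w else 0)" unfolding entry_def using uw(4) by simp
  note qE = quad_split[OF sg V(1) uw(3) V(2,3), of x, folded Wt_def]
  note qF = quad_split[OF sgF V(1) uw(3) V(2,3), of x, folded Wt_def]
  have ws: "19 / 20 * s \<le> x w * s" using uw(5) s0 by (rule mult_right_mono)
  \<comment> \<open>With \<open>dl = 0.11\<close>, the missing hub edges cost at least
    \<open>2 * 0.95 * s\<close>, and the edges at \<open>R1\<close> gain at most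
    \<open>(2 * 2 + 8) * 0.11 * s\<close>; the difference is \<open>0.58 * s\<close>. If
    \<open>{u, w}\<close> is missing, this costs at least 1.9 against a gain of at most 0.0242 from
    a closing edge.\<close>
  have main: "quad V E x + 58 / 100 * s + (if {u, w} \<in> E then 0 else 1) \<le> quad V F x"
    using b1 b2 b3 b4 b5 ws uw(5) Wsplit[of E]
    unfolding qE qF b6 entF(1) dl_def by (simp add: power2_eq_square split: if_splits)
  show thesis
  proof (rule that[OF dist Vrs])
    show "quad V E x \<le> quad V (fan_edges u w rs) x"
      using main s0 unfolding F_def by (simp split: if_splits)
    assume pos: "\<And>v. v \<in> V \<Longrightarrow> 0 < x v" and "quad V E x = quad V (fan_edges u w rs) x"
    then have eq: "quad V E x = quad V F x" unfolding F_def by simp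
    \<comment> \<open>Equality leaves no slack: the hubs are adjacent, and as all entries are
      positive, \<open>s = 0\<close> empties \<open>R1\<close>.\<close>
    have uwE: "{u, w} \<in> E" using main s0 eq by (simp split: if_splits)
    have "s = 0" using main s0 eq uwE by simp
    have "R1 = {}"
    proof (rule ccontr)
      assume "R1 \<noteq> {}"
      then have "0 < s" unfolding s_def using pos RV(3) finR(3) by (intro sum_pos) auto
      then show False using \<open>s = 0\<close> by simp
    qed
    then have RR0: "R = R0" using R01(1) by simp
    have "E \<subseteq> F"
    proof
      fix e assume e: "e \<in> E"
      then obtain a b where ab: "a \<in> V" "b \<in> V" "e = {a, b}" "a \<noteq> b" using sg unfolding simple_graph_def by blast
      show "e \<in> F"
      proof (cases "a \<in> R \<and> b \<in> R")
        case True
        then show ?thesis using cc uwE e ab(3) pF RR0 by auto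
      next
        case False
        then have "a \<in> {u, w} \<or> b \<in> {u, w}" using ab V(1) by auto
        then show ?thesis using ab V(1) unfolding F_def fan_edges_def rs(2) by (auto simp: insert_commute)
      qed
    qed
    then show "E = fan_edges u w rs"
      using quad_eq_imp_edges_eq[OF sgF _ pos eq] unfolding F_def by simp
  qed
qed

section \<open>Eigenvalues and Rayleigh quotients\<close>

lemma quad_split_vertex:
  assumes sg: "simple_graph V E" and v: "v \<in> V"
  shows "quad V E x = 2 * x v * (\<Sum>r\<in>neigh E v. x r) + (\<Sum>a\<in>V - {v}. \<Sum>b\<in>V - {v}. entry E x a b)"
proof -
  let ?R = "V - {v}"
  note fin = simple_graph_finite_vertices[OF sg]
  have loop: "entry E x v v = 0"
    using simple_graph_neigh(3)[OF sg, of v v] unfolding entry_def neigh_def by auto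
  have "(\<Sum>a\<in>V. \<Sum>b\<in>V. entry E x a b) =
      (\<Sum>b\<in>?R. entry E x v b) + ((\<Sum>a\<in>?R. entry E x a v) + (\<Sum>a\<in>?R. \<Sum>b\<in>?R. entry E x a b))"
    by (simp add: sum.remove[OF fin v] loop sum.distrib)
  also have "(\<Sum>a\<in>?R. entry E x a v) = (\<Sum>b\<in>?R. entry E x v b)"
    by (intro sum.cong refl entry_commute)
  also have "(\<Sum>b\<in>?R. entry E x v b) = x v * (\<Sum>r\<in>neigh E v. x r)"
  proof -
    have "neigh E v \<inter> ?R = neigh E v" using simple_graph_neigh[OF sg] by blast
    then show ?thesis using fin by (simp add: sum_entry sum_distrib_left)
  qed
  finally show ?thesis unfolding quad_entry[OF sg] by simp
qed

text \<open>Changing the single coordinate \<open>v\<close> by \<open>t\<close> compares the form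
  with \<open>m\<close> times the squared norm to first order:
  \<open>2 * t * g \<le> m * t\<^sup>2\<close> for every \<open>t\<close>, of either sign, forces
  the defect \<open>g\<close> to vanish.\<close>

lemma rayleigh_maximum_eigenfunction:
  fixes x :: "'v \<Rightarrow> real"
  assumes sg: "simple_graph V E" and max: "\<And>y. quad V E y \<le> m * (\<Sum>v\<in>V. (y v)\<^sup>2)"
    and eq: "quad V E x = m * (\<Sum>v\<in>V. (x v)\<^sup>2)" and v: "v \<in> V"
  shows "(\<Sum>r\<in>neigh E v. x r) = m * x v"
proof -
  note fin = simple_graph_finite_vertices[OF sg]
  define g where "g = (\<Sum>r\<in>neigh E v. x r) - m * x v"
  have bound: "2 * t * g \<le> m * t\<^sup>2" for t
  proof -
    define y where "y = x(v := x v + t)"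
    have "(\<Sum>r\<in>neigh E v. y r) = (\<Sum>r\<in>neigh E v. x r)"
      unfolding y_def using simple_graph_neigh(3)[OF sg] by (intro sum.cong) auto
    moreover have "(\<Sum>a\<in>V - {v}. \<Sum>b\<in>V - {v}. entry E y a b) = (\<Sum>a\<in>V - {v}. \<Sum>b\<in>V - {v}. entry E x a b)"
      unfolding y_def entry_def by (intro sum.cong) auto
    ultimately have "quad V E y = quad V E x + 2 * t * (\<Sum>r\<in>neigh E v. x r)"
      unfolding quad_split_vertex[OF sg v] by (simp add: y_def algebra_simps)
    moreover have "(\<Sum>v\<in>V. (y v)\<^sup>2) = (\<Sum>v\<in>V. (x v)\<^sup>2) + 2 * t * x v + t\<^sup>2"
    proof -
      have "(\<Sum>u\<in>V - {v}. (y u)\<^sup>2) = (\<Sum>u\<in>V - {v}. (x u)\<^sup>2)" unfolding y_def by (intro sum.cong) auto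
      then show ?thesis unfolding sum.remove[OF fin v] by (simp add: y_def power2_sum)
    qed
    ultimately show ?thesis using max[of y] eq unfolding g_def by (simp add: algebra_simps)
  qed
  have "g = 0"
  proof (rule ccontr)
    assume "g \<noteq> 0"
    \<comment> \<open>With the sign of \<open>g\<close> and this size, \<open>t\<close> makes the
      linear term outweigh the quadratic one.\<close>
    define t where "t = g / (\<bar>m\<bar> + 1)"
    have "m * t\<^sup>2 \<le> \<bar>m\<bar> * t\<^sup>2" by (intro mult_right_mono) auto
    also have "\<dots> \<le> (\<bar>m\<bar> + 1) * t\<^sup>2" by (intro mult_right_mono) auto
    also have "\<dots> = t * g" unfolding t_def by (simp add: power2_eq_square)
    finally have "t * g \<le> 0" using bound[of t] by simp
    moreover have "0 < t * g" unfolding t_def using \<open>g \<noteq> 0\<close>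
      by (simp add: power2_eq_square[symmetric] add_nonneg_pos)
    ultimately show False by simp
  qed
  then show ?thesis unfolding g_def by simp
qed

lemma rayleigh_eigenfunction:
  assumes eig: "\<And>v. v \<in> V \<Longrightarrow> (\<Sum>r\<in>neigh E v. x r) = k * x v"
  shows "quad V E x = k * (\<Sum>v\<in>V. (x v)\<^sup>2)"
  unfolding quad_def sum_distrib_left[symmetric] using eig
  by (simp add: sum_distrib_left power2_eq_square mult.left_commute)

text \<open>Passing to absolute values does not decrease the form, so it is enough to maximise over
  nonnegative unit vectors, which form a compact set.\<close>

lemma rayleigh_maximizer_exists:
  assumes sg: "simple_graph V E" and ne: "V \<noteq> {}"
  obtains m x where "\<And>v. v \<in> V \<Longrightarrow> 0 \<le> x v" "\<exists>v\<in>V. 0 < x v" "quad V E x = m * (\<Sum>v\<in>V. (x v)\<^sup>2)"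
    "\<And>y. quad V E y \<le> m * (\<Sum>v\<in>V. (y v)\<^sup>2)"
proof -
  note fin = simple_graph_finite_vertices[OF sg]
  \<comment> \<open>Functions live on the whole type; coordinates outside \<open>V\<close> are
    pinned to 0 to obtain compactness in the product topology.\<close>
  define P where "P = PiE UNIV (\<lambda>v. if v \<in> V then {0..1::real} else {0})"
  define S where "S = P \<inter> {x. (\<Sum>v\<in>V. (x v)\<^sup>2) = 1}"
  have "compactin (product_topology (\<lambda>_. euclidean) UNIV) P"
    unfolding P_def compactin_PiE by (auto simp: compactin_euclidean_iff)
  then have cP: "compact P" by (simp add: euclidean_product_topology compactin_euclidean_iff)
  have cont: "continuous_on UNIV (\<lambda>x :: 'a \<Rightarrow> real. x v)" for v
    by (rule continuous_on_product_coordinates)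
  have "closed {x :: 'a \<Rightarrow> real. (\<Sum>v\<in>V. (x v)\<^sup>2) = 1}"
    by (intro closed_Collect_eq continuous_intros cont)
  then have cS: "compact S" unfolding S_def by (rule compact_Int_closed[OF cP])
  have inS: "(\<lambda>v. if v \<in> V then \<bar>y v\<bar> / sqrt (\<Sum>v\<in>V. (y v)\<^sup>2) else 0) \<in> S"
    if "(\<Sum>v\<in>V. (y v)\<^sup>2) \<noteq> 0" for y
  proof -
    let ?N = "\<Sum>v\<in>V. (y v)\<^sup>2"
    have N: "0 < ?N" using that sum_nonneg[of V "\<lambda>v. (y v)\<^sup>2"] by simp
    have "\<bar>y v\<bar> / sqrt ?N \<le> 1" if "v \<in> V" for v
    proof -
      have "(y v)\<^sup>2 \<le> ?N" using fin that by (intro member_le_sum) auto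
      then have "\<bar>y v\<bar> \<le> sqrt ?N" using real_le_rsqrt[of "\<bar>y v\<bar>"] by simp
      then show ?thesis using N by simp
    qed
    moreover have "(\<Sum>v\<in>V. (\<bar>y v\<bar> / sqrt ?N)\<^sup>2) = 1"
      using N by (simp add: power_divide sum_divide_distrib[symmetric])
    ultimately show ?thesis unfolding S_def P_def using N by (simp add: PiE_def Pi_def)
  qed
  obtain r where r: "r \<in> V" using ne by auto
  have "(\<Sum>v\<in>V. (1::real)\<^sup>2) \<noteq> 0" using fin ne by simp
  from inS[OF this] have "S \<noteq> {}" by blast
  moreover have "continuous_on S (quad V E)"
    unfolding quad_def by (intro continuous_intros continuous_on_subset[OF cont]) auto
  ultimately obtain x where x: "x \<in> S" "\<And>y. y \<in> S \<Longrightarrow> quad V E y \<le> quad V E x"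
    using continuous_attains_sup[OF cS] by blast
  define m where "m = quad V E x"
  have x1: "(\<Sum>v\<in>V. (x v)\<^sup>2) = 1" using x(1) unfolding S_def by simp
  have x0: "0 \<le> x v" if "v \<in> V" for v
  proof -
    have "x v \<in> (if v \<in> V then {0..1} else {0})" using x(1) unfolding S_def P_def by blast
    then show ?thesis using that by simp
  qed
  have "\<exists>v\<in>V. 0 < x v"
  proof (rule ccontr)
    assume "\<not> ?thesis"
    then have "(\<Sum>v\<in>V. (x v)\<^sup>2) = 0" using x0 by (intro sum.neutral) force
    then show False using x1 by simp
  qed
  moreover have "quad V E y \<le> m * (\<Sum>v\<in>V. (y v)\<^sup>2)" for y
  proof (cases "(\<Sum>v\<in>V. (y v)\<^sup>2) = 0")
    case True
    then have "y v = 0" if "v \<in> V" for v using that fin by (simp add: sum_nonneg_eq_0_iff)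
    then have "quad V E y = 0" unfolding quad_def by simp
    then show ?thesis using True by simp
  next
    case False
    let ?N = "\<Sum>v\<in>V. (y v)\<^sup>2"
    define z where "z = (\<lambda>v. if v \<in> V then \<bar>y v\<bar> / sqrt ?N else 0)"
    have N: "0 < ?N" using False sum_nonneg[of V "\<lambda>v. (y v)\<^sup>2"] by simp
    have "quad V E y / ?N \<le> quad V E z"
      unfolding quad_def sum_divide_distrib
    proof (intro sum_mono)
      fix a b assume "a \<in> V" "b \<in> neigh E a"
      then have "z a * z b = \<bar>y a * y b\<bar> / (sqrt ?N * sqrt ?N)"
        using simple_graph_neigh(2)[OF sg] unfolding z_def by (auto simp: abs_mult)
      then show "y a * y b / ?N \<le> z a * z b" using N by (simp add: divide_right_mono)
    qed
    also have "\<dots> \<le> m" unfolding m_def z_def by (rule x(2)[OF inS[OF False]])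
    finally show ?thesis using N by (simp add: divide_le_eq)
  qed
  ultimately show thesis using that[of x m] x0 x1 unfolding m_def by simp
qed

section \<open>From adjacency matrices to functions on the vertices\<close>

definition edges_of :: "'a pair_pre_digraph \<Rightarrow> 'a set set" where
  "edges_of G = (\<lambda>(u, v). {u, v}) ` parcs G"

lemma pair_graph_sym:
  assumes "pair_graph G" "(u, v) \<in> parcs G"
  shows "(v, u) \<in> parcs G"
proof -
  interpret pair_graph G by fact
  have "sym (parcs G)" using pair_sym_arcs unfolding symmetric_def by simp
  then show ?thesis using assms(2) by (rule symD)
qed

lemma in_edges_of:
  "pair_graph G \<Longrightarrow> {u, v} \<in> edges_of G \<longleftrightarrow> (u, v) \<in> parcs G"
  unfolding edges_of_def using pair_graph_sym[of G] by (auto simp: doubleton_eq_iff image_iff)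

lemma simple_graph_edges_of:
  assumes "pair_graph G"
  shows "simple_graph (pverts G) (edges_of G)"
proof -
  interpret pair_graph G by fact
  show ?thesis unfolding simple_graph_def edges_of_def
    using pair_finite_verts in_arcsD1 in_arcsD2 pair_no_loops by fastforce
qed

lemma neigh_edges_of:
  "pair_graph G \<Longrightarrow> neigh (edges_of G) v = {w. (v, w) \<in> parcs G}"
  unfolding neigh_def by (simp add: in_edges_of)

lemma adjacency_mat_mult:
  assumes "distinct vs" "i < length vs"
  shows "vec_index (adjacency_mat vs G *\<^sub>v Matrix.vec (length vs) (\<lambda>i. x (vs ! i))) i =
    (\<Sum>w\<in>set vs. if (vs ! i, w) \<in> parcs G then x w else 0)"
proof -
  have "vec_index (adjacency_mat vs G *\<^sub>v Matrix.vec (length vs) (\<lambda>i. x (vs ! i))) i =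
      (\<Sum>j\<in>{0..<length vs}. (if (vs ! i, vs ! j) \<in> parcs G then 1 else 0) * x (vs ! j))"
    using assms(2) unfolding adjacency_mat_def by (simp add: scalar_prod_def)
  also have "\<dots> = (\<Sum>j\<in>{0..<length vs}. if (vs ! i, vs ! j) \<in> parcs G then x (vs ! j) else 0)"
    by (intro sum.cong) auto
  also have "\<dots> = (\<Sum>w\<in>set vs. if (vs ! i, w) \<in> parcs G then x w else 0)"
    by (rule sum.reindex_bij_betw[OF bij_betw_nth]) (use assms(1) in \<open>auto simp: atLeast0LessThan\<close>)
  finally show ?thesis .
qed

text \<open>The right-hand side mentions \<open>vs\<close> only through its set, which makes the
  spectrum independent of the enumeration.\<close>

lemma eigenvalue_adjacency_mat_iff:
  assumes "distinct vs"
  shows "eigenvalue (adjacency_mat vs G) k \<longleftrightarrow> (\<exists>x. (\<exists>v\<in>set vs. x v \<noteq> 0) \<and>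
    (\<forall>v\<in>set vs. (\<Sum>w\<in>set vs. if (v, w) \<in> parcs G then x w else 0) = k * x v))" (is "?L \<longleftrightarrow> ?R")
proof
  have dim: "dim_row (adjacency_mat vs G) = length vs" unfolding adjacency_mat_def by simp
  {
    assume ?L
    then obtain z where z: "z \<in> carrier_vec (length vs)" "z \<noteq> 0\<^sub>v (length vs)"
      "adjacency_mat vs G *\<^sub>v z = k \<cdot>\<^sub>v z"
      unfolding eigenvalue_def eigenvector_def dim by auto
    \<comment> \<open>Inverting the enumeration turns coordinates into values at vertices.\<close>
    define x where "x v = vec_index z (the_inv_into {..<length vs} ((!) vs) v)" for v
    have x: "x (vs ! i) = vec_index z i" if "i < length vs" for i
      unfolding x_def using that assms by (subst the_inv_into_f_f) (auto simp: inj_on_nth)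
    have zx: "z = Matrix.vec (length vs) (\<lambda>i. x (vs ! i))"
      using z(1) x by (intro eq_vecI) auto
    have "\<exists>i<length vs. vec_index z i \<noteq> 0"
    proof (rule ccontr)
      assume "\<not> ?thesis"
      then have "z = 0\<^sub>v (length vs)" using z(1) by (intro eq_vecI) auto
      then show False using z(2) by simp
    qed
    then have "\<exists>v\<in>set vs. x v \<noteq> 0" using x by (metis nth_mem)
    moreover have "\<forall>v\<in>set vs. (\<Sum>w\<in>set vs. if (v, w) \<in> parcs G then x w else 0) = k * x v"
    proof
      fix v assume "v \<in> set vs"
      then obtain i where i: "i < length vs" "v = vs ! i" by (auto simp: in_set_conv_nth)
      have "vec_index (adjacency_mat vs G *\<^sub>v z) i = k * vec_index z i" using z(1,3) i(1) by simp
      then show "(\<Sum>w\<in>set vs. if (v, w) \<in> parcs G then x w else 0) = k * x v"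
        using adjacency_mat_mult[OF assms i(1), of G x] x[OF i(1)] i(2) zx by simp
    qed
    ultimately show ?R by blast
  next
    assume ?R
    then obtain x v where x: "v \<in> set vs" "x v \<noteq> 0"
      "\<And>v. v \<in> set vs \<Longrightarrow> (\<Sum>w\<in>set vs. if (v, w) \<in> parcs G then x w else 0) = k * x v" by blast
    define z where "z = Matrix.vec (length vs) (\<lambda>i. x (vs ! i))"
    obtain i where i: "i < length vs" "v = vs ! i" using x(1) by (auto simp: in_set_conv_nth)
    have "vec_index z i \<noteq> vec_index (0\<^sub>v (length vs)) i" using i x(2) unfolding z_def by simp
    then have "z \<noteq> 0\<^sub>v (length vs)" by auto
    moreover have "adjacency_mat vs G *\<^sub>v z = k \<cdot>\<^sub>v z"
    proof (rule eq_vecI)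
      fix j assume "j < dim_vec (k \<cdot>\<^sub>v z)"
      then have j: "j < length vs" unfolding z_def by simp
      show "vec_index (adjacency_mat vs G *\<^sub>v z) j = vec_index (k \<cdot>\<^sub>v z) j"
        unfolding z_def adjacency_mat_mult[OF assms j] using x(3)[of "vs ! j"] j by simp
    qed (simp add: z_def adjacency_mat_def)
    ultimately show ?L
      unfolding eigenvalue_def eigenvector_def dim by (intro exI[of _ z]) (simp add: z_def)
  }
qed

lemma graph_eigenvalues_eq:
  assumes "pair_graph G"
  shows "graph_eigenvalues G = {k. \<exists>x. (\<exists>v\<in>pverts G. x v \<noteq> 0) \<and>
    (\<forall>v\<in>pverts G. (\<Sum>w\<in>neigh (edges_of G) v. x w) = k * x v)}"
proof -
  have fin: "finite (pverts G)" using simple_graph_finite_vertices[OF simple_graph_edges_of[OF assms]] .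
  have N: "(\<Sum>w\<in>pverts G. if (v, w) \<in> parcs G then x w else 0) = (\<Sum>w\<in>neigh (edges_of G) v. x w)"
    for v and x :: "'a \<Rightarrow> real"
  proof -
    have "neigh (edges_of G) v = pverts G \<inter> {w. (v, w) \<in> parcs G}"
      using simple_graph_neigh(2)[OF simple_graph_edges_of[OF assms]] neigh_edges_of[OF assms, of v] by blast
    then show ?thesis using fin by (simp add: sum.If_cases)
  qed
  obtain vs where vs: "distinct vs" "set vs = pverts G" using finite_distinct_list[OF fin] by auto
  have iff: "eigenvalue (adjacency_mat us G) k \<longleftrightarrow> (\<exists>x. (\<exists>v\<in>pverts G. x v \<noteq> 0) \<and>
    (\<forall>v\<in>pverts G. (\<Sum>w\<in>neigh (edges_of G) v. x w) = k * x v))"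
    if "distinct us" "set us = pverts G" for us k
    using eigenvalue_adjacency_mat_iff[OF that(1), of G k] unfolding that(2) N .
  show ?thesis
  proof (rule Set.set_eqI)
    fix k
    have "k \<in> graph_eigenvalues G \<longleftrightarrow> eigenvalue (adjacency_mat vs G) k"
    proof
      assume "k \<in> graph_eigenvalues G"
      then obtain us where us: "distinct us" "set us = pverts G" "eigenvalue (adjacency_mat us G) k"
        unfolding graph_eigenvalues_def by auto
      then show "eigenvalue (adjacency_mat vs G) k" using iff[OF us(1,2)] iff[OF vs] by simp
    next
      assume "eigenvalue (adjacency_mat vs G) k"
      then show "k \<in> graph_eigenvalues G" unfolding graph_eigenvalues_def using vs by auto
    qed
    then show "k \<in> graph_eigenvalues G \<longleftrightarrow> k \<in> {k. \<exists>x. (\<exists>v\<in>pverts G. x v \<noteq> 0) \<and>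
      (\<forall>v\<in>pverts G. (\<Sum>w\<in>neigh (edges_of G) v. x w) = k * x v)}"
      unfolding mem_Collect_eq using iff[OF vs] by simp
  qed
qed

lemma finite_graph_eigenvalues:
  assumes "pair_graph G"
  shows "finite (graph_eigenvalues G)"
proof -
  have fin: "finite (pverts G)" using simple_graph_finite_vertices[OF simple_graph_edges_of[OF assms]] .
  obtain vs where vs: "distinct vs" "set vs = pverts G" using finite_distinct_list[OF fin] by auto
  let ?A = "adjacency_mat vs G"
  have A: "?A \<in> carrier_mat (length vs) (length vs)" unfolding adjacency_mat_def by simp
  have "graph_eigenvalues G \<subseteq> {k. eigenvalue ?A k}"
  proof
    fix k assume "k \<in> graph_eigenvalues G"
    then obtain us where us: "distinct us" "set us = pverts G" "eigenvalue (adjacency_mat us G) k"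
      unfolding graph_eigenvalues_def by auto
    then show "k \<in> {k. eigenvalue ?A k}"
      using eigenvalue_adjacency_mat_iff[OF us(1), of G k] eigenvalue_adjacency_mat_iff[OF vs(1), of G k] vs(2) by simp
  qed
  also have "\<dots> = {k. poly (char_poly ?A) k = 0}" using eigenvalue_root_char_poly[OF A] by simp
  finally show ?thesis
    using poly_roots_finite[of "char_poly ?A"] degree_monic_char_poly[OF A] finite_subset by fastforce
qed

text \<open>The maximum of the Rayleigh quotient is attained at an eigenfunction, and every
  eigenvalue is the Rayleigh quotient of its eigenfunctions; so this maximum is the largest
  eigenvalue.\<close>

lemma graph_spectral_radius_rayleigh:
  assumes G: "pair_graph G" and ne: "pverts G \<noteq> {}"
  shows "quad (pverts G) (edges_of G) y \<le> graph_spectral_radius G * (\<Sum>v\<in>pverts G. (y v)\<^sup>2)"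
    and "\<exists>x. (\<forall>v\<in>pverts G. 0 \<le> x v) \<and> (\<exists>v\<in>pverts G. 0 < x v) \<and>
      (\<forall>v\<in>pverts G. (\<Sum>w\<in>neigh (edges_of G) v. x w) = graph_spectral_radius G * x v)"
proof -
  note sg = simple_graph_edges_of[OF G]
  obtain m x where x: "\<And>v. v \<in> pverts G \<Longrightarrow> 0 \<le> x v" "\<exists>v\<in>pverts G. 0 < x v"
    "quad (pverts G) (edges_of G) x = m * (\<Sum>v\<in>pverts G. (x v)\<^sup>2)"
    and m: "\<And>y. quad (pverts G) (edges_of G) y \<le> m * (\<Sum>v\<in>pverts G. (y v)\<^sup>2)"
    using rayleigh_maximizer_exists[OF sg ne] by metis
  note eig = rayleigh_maximum_eigenfunction[OF sg m x(3)]
  have "m = graph_spectral_radius G"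
    unfolding graph_spectral_radius_def
  proof (rule sym, rule Max_eqI[OF finite_graph_eigenvalues[OF G]])
    show "m \<in> graph_eigenvalues G"
      unfolding graph_eigenvalues_eq[OF G] using x(2) eig by (intro CollectI exI[of _ x]) force
    fix k assume "k \<in> graph_eigenvalues G"
    then obtain y v where y: "v \<in> pverts G" "y v \<noteq> 0"
      "\<And>v. v \<in> pverts G \<Longrightarrow> (\<Sum>w\<in>neigh (edges_of G) v. y w) = k * y v"
      unfolding graph_eigenvalues_eq[OF G] by blast
    have "0 < (y v)\<^sup>2" using y(2) by simp
    also have "\<dots> \<le> (\<Sum>v\<in>pverts G. (y v)\<^sup>2)" using simple_graph_finite_vertices[OF sg] y(1) by (intro member_le_sum) auto
    finally have "0 < (\<Sum>v\<in>pverts G. (y v)\<^sup>2)" .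
    then show "k \<le> m" using m[of y] rayleigh_eigenfunction[of "pverts G", OF y(3)] by simp
  qed
  then show "quad (pverts G) (edges_of G) y \<le> graph_spectral_radius G * (\<Sum>v\<in>pverts G. (y v)\<^sup>2)"
    and "\<exists>x. (\<forall>v\<in>pverts G. 0 \<le> x v) \<and> (\<exists>v\<in>pverts G. 0 < x v) \<and>
      (\<forall>v\<in>pverts G. (\<Sum>w\<in>neigh (edges_of G) v. x w) = graph_spectral_radius G * x v)"
    using m x(1,2) eig by blast+
qed

section \<open>Isomorphism invariance\<close>

lemma neigh_image:
  assumes "inj_on f V" "simple_graph V E" "a \<in> V"
  shows "neigh ((`) f ` E) (f a) = f ` neigh E a"
proof (intro equalityI subsetI)
  fix y assume "y \<in> neigh ((`) f ` E) (f a)"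
  then obtain e where e: "e \<in> E" "{f a, y} = f ` e" unfolding neigh_def by auto
  obtain b c where bc: "b \<in> V" "c \<in> V" "e = {b, c}" using e(1) assms(2) unfolding simple_graph_def by blast
  then have "f a = f b \<and> y = f c \<or> f a = f c \<and> y = f b" using e(2) by (auto simp: doubleton_eq_iff)
  then have "a = b \<and> y = f c \<or> a = c \<and> y = f b" using inj_onD[OF assms(1)] assms(3) bc by metis
  then show "y \<in> f ` neigh E a" using e(1) bc(3) unfolding neigh_def by (auto simp: insert_commute)
next
  fix y assume "y \<in> f ` neigh E a"
  then obtain b where "{a, b} \<in> E" "y = f b" unfolding neigh_def by auto
  then have "f ` {a, b} \<in> (`) f ` E" "y = f b" by blast+
  then show "y \<in> neigh ((`) f ` E) (f a)" unfolding neigh_def by simp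
qed

lemma quad_image:
  assumes "inj_on f V" "simple_graph V E"
  shows "quad (f ` V) ((`) f ` E) y = quad V E (\<lambda>v. y (f v))"
proof -
  have "(\<Sum>b\<in>neigh ((`) f ` E) (f a). y (f a) * y b) = (\<Sum>b\<in>neigh E a. y (f a) * y (f b))" if "a \<in> V" for a
  proof -
    have "neigh E a \<subseteq> V" using simple_graph_neigh(2)[OF assms(2)] by blast
    then show ?thesis unfolding neigh_image[OF assms that]
      using assms(1) by (simp add: sum.reindex inj_on_subset)
  qed
  then show ?thesis unfolding quad_def by (simp add: sum.reindex[OF assms(1)])
qed

lemma quad_cong:
  assumes "simple_graph V E" "\<And>v. v \<in> V \<Longrightarrow> x v = y v"
  shows "quad V E x = quad V E y"
  unfolding quad_def using assms simple_graph_neigh(2)[OF assms(1)] by (intro sum.cong) auto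

text \<open>For each inequality, an eigenfunction of one graph is transported along \<open>f\<close>
  and serves as test function for the other.\<close>

lemma graph_spectral_radius_image:
  assumes G: "pair_graph G" and H: "pair_graph H" and ne: "pverts G \<noteq> {}"
    and f: "inj_on f (pverts G)" "pverts H = f ` pverts G" "edges_of H = (`) f ` edges_of G"
  shows "graph_spectral_radius G = graph_spectral_radius H"
proof (rule antisym)
  note sg = simple_graph_edges_of[OF G]
  have neH: "pverts H \<noteq> {}" using ne f(2) by simp
  have q: "quad (pverts H) (edges_of H) y = quad (pverts G) (edges_of G) (\<lambda>v. y (f v))" for y
    unfolding f(2,3) by (rule quad_image[OF f(1) sg])
  have s: "(\<Sum>v\<in>pverts H. (y v)\<^sup>2) = (\<Sum>v\<in>pverts G. (y (f v))\<^sup>2)" for y :: "'b \<Rightarrow> real"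
    unfolding f(2) by (simp add: sum.reindex[OF f(1)])
  have pos: "0 < (\<Sum>v\<in>A. (x v)\<^sup>2)" if fin: "finite A" and ex: "\<exists>v\<in>A. 0 < x v"
    for A and x :: "'c \<Rightarrow> real"
  proof -
    obtain v where "v \<in> A" "0 < x v" using ex by blast
    then show ?thesis using fin by (intro sum_pos2[of _ v]) auto
  qed
  show "graph_spectral_radius H \<le> graph_spectral_radius G"
  proof -
    obtain x where x: "\<exists>v\<in>pverts H. 0 < x v"
      "\<And>v. v \<in> pverts H \<Longrightarrow> (\<Sum>w\<in>neigh (edges_of H) v. x w) = graph_spectral_radius H * x v"
      using graph_spectral_radius_rayleigh(2)[OF H neH] by blast
    note sgH = simple_graph_edges_of[OF H]
    have "graph_spectral_radius H * (\<Sum>v\<in>pverts H. (x v)\<^sup>2) \<le> graph_spectral_radius G * (\<Sum>v\<in>pverts H. (x v)\<^sup>2)"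
      using rayleigh_eigenfunction[of "pverts H", OF x(2)] graph_spectral_radius_rayleigh(1)[OF G ne, of "\<lambda>v. x (f v)"]
      unfolding q s by simp
    then show ?thesis using pos[OF simple_graph_finite_vertices[OF sgH] x(1)] by simp
  qed
  show "graph_spectral_radius G \<le> graph_spectral_radius H"
  proof -
    obtain x where x: "\<exists>v\<in>pverts G. 0 < x v"
      "\<And>v. v \<in> pverts G \<Longrightarrow> (\<Sum>w\<in>neigh (edges_of G) v. x w) = graph_spectral_radius G * x v"
      using graph_spectral_radius_rayleigh(2)[OF G ne] by blast
    define y where "y v = x (the_inv_into (pverts G) f v)" for v
    have y: "y (f v) = x v" if "v \<in> pverts G" for v
      unfolding y_def using the_inv_into_f_f[OF f(1) that] by simp
    have "graph_spectral_radius G * (\<Sum>v\<in>pverts G. (x v)\<^sup>2) = quad (pverts G) (edges_of G) x"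
      using rayleigh_eigenfunction[of "pverts G", OF x(2)] by simp
    also have "\<dots> = quad (pverts H) (edges_of H) y" unfolding q by (rule quad_cong[OF sg]) (simp add: y)
    also have "\<dots> \<le> graph_spectral_radius H * (\<Sum>v\<in>pverts H. (y v)\<^sup>2)"
      by (rule graph_spectral_radius_rayleigh(1)[OF H neH])
    also have "(\<Sum>v\<in>pverts H. (y v)\<^sup>2) = (\<Sum>v\<in>pverts G. (x v)\<^sup>2)" unfolding s by (simp add: y)
    finally show ?thesis using pos[OF simple_graph_finite_vertices[OF sg] x(1)] by simp
  qed
qed

text \<open>A digraph isomorphism carries a separate map on arcs. Here arcs are pairs, with the
  projections as tail and head, so the arc map is determined by the vertex map.\<close>

lemma digraph_iso_imp_image:
  assumes G: "pair_graph G" and iso: "digraph_iso (with_proj G) (with_proj H)"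
  obtains f where "inj_on f (pverts G)" "pverts H = f ` pverts G" "edges_of H = (`) f ` edges_of G"
proof -
  obtain h where h: "pre_digraph.digraph_isomorphism (with_proj G) h" "with_proj H = app_iso h (with_proj G)"
    using iso unfolding digraph_iso_def by blast
  have t: "iso_tail h = fst" "iso_head h = snd"
    using arg_cong[OF h(2), of tail] arg_cong[OF h(2), of head] by simp_all
  have v: "pverts H = iso_verts h ` pverts G" and a: "parcs H = iso_arcs h ` parcs G"
    using arg_cong[OF h(2), of verts] arg_cong[OF h(2), of arcs] by simp_all
  have inj: "inj_on (iso_verts h) (pverts G)"
    using h(1) unfolding pre_digraph.digraph_isomorphism_def by simp
  have "iso_arcs h e = map_prod (iso_verts h) (iso_verts h) e" if "e \<in> parcs G" for e
    using h(1) that t unfolding pre_digraph.digraph_isomorphism_def by (simp add: prod_eq_iff)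
  then have "parcs H = map_prod (iso_verts h) (iso_verts h) ` parcs G" unfolding a by simp
  then have "edges_of H = (`) (iso_verts h) ` edges_of G"
    unfolding edges_of_def by (auto simp: image_image case_prod_beta)
  then show thesis using that inj v by blast
qed

lemma image_imp_digraph_iso:
  assumes G: "pair_graph G" and H: "pair_graph H"
    and f: "inj_on f (pverts G)" "pverts H = f ` pverts G" "edges_of H = (`) f ` edges_of G"
  shows "digraph_iso (with_proj G) (with_proj H)"
proof -
  interpret G: pair_graph G by fact
  define h where "h = \<lparr>iso_verts = f, iso_arcs = map_prod f f, iso_head = snd, iso_tail = fst\<rparr>"
  have V: "a \<in> pverts G" "b \<in> pverts G" if "(a, b) \<in> parcs G" for a b
    using G.in_arcsD1[OF that] G.in_arcsD2[OF that] .
  have arcs: "parcs H = map_prod f f ` parcs G"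
  proof (intro equalityI subsetI)
    fix e assume e: "e \<in> parcs H"
    obtain x y where xy: "e = (x, y)" by (cases e)
    have "{x, y} \<in> (`) f ` edges_of G" using e xy in_edges_of[OF H, of x y] f(3) by simp
    then obtain a b where ab: "(a, b) \<in> parcs G" "{x, y} = {f a, f b}" unfolding edges_of_def by auto
    then have "e = map_prod f f (a, b) \<or> e = map_prod f f (b, a)" using xy by (auto simp: doubleton_eq_iff)
    then show "e \<in> map_prod f f ` parcs G" using ab(1) pair_graph_sym[OF G ab(1)] by blast
  next
    fix e assume "e \<in> map_prod f f ` parcs G"
    then obtain a b where ab: "(a, b) \<in> parcs G" "e = (f a, f b)" by auto
    then have "f ` {a, b} \<in> (`) f ` edges_of G" using in_edges_of[OF G, of a b] by blast
    then have "{f a, f b} \<in> edges_of H" using f(3) by simp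
    then show "e \<in> parcs H" using in_edges_of[OF H] ab(2) by simp
  qed
  have "inj_on (map_prod f f) (parcs G)"
    by (rule inj_on_subset[OF map_prod_inj_on[OF f(1) f(1)]]) (use V in auto)
  then have "pre_digraph.digraph_isomorphism (with_proj G) h"
    unfolding pre_digraph.digraph_isomorphism_def h_def using f(1) G.wf_digraph_axioms by auto
  moreover have "with_proj H = app_iso h (with_proj G)"
    unfolding app_iso_def h_def with_proj_def using f(2) arcs by simp
  ultimately show ?thesis unfolding digraph_iso_def by blast
qed

section \<open>Radius and eigenfunctions of a fan\<close>

lemma fan_edges_image: "fan_edges (f u) (f w) (map f rs) = (`) f ` fan_edges u w rs"
proof -
  have "path_edges (map f rs) = (\<lambda>i. {map f rs ! i, map f rs ! Suc i}) ` {i. Suc i < length rs}"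
    unfolding path_edges_def setcompr_eq_image by simp
  also have "\<dots> = (\<lambda>i. f ` {rs ! i, rs ! Suc i}) ` {i. Suc i < length rs}"
    by (intro image_cong) auto
  also have "\<dots> = (`) f ` path_edges rs"
    unfolding path_edges_def by (simp add: image_image setcompr_eq_image)
  finally have "path_edges (map f rs) = (`) f ` path_edges rs" .
  then show ?thesis unfolding fan_edges_def by (simp add: image_Un image_image)
qed

text \<open>For \<open>m = length rs\<close>, the test function with value
  \<open>sqrt (m / 2)\<close> at the hubs and 1 elsewhere is the principal eigenvector of
  \<open>K\<^sub>2\<^sub>,\<^sub>m\<close>, with eigenvalue \<open>sqrt (2 * m)\<close>; the hub
  edge and the path edges only increase the form.\<close>

lemma fan_radius_lower_bound:
  assumes dist: "distinct (u # w # rs)" and rs: "rs \<noteq> []"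
    and bound: "\<And>y. quad (set (u # w # rs)) (fan_edges u w rs) y \<le> k * (\<Sum>v\<in>set (u # w # rs). (y v)\<^sup>2)"
  shows "0 < k" "2 * real (length rs) \<le> k\<^sup>2"
proof -
  define m where "m = real (length rs)"
  have m: "0 < m" unfolding m_def using rs by simp
  define a where "a = sqrt (m / 2)"
  have a: "0 < a" "2 * a\<^sup>2 = m" unfolding a_def using m by simp_all
  define y where "y v = (if v = u \<or> v = w then a else 1)" for v
  note sg = simple_graph_fan[OF dist]
  have R: "set (u # w # rs) = insert u (insert w (set rs))" "u \<noteq> w" "u \<notin> set rs" "w \<notin> set rs"
    using dist by auto
  have y0: "0 \<le> y v" for v unfolding y_def using a by simp
  have e0: "0 \<le> entry (fan_edges u w rs) y b c" for b c unfolding entry_def using y0 by simp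
  have e1: "entry (fan_edges u w rs) y u r + entry (fan_edges u w rs) y w r = 2 * a" if "r \<in> set rs" for r
    using that R unfolding entry_def fan_edges_def y_def by auto
  have card: "real (card (set rs)) = m" unfolding m_def using dist by (simp add: distinct_card)
  have "4 * a * m = 2 * (\<Sum>r\<in>set rs. entry (fan_edges u w rs) y u r + entry (fan_edges u w rs) y w r)"
    using card by (simp add: e1)
  also have "\<dots> \<le> quad (set (u # w # rs)) (fan_edges u w rs) y"
    unfolding quad_split[OF sg R] using e0 by (simp add: sum_nonneg)
  also have "\<dots> \<le> k * (\<Sum>v\<in>set (u # w # rs). (y v)\<^sup>2)" by (rule bound)
  also have "(\<Sum>v\<in>set (u # w # rs). (y v)\<^sup>2) = 2 * m"
  proof -
    have "(\<Sum>v\<in>set rs. (y v)\<^sup>2) = (\<Sum>v\<in>set rs. 1)" unfolding y_def using R by (intro sum.cong) auto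
    then show ?thesis using R a(2) card by (simp add: y_def)
  qed
  finally have "(2 * a) * (2 * m) \<le> k * (2 * m)" by (simp add: algebra_simps)
  then have k: "2 * a \<le> k" using m by simp
  then show "0 < k" using a by simp
  have "(2 * a)\<^sup>2 \<le> k\<^sup>2" using k a by (intro power_mono) auto
  then show "2 * real (length rs) \<le> k\<^sup>2" using a(2) unfolding m_def by (simp add: power_mult_distrib)
qed

text \<open>At a zero of a nonnegative eigenfunction all neighbours vanish as well. The hub
  \<open>u\<close> is adjacent to all other vertices, so a single zero would spread to
  \<open>u\<close> and from there to everything.\<close>

lemma fan_eigenfunction_positive:
  assumes dist: "distinct (u # w # rs)" and rs: "rs \<noteq> []"
    and x0: "\<And>v. v \<in> set (u # w # rs) \<Longrightarrow> 0 \<le> x v" and x1: "\<exists>v\<in>set (u # w # rs). 0 < x v"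
    and eig: "\<And>v. v \<in> set (u # w # rs) \<Longrightarrow> (\<Sum>r\<in>neigh (fan_edges u w rs) v. x r) = (k :: real) * x v"
    and v: "v \<in> set (u # w # rs)"
  shows "0 < x v"
proof -
  let ?V = "set (u # w # rs)" and ?E = "fan_edges u w rs"
  note sg = simple_graph_fan[OF dist]
  have zero: "x b = 0" if "a \<in> ?V" "x a = 0" "{a, b} \<in> ?E" for a b
  proof -
    have N: "neigh ?E a \<subseteq> ?V" using simple_graph_neigh(2)[OF sg] by blast
    have "(\<Sum>r\<in>neigh ?E a. x r) = 0" using eig[OF that(1)] that(2) by simp
    then have "\<forall>r\<in>neigh ?E a. x r = 0"
      using sum_nonneg_eq_0_iff[OF simple_graph_finite_neigh[OF sg], of a x] x0 N by blast
    then show ?thesis using that(3) unfolding neigh_def by simp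
  qed
  have uw: "{u, w} \<in> ?E" "{w, u} \<in> ?E" and ur: "{u, r} \<in> ?E" "{r, u} \<in> ?E" if "r \<in> set rs" for r
    using that unfolding fan_edges_def by (auto simp: insert_commute)
  obtain r0 where "r0 \<in> set rs" using rs by (metis list.set_intros(1) neq_Nil_conv)
  note uw = uw[OF this]
  have u: "x u \<noteq> 0"
  proof
    assume 0: "x u = 0"
    have "x b = 0" if "b \<in> ?V" for b
      using that 0 zero[OF _ 0 uw(1)] zero[OF _ 0 ur(1)] by auto
    then show False using x1 by auto
  qed
  have "x v \<noteq> 0"
  proof
    assume 0: "x v = 0"
    consider "v = u" | "v = w" | "v \<in> set rs" using v by auto
    then show False
    proof cases
      case 1
      then show False using 0 u by simp
    next
      case 2
      then show False using zero[OF v 0, of u] uw(2) u by simp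
    next
      case 3
      then show False using zero[OF v 0 ur(2)[OF 3]] u by simp
    qed
  qed
  then show ?thesis using x0[OF v] by simp
qed

section \<open>The extremal graph\<close>

definition extremal :: "nat \<Rightarrow> (nat + nat) pair_pre_digraph" where
  "extremal m = complete_graph 2 \<nabla> path_graph m"

lemma pverts_extremal: "pverts (extremal m) = set (Inl 0 # Inl 1 # map Inr [0..<m])"
proof -
  have "{..<2::nat} = {0, 1}" by auto
  then show ?thesis unfolding extremal_def graph_join_def complete_graph_def path_graph_def
    by (auto simp: atLeast0LessThan)
qed

lemma parcs_extremal:
  "(Inl i, Inl j) \<in> parcs (extremal m) \<longleftrightarrow> i < 2 \<and> j < 2 \<and> i \<noteq> j"
  "(Inr i, Inr j) \<in> parcs (extremal m) \<longleftrightarrow> i < m \<and> j < m \<and> (j = Suc i \<or> i = Suc j)"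
  "(Inl i, Inr j) \<in> parcs (extremal m) \<longleftrightarrow> i < 2 \<and> j < m"
  "(Inr j, Inl i) \<in> parcs (extremal m) \<longleftrightarrow> i < 2 \<and> j < m"
  unfolding extremal_def graph_join_def complete_graph_def path_graph_def by auto

lemma pverts_extremal_iff:
  "Inl i \<in> pverts (extremal m) \<longleftrightarrow> i < 2" "Inr j \<in> pverts (extremal m) \<longleftrightarrow> j < m"
  unfolding extremal_def graph_join_def complete_graph_def path_graph_def by auto

lemma pair_graph_extremal: "pair_graph (extremal m)"
proof -
  have fin: "finite (pverts (extremal m))" unfolding pverts_extremal by simp
  have arc: "a \<in> pverts (extremal m) \<and> b \<in> pverts (extremal m) \<and> a \<noteq> b \<and> (b, a) \<in> parcs (extremal m)"
    if "(a, b) \<in> parcs (extremal m)" for a b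
    using that by (cases a; cases b) (auto simp: parcs_extremal pverts_extremal_iff)
  have sub: "parcs (extremal m) \<subseteq> pverts (extremal m) \<times> pverts (extremal m)"
    using arc by auto
  have "finite (parcs (extremal m))" using finite_subset[OF sub] fin by simp
  moreover have "sym (parcs (extremal m))" using arc by (auto intro: symI)
  ultimately show ?thesis using fin arc by unfold_locales (auto simp: symmetric_def)
qed

lemma edges_of_extremal: "edges_of (extremal m) = fan_edges (Inl 0) (Inl 1) (map Inr [0..<m])"
proof (intro equalityI subsetI)
  have path: "{Inr j, Inr (Suc j)} \<in> path_edges (map Inr [0..<m] :: (nat + nat) list)" if "Suc j < m" for j
    using that unfolding path_edges_def by (intro CollectI exI[of _ j]) simp
  fix e assume "e \<in> edges_of (extremal m)"
  then obtain a b where ab: "(a, b) \<in> parcs (extremal m)" "e = {a, b}" unfolding edges_of_def by auto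
  show "e \<in> fan_edges (Inl 0) (Inl 1) (map Inr [0..<m])"
  proof (cases a; cases b)
    fix i j assume "a = Inl i" "b = Inl j"
    then have "e = {Inl 0, Inl 1}" using ab by (auto simp: parcs_extremal less_2_cases_iff)
    then show ?thesis unfolding fan_edges_def by simp
  next
    fix i j assume "a = Inl i" "b = Inr j"
    then have "(e = {Inl 0, Inr j} \<or> e = {Inl 1, Inr j}) \<and> j < m" using ab by (auto simp: parcs_extremal less_2_cases_iff)
    then show ?thesis unfolding fan_edges_def by auto
  next
    fix j i assume "a = Inr j" "b = Inl i"
    then have "(e = {Inl 0, Inr j} \<or> e = {Inl 1, Inr j}) \<and> j < m" using ab by (auto simp: parcs_extremal less_2_cases_iff)
    then show ?thesis unfolding fan_edges_def by auto
  next
    fix i j assume "a = Inr i" "b = Inr j"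
    then have "e = {Inr i, Inr (Suc i)} \<and> Suc i < m \<or> e = {Inr j, Inr (Suc j)} \<and> Suc j < m"
      using ab by (auto simp: parcs_extremal)
    then have "e \<in> path_edges (map Inr [0..<m])" using path by auto
    then show ?thesis unfolding fan_edges_def by simp
  qed
next
  fix e :: "(nat + nat) set" assume "e \<in> fan_edges (Inl 0) (Inl 1) (map Inr [0..<m])"
  then consider "e = {Inl 0, Inl 1}" | j where "j < m" "e = {Inl 0, Inr j}" | j where "j < m" "e = {Inl 1, Inr j}"
    | j where "Suc j < m" "e = {Inr j, Inr (Suc j)}"
    unfolding fan_edges_def path_edges_def by auto
  then show "e \<in> edges_of (extremal m)"
    by cases (simp_all add: in_edges_of[OF pair_graph_extremal] parcs_extremal)
qed

text \<open>The shift to \<open>Suc j\<close> keeps the path off the imaginary axis, which carries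
  the edge between the hubs.\<close>

definition fan_point :: "nat + nat \<Rightarrow> complex" where
  "fan_point v = (case v of Inl i \<Rightarrow> (if i = 0 then \<i> else - \<i>) | Inr j \<Rightarrow> of_nat (Suc j))"

lemma fan_point_simps:
  "fan_point (Inl 0) = \<i>" "fan_point (Inl (Suc 0)) = - \<i>" "fan_point (Inr j) = of_nat (Suc j)"
  unfolding fan_point_def by simp_all

text \<open>The hubs are drawn at \<open>\<plusminus>\<i>\<close> and the path on the real axis. For the edge between the hubs, the
  whole imaginary axis is harmless.\<close>

definition on_segment :: "(nat + nat) set \<Rightarrow> complex \<Rightarrow> bool" where
  "on_segment e z \<longleftrightarrow>
     e = {Inl 0, Inl 1} \<and> Re z = 0 \<or>
     (\<exists>j. e = {Inl 0, Inr j} \<and> 0 \<le> Im z \<and> Im z \<le> 1 \<and> Re z = (1 - Im z) * real (Suc j)) \<or>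
     (\<exists>j. e = {Inl 1, Inr j} \<and> - 1 \<le> Im z \<and> Im z \<le> 0 \<and> Re z = (1 + Im z) * real (Suc j)) \<or>
     (\<exists>j. e = {Inr j, Inr (Suc j)} \<and> Im z = 0 \<and> real (Suc j) \<le> Re z \<and> Re z \<le> real (Suc (Suc j)))"

lemma on_segment_point:
  assumes "on_segment e (fan_point v)" "v = Inl 0 \<or> v = Inl 1 \<or> v = Inr j"
  shows "v \<in> e"
  using assms(2)
proof (elim disjE)
  assume "v = Inl 0"
  then show ?thesis using assms(1) unfolding on_segment_def by (auto simp: fan_point_simps)
next
  assume "v = Inl 1"
  then show ?thesis using assms(1) unfolding on_segment_def by (auto simp: fan_point_simps)
next
  assume v: "v = Inr j"
  have "k = j \<or> k = Suc j" if "real k \<le> real (Suc j)" "real (Suc j) \<le> real (Suc k)" for k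
    using that by linarith
  then show ?thesis using assms(1) v unfolding on_segment_def by (auto simp: fan_point_simps)
qed

text \<open>The coordinate \<open>t\<close> is 0 on the hub edge, \<open>j + 1\<close> on the spokes
  to path vertex \<open>j\<close>, and between \<open>j + 1\<close> and \<open>j + 2\<close> on a
  path edge. Together with the sign of \<open>Im z\<close> it separates the edges except at their
  vertices. Heights of absolute value at least 1, where \<open>t\<close> has no positive
  denominator, are treated first; apart from the hub edge, only the hubs themselves occur
  there.\<close>

lemma on_segment_common:
  assumes e: "on_segment e z" and f: "on_segment f z" and ne: "e \<noteq> f"
  shows "z \<in> fan_point ` (e \<inter> f)"
proof (cases "\<bar>Im z\<bar> < 1")
  case False
  have top: "Inl 0 \<in> g \<and> z = \<i>" if "on_segment g z" "g \<noteq> {Inl 0, Inl 1}" "0 < Im z" for g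
    using that False unfolding on_segment_def by (auto simp: complex_eq_iff)
  have bot: "Inl 1 \<in> g \<and> z = - \<i>" if "on_segment g z" "g \<noteq> {Inl 0, Inl 1}" "Im z < 0" for g
    using that False unfolding on_segment_def by (auto simp: complex_eq_iff)
  consider "0 < Im z" | "Im z < 0" using False by linarith
  then show ?thesis
  proof cases
    case 1
    then have "z = \<i>" "Inl 0 \<in> e \<inter> f" using top[OF e] top[OF f] ne by auto
    then show ?thesis using fan_point_simps(1) by (metis image_eqI)
  next
    case 2
    then have "z = - \<i>" "Inl 1 \<in> e \<inter> f" using bot[OF e] bot[OF f] ne by auto
    then show ?thesis using fan_point_simps(2) by (metis One_nat_def image_eqI)
  qed
next
  case True
  \<comment> \<open>The slope coordinate \<open>Re z / (1 - \<bar>Im z\<bar>)\<close> tells the spokes apart.\<close>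
  define t where "t = Re z / (1 - \<bar>Im z\<bar>)"
  have Re: "Re z = (1 - \<bar>Im z\<bar>) * t" unfolding t_def using True by simp
  define side :: "nat \<Rightarrow> bool" where "side a \<longleftrightarrow> a = 0 \<and> 0 \<le> Im z \<or> a = 1 \<and> Im z \<le> 0" for a
  have kind: "(g = {Inl 0, Inl 1} \<and> t = 0) \<or>
      (\<exists>a j. g = {Inl a, Inr j} \<and> side a \<and> t = real (Suc j)) \<or>
      (\<exists>j. g = {Inr j, Inr (Suc j)} \<and> Im z = 0 \<and> real (Suc j) \<le> t \<and> t \<le> real (Suc (Suc j)))" if "on_segment g z" for g
    using that unfolding on_segment_def
  proof (elim disjE exE conjE)
    assume "g = {Inl 0, Inl 1}" "Re z = 0"
    then show ?thesis unfolding t_def by simp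
  next
    fix j assume g: "g = {Inl 0, Inr j}" "0 \<le> Im z" "Re z = (1 - Im z) * real (Suc j)"
    then have "t = real (Suc j)" unfolding t_def using True by simp
    moreover have "side 0" using g(2) unfolding side_def by simp
    ultimately show ?thesis using g(1) by blast
  next
    fix j assume g: "g = {Inl 1, Inr j}" "Im z \<le> 0" "Re z = (1 + Im z) * real (Suc j)"
    then have "t = real (Suc j)" unfolding t_def using True by simp
    moreover have "side 1" using g(2) unfolding side_def by simp
    ultimately show ?thesis using g(1) by blast
  next
    fix j assume g: "g = {Inr j, Inr (Suc j)}" "Im z = 0" "real (Suc j) \<le> Re z" "Re z \<le> real (Suc (Suc j))"
    then have "t = Re z" unfolding t_def by simp
    then show ?thesis using g by metis
  qed
  have vertex: "z \<in> fan_point ` (e \<inter> f)" if "Inr j \<in> e" "Inr j \<in> f" "Im z = 0" "t = real (Suc j)" for j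
  proof -
    have "z = fan_point (Inr j)" using that(3,4) Re by (simp add: complex_eq_iff fan_point_simps)
    then show ?thesis using that(1,2) by blast
  qed
  have step: "j = k \<or> j = Suc k" if "real (Suc k) \<le> real (Suc j)" "real (Suc j) \<le> real (Suc (Suc k))" for j k
    using that by linarith
  from kind[OF e] show ?thesis
  proof (elim disjE exE conjE)
    assume e': "e = {Inl 0, Inl 1}" "t = 0"
    then show ?thesis using kind[OF f] ne by auto
  next
    fix j assume e': "e = {Inr j, Inr (Suc j)}" "Im z = 0" "real (Suc j) \<le> t" "t \<le> real (Suc (Suc j))"
    from kind[OF f] show ?thesis
    proof (elim disjE exE conjE)
      assume "t = 0"
      then show ?thesis using e'(3) by simp
    next
      fix a k assume "f = {Inl a, Inr k}" "t = real (Suc k)"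
      then show ?thesis using vertex[of k] step[of j k] e' by auto
    next
      fix k assume f': "f = {Inr k, Inr (Suc k)}" "real (Suc k) \<le> t" "t \<le> real (Suc (Suc k))"
      then have "j \<noteq> k" using ne e'(1) by auto
      then consider "j = Suc k" | "k = Suc j" using e'(3,4) f'(2,3) by linarith
      then show ?thesis
      proof cases
        case 1
        then have "t = real (Suc j)" using e'(3) f'(3) by simp
        then show ?thesis using vertex[of j] 1 e'(1,2) f'(1) by simp
      next
        case 2
        then have "t = real (Suc k)" using f'(2) e'(4) by simp
        then show ?thesis using vertex[of k] 2 e'(1,2) f'(1) by simp
      qed
    qed
  next
    fix a j assume e': "e = {Inl a, Inr j}" "side a" "t = real (Suc j)"
    from kind[OF f] show ?thesis
    proof (elim disjE exE conjE)
      assume "t = 0"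
      then show ?thesis using e'(3) by simp
    next
      fix b k assume f': "f = {Inl b, Inr k}" "side b" "t = real (Suc k)"
      have "j = k" using e'(3) f'(3) by linarith
      then have "a \<noteq> b" using ne e'(1) f'(1) by auto
      then have "Im z = 0" using e'(2) f'(2) unfolding side_def by auto
      then show ?thesis using vertex[of j] e'(1,3) f'(1) \<open>j = k\<close> by simp
    next
      fix k assume "f = {Inr k, Inr (Suc k)}" "Im z = 0" "real (Suc k) \<le> t" "t \<le> real (Suc (Suc k))"
      then show ?thesis using vertex[of j] step[of k j] e' by auto
    qed
  qed
qed

lemma extremal_arc_segment:
  assumes "(a, b) \<in> parcs (extremal m)" "z \<in> closed_segment (fan_point a) (fan_point b)"
  shows "on_segment {a, b} z"
proof -
  have base: "on_segment {a, b} z" if ab: "a = Inl 0 \<and> b = Inl 1 \<or> a = Inl 0 \<and> b = Inr j \<or> a = Inl 1 \<and> b = Inr j \<or>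
      a = Inr j \<and> b = Inr (Suc j)" and z: "z \<in> closed_segment (fan_point a) (fan_point b)" for a b j
  proof -
    obtain s where s: "0 \<le> s" "s \<le> 1" "z = (1 - s) *\<^sub>R fan_point a + s *\<^sub>R fan_point b"
      using z unfolding closed_segment_def by auto
    have ReIm: "Re z = (1 - s) * Re (fan_point a) + s * Re (fan_point b)"
      "Im z = (1 - s) * Im (fan_point a) + s * Im (fan_point b)"
      using s(3) by simp_all
    from ab show ?thesis
    proof (elim disjE)
      assume ab: "a = Inl 0 \<and> b = Inl 1"
      then have "Re z = 0" using ReIm by (simp add: fan_point_simps)
      then show ?thesis using ab unfolding on_segment_def by simp
    next
      assume ab: "a = Inl 0 \<and> b = Inr j"
      then have "Re z = s * real (Suc j)" "Im z = 1 - s" using ReIm ab by (simp_all add: fan_point_simps)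
      then have "0 \<le> Im z \<and> Im z \<le> 1 \<and> Re z = (1 - Im z) * real (Suc j)" using s(1,2) by simp
      then show ?thesis using ab unfolding on_segment_def by blast
    next
      assume ab: "a = Inl 1 \<and> b = Inr j"
      then have "Re z = s * real (Suc j)" "Im z = s - 1" using ReIm ab by (simp_all add: fan_point_simps)
      then have "- 1 \<le> Im z \<and> Im z \<le> 0 \<and> Re z = (1 + Im z) * real (Suc j)" using s(1,2) by simp
      then show ?thesis using ab unfolding on_segment_def by blast
    next
      assume ab: "a = Inr j \<and> b = Inr (Suc j)"
      then have "Re z = real (Suc j) + s" "Im z = 0" using ReIm ab by (simp_all add: fan_point_simps algebra_simps)
      then have "Im z = 0 \<and> real (Suc j) \<le> Re z \<and> Re z \<le> real (Suc (Suc j))" using s(1,2) by simp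
      then show ?thesis using ab unfolding on_segment_def by blast
    qed
  qed
  have "\<exists>j. (a = Inl 0 \<and> b = Inl 1 \<or> a = Inl 0 \<and> b = Inr j \<or> a = Inl 1 \<and> b = Inr j \<or> a = Inr j \<and> b = Inr (Suc j)) \<or>
    (b = Inl 0 \<and> a = Inl 1 \<or> b = Inl 0 \<and> a = Inr j \<or> b = Inl 1 \<and> a = Inr j \<or> b = Inr j \<and> a = Inr (Suc j))"
    using assms(1) by (cases a; cases b) (auto simp: parcs_extremal less_2_cases_iff)
  then show ?thesis
    using base[of a b] base[of b a] assms(2) by (metis closed_segment_commute insert_commute)
qed

lemma planar_extremal: "planar (extremal m)"
proof -
  \<comment> \<open>Edges are unordered, so each is given a direction before its line segment is
    parametrised.\<close>
  define q where "q e = (SOME r. (e :: (nat + nat) set) = {fst r, snd r})" for e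
  define g where "g e = linepath (fan_point (fst (q e))) (fan_point (snd (q e)))" for e
  have q: "{fst (q {a, b}), snd (q {a, b})} = {a, b}" for a b
  proof -
    have "\<exists>r. {a, b} = {fst r, snd r}" by (rule exI[of _ "(a, b)"]) simp
    from someI_ex[OF this] show ?thesis unfolding q_def by (rule sym)
  qed
  then have q': "fst (q {a, b}) = a \<and> snd (q {a, b}) = b \<or> fst (q {a, b}) = b \<and> snd (q {a, b}) = a" for a b
    by (metis doubleton_eq_iff)
  have img: "path_image (g {a, b}) = closed_segment (fan_point a) (fan_point b)" for a b
    using q'[of a b] unfolding g_def by (auto simp: closed_segment_commute)
  have kinds: "v = Inl 0 \<or> v = Inl 1 \<or> (\<exists>j. v = Inr j)" if "v \<in> pverts (extremal m)" for v
    using that by (cases v) (auto simp: pverts_extremal_iff less_2_cases_iff)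
  have inj: "inj_on fan_point (pverts (extremal m))"
    using kinds by (auto simp: inj_on_def fan_point_simps complex_eq_iff dest!: kinds)
  note sg = simple_graph_edges_of[OF pair_graph_extremal[of m]]
  have arcD: "a \<in> pverts (extremal m)" "b \<in> pverts (extremal m)" "a \<noteq> b" if "(a, b) \<in> parcs (extremal m)" for a b
    using simple_graph_neigh[OF sg, of b a] that neigh_edges_of[OF pair_graph_extremal, of m a] by auto
  have edge: "arc (g {a, b})" "{pathstart (g {a, b}), pathfinish (g {a, b})} = {fan_point a, fan_point b}"
      "path_image (g {a, b}) \<inter> fan_point ` pverts (extremal m) = {fan_point a, fan_point b}"
    if ab: "(a, b) \<in> parcs (extremal m)" for a b
  proof -
    have "fan_point a \<noteq> fan_point b" using inj_on_contraD[OF inj arcD(3)[OF ab] arcD(1,2)[OF ab]] .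
    then show "arc (g {a, b})" using q'[of a b] unfolding g_def by (auto intro!: arc_linepath)
    show "{pathstart (g {a, b}), pathfinish (g {a, b})} = {fan_point a, fan_point b}"
      using q'[of a b] unfolding g_def by auto
    show "path_image (g {a, b}) \<inter> fan_point ` pverts (extremal m) = {fan_point a, fan_point b}"
    proof
      show "path_image (g {a, b}) \<inter> fan_point ` pverts (extremal m) \<subseteq> {fan_point a, fan_point b}"
      proof
        fix z assume z: "z \<in> path_image (g {a, b}) \<inter> fan_point ` pverts (extremal m)"
        then obtain v where v: "v \<in> pverts (extremal m)" "z = fan_point v" by (elim IntE imageE)
        have "on_segment {a, b} (fan_point v)"
          using extremal_arc_segment[OF ab, of z] z v(2) img[of a b] by simp
        then have "v \<in> {a, b}" using on_segment_point kinds[OF v(1)] by metis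
        then show "z \<in> {fan_point a, fan_point b}" using v(2) by auto
      qed
      show "{fan_point a, fan_point b} \<subseteq> path_image (g {a, b}) \<inter> fan_point ` pverts (extremal m)"
        using arcD(1,2)[OF ab] img[of a b] by simp
    qed
  qed
  have cross: "path_image (g {a, b}) \<inter> path_image (g {c, d}) \<subseteq> fan_point ` ({a, b} \<inter> {c, d})"
    if "(a, b) \<in> parcs (extremal m)" "(c, d) \<in> parcs (extremal m)" "{a, b} \<noteq> {c, d}" for a b c d
    using on_segment_common[OF extremal_arc_segment[OF that(1)] extremal_arc_segment[OF that(2)] that(3)]
    unfolding img by (intro subsetI) (elim IntE)
  have "plane_drawing (extremal m) fan_point g"
    unfolding plane_drawing_def
  proof (intro conjI ballI inj)
    show "case e of (a, b) \<Rightarrow> arc (g {a, b}) \<and>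
        {pathstart (g {a, b}), pathfinish (g {a, b})} = {fan_point a, fan_point b} \<and>
        path_image (g {a, b}) \<inter> fan_point ` pverts (extremal m) = {fan_point a, fan_point b}"
      if "e \<in> parcs (extremal m)" for e
    proof (cases e)
      case (Pair a b)
      then show ?thesis using edge[of a b] that by (simp only: prod.case)
    qed
    show "case e of (a, b) \<Rightarrow> \<forall>(c, d) \<in> parcs (extremal m). {a, b} \<noteq> {c, d} \<longrightarrow>
        path_image (g {a, b}) \<inter> path_image (g {c, d}) \<subseteq> fan_point ` ({a, b} \<inter> {c, d})"
      if "e \<in> parcs (extremal m)" for e
    proof (cases e)
      case (Pair a b)
      then show ?thesis using cross[of a b] that by (simp only: prod.case) (intro ballI, clarify, blast)
    qed
  qed
  then show ?thesis unfolding planar_def by blast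
qed

section \<open>Uniqueness of the extremal graph\<close>

lemma planar_point_drawing:
  assumes G: "pair_graph G" and "planar G"
  obtains p M where "point_drawing (pverts G) (edges_of G) p M"
proof -
  obtain p g where pl: "plane_drawing G p g" using assms(2) unfolding planar_def by blast
  note P = pl[unfolded plane_drawing_def]
  have inj: "inj_on p (pverts G)" using P by (rule conjunct1)
  have edge: "arc (g {u, v}) \<and> {pathstart (g {u, v}), pathfinish (g {u, v})} = {p u, p v} \<and>
      path_image (g {u, v}) \<inter> p ` pverts G = {p u, p v}" if "(u, v) \<in> parcs G" for u v
    using bspec[OF P[THEN conjunct2, THEN conjunct1] that] by simp
  have cross: "path_image (g {u, v}) \<inter> path_image (g {x, y}) \<subseteq> p ` ({u, v} \<inter> {x, y})"
    if uv: "(u, v) \<in> parcs G" and xy: "(x, y) \<in> parcs G" and ne: "{u, v} \<noteq> {x, y}" for u v x y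
    using bspec[OF P[THEN conjunct2, THEN conjunct2] uv, unfolded prod.case, THEN bspec, OF xy, unfolded prod.case] ne
    by (rule mp)
  have ex: "\<exists>u v. (u, v) \<in> parcs G \<and> e = {u, v}" if "e \<in> edges_of G" for e
    using that unfolding edges_of_def by auto
  have "point_drawing (pverts G) (edges_of G) p (\<lambda>e. path_image (g e))"
    unfolding point_drawing_def
  proof (intro conjI ballI impI inj)
    fix e assume e: "e \<in> edges_of G"
    then show "\<exists>u v. u \<in> pverts G \<and> v \<in> pverts G \<and> u \<noteq> v \<and> e = {u, v}"
      using simple_graph_edges_of[OF G] unfolding simple_graph_def by blast
    obtain u v where uv: "(u, v) \<in> parcs G" "e = {u, v}" using ex[OF e] by blast
    note E = edge[OF uv(1)]
    show "path_connected (path_image (g e))"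
      using E uv(2) by (simp add: arc_imp_path path_connected_path_image)
    show "p ` e \<subseteq> path_image (g e)" "path_image (g e) \<inter> p ` pverts G \<subseteq> p ` e"
      using E uv(2) by auto
    fix f assume f: "f \<in> edges_of G" "e \<noteq> f"
    obtain x y where xy: "(x, y) \<in> parcs G" "f = {x, y}" using ex[OF f(1)] by blast
    show "path_image (g e) \<inter> path_image (g f) \<subseteq> p ` (e \<inter> f)"
      using cross[OF uv(1) xy(1)] uv(2) xy(2) f(2) by simp
  qed
  then show thesis by (rule that)
qed

text \<open>For the normalised eigenvector \<open>z\<close> of \<open>G\<close>, \<open>rT * N \<le>
  rG * N = quad V E z \<le> quad V (fan_edges u w rs) z \<le> rT * N\<close>, so equality holds
  throughout. \<open>G\<close> may be disconnected, hence \<open>z\<close> is at first only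
  nonnegative; but equality makes \<open>z\<close> an eigenfunction of the fan, and there positivity
  follows. The equality case of the comparison then identifies the edge sets.\<close>

lemma large_radius_imp_extremal:
  fixes G :: "'a pair_pre_digraph"
  assumes n: "4500000 \<le> real n" and G: "planar_graph_of_order n G"
    and ge: "graph_spectral_radius (extremal (n - 2)) \<le> graph_spectral_radius G"
  shows "digraph_iso (with_proj G) (with_proj (extremal (n - 2)))"
proof -
  define m where "m = n - 2"
  define V where "V = pverts G"
  define E where "E = edges_of G"
  define rG where "rG = graph_spectral_radius G"
  define rT where "rT = graph_spectral_radius (extremal m)"
  have pg: "pair_graph G" and pl: "planar G" and cV: "card V = n"
    using G unfolding planar_graph_of_order_def V_def by simp_all
  have n2: "2 < n" "n = m + 2" using n unfolding m_def by auto
  have ne: "V \<noteq> {}" using cV n2 by auto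
  have sg: "simple_graph V E" unfolding V_def E_def by (rule simple_graph_edges_of[OF pg])
  note fin = simple_graph_finite_vertices[OF sg]
  obtain p M where pd: "point_drawing V E p M"
    using planar_point_drawing[OF pg pl] unfolding V_def E_def by metis
  note fp = point_drawing_fat_planar[OF pd]
  have distT: "distinct (Inl 0 # Inl 1 # map Inr [0..<m] :: (nat + nat) list)" by (auto simp: distinct_map)
  have mne: "map Inr [0..<m] \<noteq> ([] :: (nat + nat) list)" using n2 by auto
  have neT: "pverts (extremal m) \<noteq> {}" unfolding pverts_extremal by simp
  note rayT = graph_spectral_radius_rayleigh(1)[OF pair_graph_extremal neT, folded rT_def]
  note lowT = fan_radius_lower_bound[OF distT mne rayT[unfolded pverts_extremal edges_of_extremal]]
  have rT: "0 < rT" "2 * real n - 4 \<le> rT\<^sup>2" using lowT n2 by auto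
  have rG: "0 < rG" "2 * real (card V) - 4 \<le> rG\<^sup>2" "rT \<le> rG"
  proof -
    show "rT \<le> rG" using ge unfolding rT_def rG_def m_def .
    then show "0 < rG" using rT(1) by simp
    have "rT\<^sup>2 \<le> rG\<^sup>2" using \<open>rT \<le> rG\<close> rT(1) by (intro power_mono) auto
    then show "2 * real (card V) - 4 \<le> rG\<^sup>2" using rT(2) cV by simp
  qed
  obtain x where x: "\<And>v. v \<in> V \<Longrightarrow> 0 \<le> x v" "\<exists>v\<in>V. 0 < x v"
    "\<And>v. v \<in> V \<Longrightarrow> (\<Sum>r\<in>neigh E v. x r) = rG * x v"
    using graph_spectral_radius_rayleigh(2)[OF pg] ne unfolding V_def E_def rG_def by blast
  define K where "K = Max (x ` V)"
  have "K \<in> x ` V" unfolding K_def using fin ne by (intro Max_in) auto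
  then obtain u where u: "u \<in> V" "x u = K" by auto
  have leK: "x v \<le> K" if "v \<in> V" for v unfolding K_def using fin that by simp
  have K0: "0 < K" using x(2) leK by (meson less_le_trans)
  define z where "z v = x v / K" for v
  have z01: "0 \<le> z v \<and> z v \<le> 1" if "v \<in> V" for v
    unfolding z_def using x(1)[OF that] leK[OF that] K0 by simp
  have zu: "z u = 1" unfolding z_def using u K0 by simp
  have zeig: "(\<Sum>r\<in>neigh E v. z r) = rG * z v" if "v \<in> V" for v
    unfolding z_def using x(3)[OF that] by (simp add: sum_divide_distrib[symmetric])
  have ncard: "4500000 \<le> real (card V)" using n cV by simp
  obtain w where w: "w \<in> V" "w \<noteq> u" "19 / 20 \<le> z w" "\<And>v. v \<in> V - {u, w} \<Longrightarrow> z v \<le> 11 / 100"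
    using two_dominant_vertices[OF fp fin ncard z01 zeig rG(1,2) u(1) zu] by metis
  have "z w \<le> 1" using z01[OF w(1)] by simp
  note fan = planar_quad_le_fan[OF pd fin u(1) w(1) w(2)[symmetric] zu w(3) this]
  obtain rs where dist: "distinct (u # w # rs)" and Vrs: "V = set (u # w # rs)"
    and qle: "quad V E z \<le> quad V (fan_edges u w rs) z"
    and qeq: "(\<And>v. v \<in> V \<Longrightarrow> 0 < z v) \<Longrightarrow> quad V E z = quad V (fan_edges u w rs) z \<Longrightarrow> E = fan_edges u w rs"
    using fan z01 w(4) by metis
  have len: "length rs = m" using cV n2(2) distinct_card[OF dist] Vrs by simp
  \<comment> \<open>The position in \<open>rs\<close> is the label of a path vertex in the extremal
    graph; this carries the Rayleigh bound for the radius \<open>rT\<close> over to the fan on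
    \<open>V\<close>.\<close>
  define i where "i v = the_inv_into {..<m} ((!) rs) v" for v
  define f where "f v = (if v = u then Inl 0 else if v = w then Inl 1 else Inr (i v) :: nat + nat)" for v
  have i: "i (rs ! j) = j" if "j < m" for j
    unfolding i_def using that dist len by (intro the_inv_into_f_f) (auto simp: inj_on_nth)
  have fu: "f u = Inl 0" "f w = Inl 1" unfolding f_def using w(2) by simp_all
  have fr: "f (rs ! j) = Inr j" if "j < m" for j
  proof -
    have "rs ! j \<in> set rs" using that len by simp
    then show ?thesis using dist i[OF that] unfolding f_def by auto
  qed
  have mapf: "map f rs = map Inr [0..<m]" using fr len by (intro nth_equalityI) auto
  have VT: "pverts (extremal m) = f ` V"
    unfolding pverts_extremal Vrs using fu mapf[THEN arg_cong, of set] by simp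
  have finj: "inj_on f V"
  proof -
    have "distinct (map f (u # w # rs))" using distT fu mapf by simp
    then have "inj_on f (set (u # w # rs))" by (simp only: distinct_map)
    then show ?thesis unfolding Vrs .
  qed
  have ET: "edges_of (extremal m) = (`) f ` fan_edges u w rs"
    unfolding edges_of_extremal using fan_edges_image[of f u w rs] fu mapf by simp
  have sgF: "simple_graph V (fan_edges u w rs)" unfolding Vrs by (rule simple_graph_fan[OF dist])
  have ray: "quad V (fan_edges u w rs) y \<le> rT * (\<Sum>v\<in>V. (y v)\<^sup>2)" for y
  proof -
    define y' where "y' v = y (the_inv_into V f v)" for v
    have y': "y' (f v) = y v" if "v \<in> V" for v unfolding y'_def using the_inv_into_f_f[OF finj that] by simp
    have "quad V (fan_edges u w rs) y = quad V (fan_edges u w rs) (\<lambda>v. y' (f v))"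
      by (rule quad_cong[OF sgF]) (simp add: y')
    also have "\<dots> = quad (pverts (extremal m)) (edges_of (extremal m)) y'"
      unfolding VT ET by (rule quad_image[OF finj sgF, symmetric])
    also have "\<dots> \<le> rT * (\<Sum>v\<in>pverts (extremal m). (y' v)\<^sup>2)" by (rule rayT)
    also have "(\<Sum>v\<in>pverts (extremal m). (y' v)\<^sup>2) = (\<Sum>v\<in>V. (y v)\<^sup>2)"
      unfolding VT by (simp add: sum.reindex[OF finj] y')
    finally show ?thesis .
  qed
  define N where "N = (\<Sum>v\<in>V. (z v)\<^sup>2)"
  have "(z u)\<^sup>2 \<le> N" unfolding N_def using fin u(1) by (intro member_le_sum) auto
  then have N: "0 < N" using zu by simp
  have qE: "quad V E z = rG * N" unfolding N_def by (rule rayleigh_eigenfunction[OF zeig])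
  have "rT * N \<le> rG * N" using rG(3) N by simp
  then have eqs: "quad V (fan_edges u w rs) z = rT * N" "quad V E z = quad V (fan_edges u w rs) z"
    using qE qle ray[of z] unfolding N_def by linarith+
  have eigF: "(\<Sum>r\<in>neigh (fan_edges u w rs) v. z r) = rT * z v" if "v \<in> V" for v
    by (rule rayleigh_maximum_eigenfunction[OF sgF ray eqs(1)[unfolded N_def] that])
  have zpos: "0 < z v" if "v \<in> V" for v
  proof (rule fan_eigenfunction_positive[OF dist])
    show "rs \<noteq> []" using len n2 by auto
    show "\<exists>v\<in>set (u # w # rs). 0 < z v" using zu by simp
  qed (use z01 eigF that Vrs in auto)
  have "E = fan_edges u w rs" by (rule qeq[OF zpos eqs(2)])
  then show ?thesis
    using image_imp_digraph_iso[OF pg pair_graph_extremal, of f m] finj VT ET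
    unfolding V_def E_def m_def by simp
qed

theorem corollary1p1:
  fixes n :: nat
  assumes "real n \<ge> 4.5 * 10 ^ 6"
  shows "planar_graph_of_order n (complete_graph 2 \<nabla> path_graph (n - 2)) \<and>
    (\<forall>G :: 'a pair_pre_digraph. planar_graph_of_order n G \<longrightarrow>
       graph_spectral_radius G \<le> graph_spectral_radius (complete_graph 2 \<nabla> path_graph (n - 2)) \<and>
       (graph_spectral_radius G = graph_spectral_radius (complete_graph 2 \<nabla> path_graph (n - 2))
        \<longleftrightarrow> digraph_iso (with_proj G) (with_proj (complete_graph 2 \<nabla> path_graph (n - 2)))))"
proof -
  let ?T = "extremal (n - 2)"
  have n: "4500000 \<le> real n" using assms by simp
  have "distinct (Inl 0 # Inl 1 # map Inr [0..<n - 2] :: (nat + nat) list)" by (auto simp: distinct_map)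
  from distinct_card[OF this] have "card (pverts ?T) = n" unfolding pverts_extremal using n by simp
  then have T: "planar_graph_of_order n ?T"
    unfolding planar_graph_of_order_def using pair_graph_extremal planar_extremal by simp
  have "graph_spectral_radius G \<le> graph_spectral_radius ?T \<and>
       (graph_spectral_radius G = graph_spectral_radius ?T \<longleftrightarrow> digraph_iso (with_proj G) (with_proj ?T))"
    if G: "planar_graph_of_order n G" for G :: "'a pair_pre_digraph"
  proof -
    have pg: "pair_graph G" and "card (pverts G) = n" using G unfolding planar_graph_of_order_def by simp_all
    then have ne: "pverts G \<noteq> {}" using n by auto
    have iso_eq: "graph_spectral_radius G = graph_spectral_radius ?T" if iso: "digraph_iso (with_proj G) (with_proj ?T)"
      using digraph_iso_imp_image[OF pg iso] graph_spectral_radius_image[OF pg pair_graph_extremal ne] by metis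
    \<comment> \<open>The upper bound follows as well: a radius above that of the extremal graph
      would imply isomorphism, and therefore equality.\<close>
    show ?thesis
      using large_radius_imp_extremal[OF n G] iso_eq by (metis linorder_le_cases order_refl)
  qed
  then show ?thesis using T unfolding extremal_def by blast
qed

end
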